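(* Let $\mathbf{G}=(J,\mu,E)$ and $\mathbf{G}^*=(J^*,\mu^*,E^* )$ be a pair of dual planar graphings with canonical measure-preserving Borel bijection $\sigma:E\to E^*$, and let $<$ be an arbitrary Borel total order on $E$. Then the measure $\eta_{\mathbf{G}}|_{\mathcal{T}^<_w}$ of the wired maximal spanning forest $\mathcal{T}^<_w$ is an exposed point of $\mathsf{bmm}_+(\rho_{\mathbf{G}})$, while the measure corresponding to the free maximal spanning forest $\mathcal{T}^<_f$, namely $A^*\mapsto\eta_{\mathbf{G}}(\sigma^{-1}(A^* )\cap\mathcal{T}^<_f)$ on $E^*$, is an exposed point of $\mathsf{bmm}_+(\rho^*_{\mathbf{G}^*})$.
   Context: A graphing $\mathbf{H}=(X,\nu,E_{\mathbf{H}})$: $X$ a standard Borel space with finite measure $\nu$ (a probability measure for $\mathbf{G}$), $E_{\mathbf{H}}\subseteq\binom{X}{2}$ Borel with bounded degrees, satisfying $\int_A\deg(B,x)\,d\nu(x)=\int_B\deg(A,x)\,d\nu(x)$ for measurable $A,B$. Edge measure $\eta_{\mathbf{H}}(F)=\frac12\int\deg_F(x)\,d\nu(x)$. Rank $\rho_{\mathbf{H}}(F)=\int_X\big(1-\frac{1}{|V(\mathbf{H}^F_x)|}\big)\,d\nu(x)$, where $\mathbf{H}^F_x$ is the component of $x$ in $(X,\nu,F)$ and $1/\infty=0$. Cocycle rank $\rho^*_{\mathbf{H}}(A)=\rho_{\mathbf{H}}(E_{\mathbf{H}}\setminus A)+\eta_{\mathbf{H}}(A)-\rho_{\mathbf{H}}(E_{\mathbf{H}})$.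 For a setfunction $\varphi$ on Borel subsets of $E_{\mathbf{H}}$ with $\varphi\le\eta_{\mathbf{H}}$, $\mathsf{bmm}_+(\varphi)$ is the set of measures $\alpha$ on $E_{\mathbf{H}}$ with $0\le\alpha(A)\le\varphi(A)$ for all Borel $A$ and $\alpha(E_{\mathbf{H}})=\varphi(E_{\mathbf{H}})$; these are identified with their Radon–Nikodym derivatives in $L^1(E_{\mathbf{H}},\eta_{\mathbf{H}})$ with the weak topology, and a point $v$ of this convex set is exposed if some continuous linear functional attains its maximum over the set uniquely at $v$. Planar graphings: $\mathbf{G}$ is a graphing whose components are 2-vertex-connected planar graphs with planar embeddings encoded in a Borel way by their facial cycles; vertex sets have no accumulation points, and all faces are finite cycles of uniformly bounded length. The dual $\mathbf{G}^*=(J^*,\mu^*,E^* )$ has vertex set the faces of $\mathbf{G}$, with Borel bijection $\sigma:E\to E^*$, $e\mapsto e^*$, $e^*$ joining the two faces containing $e$; $\mu^*$ makes $\mathbf{G}^*$ a graphing with $\sigma$ measure preserving from $\eta_{\mathbf{G}}$ to $\eta_{\mathbf{G}^*}$. Free/wired maximal spanning forests: given a Borel total order $<$ on $E$, the free maximal spanning forest $\mathcal{T}^<_f$ is obtained by simultaneously deleting every edge $e$ for which there is a cycle $C$ of $\mathbf{G}$ containing $e$ in which $e$ is $<$-minimal. The wired maximal spanning forest $\mathcal{T}^<_w$ is obtained by additionally deleting every edge that is $<$-minimal on some two-way infinite simple path containing it. *)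

theory Defs
  imports "HOL-Analysis.Analysis" "HOL-Library.Uprod"
begin

section \<open>Edges as unordered pairs, with the induced Borel structure\<close>

definition upair_space :: "'a measure \<Rightarrow> 'a uprod measure" where
  "upair_space M = sigma UNIV
     {A. (\<lambda>p. Upair (fst p) (snd p)) -` A \<inter> space (M \<Otimes>\<^sub>M M) \<in> sets (M \<Otimes>\<^sub>M M)}"

text \<open>Borel subsets of the edge set E.\<close>
definition edge_space :: "'a measure \<Rightarrow> 'a uprod set \<Rightarrow> 'a uprod measure" where
  "edge_space M E = restrict_space (upair_space M) E"

definition nbhd :: "'a uprod set \<Rightarrow> 'a \<Rightarrow> 'a set" where
  "nbhd F x = {y. Upair x y \<in> F}"

text \<open>deg(B,x): number of E-neighbours of x lying in B.\<close>
definition degin :: "'a uprod set \<Rightarrow> 'a set \<Rightarrow> 'a \<Rightarrow> nat" where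
  "degin E B x = card {y \<in> B. Upair x y \<in> E}"

definition graphing :: "'a::topological_space measure \<Rightarrow> 'a uprod set \<Rightarrow> bool" where
  "graphing M E \<longleftrightarrow>
     finite_measure M \<and> sets M = sets borel \<and>
     E \<in> sets (upair_space M) \<and> (\<forall>x. Upair x x \<notin> E) \<and>
     (\<exists>D::nat. \<forall>x. finite (nbhd E x) \<and> card (nbhd E x) \<le> D) \<and>
     (\<forall>A\<in>sets M. \<forall>B\<in>sets M.
        (\<integral>\<^sup>+x\<in>A. ennreal (real (degin E B x)) \<partial>M) =
        (\<integral>\<^sup>+x\<in>B. ennreal (real (degin E A x)) \<partial>M))"

section \<open>Edge measure, rank, cocycle rank\<close>

definition eta :: "'a measure \<Rightarrow> 'a uprod set \<Rightarrow> 'a uprod set \<Rightarrow> real" where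
  "eta M E F = (\<integral>x. real (card (nbhd (F \<inter> E) x)) \<partial>M) / 2"

definition adj :: "'a uprod set \<Rightarrow> ('a \<times> 'a) set" where
  "adj F = {(a, b). Upair a b \<in> F}"

text \<open>Vertex set of the component of x in (X, F).\<close>
definition gcomp :: "'a uprod set \<Rightarrow> 'a \<Rightarrow> 'a set" where
  "gcomp F x = {y. (x, y) \<in> (adj F)\<^sup>*}"

text \<open>Note: card of an infinite set is 0 and 1/0 = 0, matching the convention 1/\<infinity> = 0.\<close>
definition grank :: "'a measure \<Rightarrow> 'a uprod set \<Rightarrow> 'a uprod set \<Rightarrow> real" where
  "grank M E F = (\<integral>x. (1 - 1 / real (card (gcomp (F \<inter> E) x))) \<partial>M)"

definition corank :: "'a measure \<Rightarrow> 'a uprod set \<Rightarrow> 'a uprod set \<Rightarrow> real" where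
  "corank M E A = grank M E (E - A) + eta M E A - grank M E E"

section \<open>Base polytope bmm_+ and exposed points\<close>

definition bmm :: "'a measure \<Rightarrow> 'a uprod set \<Rightarrow> ('a uprod set \<Rightarrow> real) \<Rightarrow> 'a uprod measure set" where
  "bmm M E \<phi> = {\<alpha>. sets \<alpha> = sets (edge_space M E) \<and> finite_measure \<alpha> \<and>
       (\<forall>A\<in>sets \<alpha>. measure \<alpha> A \<le> \<phi> A) \<and> measure \<alpha> E = \<phi> E}"

text \<open>Exposed point of bmm_+(phi) in L^1(E, eta) with the weak topology: the continuous linear
  functionals are integration against L^\<infinity> functions, represented by bounded Borel g.\<close>
definition exposed_point :: "'a measure \<Rightarrow> 'a uprod set \<Rightarrow> ('a uprod set \<Rightarrow> real) \<Rightarrow> 'a uprod measure \<Rightarrow> bool" where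
  "exposed_point M E \<phi> v \<longleftrightarrow> v \<in> bmm M E \<phi> \<and>
     (\<exists>g::'a uprod \<Rightarrow> real. g \<in> borel_measurable (edge_space M E) \<and> bounded (range g) \<and>
        (\<forall>\<alpha>\<in>bmm M E \<phi>. (\<integral>e. g e \<partial>\<alpha>) \<le> (\<integral>e. g e \<partial>v) \<and>
                          ((\<integral>e. g e \<partial>\<alpha>) = (\<integral>e. g e \<partial>v) \<longrightarrow> \<alpha> = v)))"

section \<open>Cycles, bi-infinite paths, maximal spanning forests\<close>

definition cycle_edges :: "'a list \<Rightarrow> 'a uprod set" where
  "cycle_edges cs = {Upair (cs ! i) (cs ! ((i + 1) mod length cs)) | i. i < length cs}"

definition is_cycle :: "'a uprod set \<Rightarrow> 'a list \<Rightarrow> bool" where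
  "is_cycle E cs \<longleftrightarrow> length cs \<ge> 3 \<and> distinct cs \<and> cycle_edges cs \<subseteq> E"

text \<open>R is the strict order: (e, e') \<in> R means e < e'.\<close>
definition free_msf :: "'a uprod set \<Rightarrow> ('a uprod \<times> 'a uprod) set \<Rightarrow> 'a uprod set" where
  "free_msf E R = E - {e. \<exists>cs. is_cycle E cs \<and> e \<in> cycle_edges cs \<and>
                              (\<forall>e'\<in>cycle_edges cs. e' \<noteq> e \<longrightarrow> (e, e') \<in> R)}"

definition biinf_path_edges :: "(int \<Rightarrow> 'a) \<Rightarrow> 'a uprod set" where
  "biinf_path_edges p = range (\<lambda>i. Upair (p i) (p (i + 1)))"

definition wired_msf :: "'a uprod set \<Rightarrow> ('a uprod \<times> 'a uprod) set \<Rightarrow> 'a uprod set" where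
  "wired_msf E R = free_msf E R -
     {e. \<exists>p::int \<Rightarrow> 'a. inj p \<and> biinf_path_edges p \<subseteq> E \<and> e \<in> biinf_path_edges p \<and>
            (\<forall>e'\<in>biinf_path_edges p. e' \<noteq> e \<longrightarrow> (e, e') \<in> R)}"

definition borel_total_order :: "'a measure \<Rightarrow> 'a uprod set \<Rightarrow> ('a uprod \<times> 'a uprod) set \<Rightarrow> bool" where
  "borel_total_order M E R \<longleftrightarrow> R \<subseteq> E \<times> E \<and> strict_linear_order_on E R \<and>
     R \<in> sets (edge_space M E \<Otimes>\<^sub>M edge_space M E)"

section \<open>Planar graphings and their duals\<close>

definition two_connected :: "'a uprod set \<Rightarrow> 'a set \<Rightarrow> bool" where
  "two_connected E C \<longleftrightarrow> \<not> (finite C \<and> card C \<le> 2) \<and>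
     (\<forall>v\<in>C. \<forall>x\<in>C - {v}. \<forall>y\<in>C - {v}. (x, y) \<in> (adj E \<inter> (C - {v}) \<times> (C - {v}))\<^sup>*)"

text \<open>Facial cycle of face f: the vertices fcyc f 0, ..., fcyc f (flen f - 1).\<close>
definition face_list :: "('f \<Rightarrow> nat \<Rightarrow> 'a) \<Rightarrow> ('f \<Rightarrow> nat) \<Rightarrow> 'f \<Rightarrow> 'a list" where
  "face_list fcyc flen f = map (fcyc f) [0..<flen f]"

text \<open>The component C (with faces {f. fcyc f 0 \<in> C}) has a planar embedding in the plane
  with vertex set without accumulation points, whose faces (components of the complement)
  correspond bijectively to the given faces, each bounded by its facial cycle.\<close>
definition planar_component ::
    "'a uprod set \<Rightarrow> ('f \<Rightarrow> nat \<Rightarrow> 'a) \<Rightarrow> ('f \<Rightarrow> nat) \<Rightarrow> 'a set \<Rightarrow> bool" where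
  "planar_component E fcyc flen C \<longleftrightarrow>
     (\<exists>(pos::'a \<Rightarrow> complex) (\<gamma>::'a \<Rightarrow> 'a \<Rightarrow> real \<Rightarrow> complex).
        inj_on pos C \<and>
        (\<forall>r. finite {x\<in>C. norm (pos x) \<le> r}) \<and>
        (\<forall>a\<in>C. \<forall>b\<in>C. Upair a b \<in> E \<longrightarrow>
            arc (\<gamma> a b) \<and> pathstart (\<gamma> a b) = pos a \<and> pathfinish (\<gamma> a b) = pos b \<and>
            path_image (\<gamma> a b) = path_image (\<gamma> b a) \<and>
            path_image (\<gamma> a b) \<inter> pos ` C = {pos a, pos b}) \<and>
        (\<forall>a\<in>C. \<forall>b\<in>C. \<forall>c\<in>C. \<forall>d\<in>C. Upair a b \<in> E \<longrightarrow> Upair c d \<in> E \<longrightarrow>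
            Upair a b \<noteq> Upair c d \<longrightarrow>
            path_image (\<gamma> a b) \<inter> path_image (\<gamma> c d) \<subseteq> pos ` ({a, b} \<inter> {c, d})) \<and>
        (\<exists>\<Phi>. bij_betw \<Phi> {f. fcyc f 0 \<in> C}
                 (components (- (pos ` C \<union>
                    \<Union>{path_image (\<gamma> a b) | a b. a \<in> C \<and> b \<in> C \<and> Upair a b \<in> E}))) \<and>
              (\<forall>f. fcyc f 0 \<in> C \<longrightarrow>
                 frontier (\<Phi> f) =
                   \<Union>{path_image (\<gamma> a b) | a b. Upair a b \<in> cycle_edges (face_list fcyc flen f)})))"

definition dual_planar_graphings ::
    "'a::topological_space measure \<Rightarrow> 'a uprod set \<Rightarrow>
     'f::topological_space measure \<Rightarrow> 'f uprod set \<Rightarrow>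
     ('f \<Rightarrow> nat \<Rightarrow> 'a) \<Rightarrow> ('f \<Rightarrow> nat) \<Rightarrow> ('a uprod \<Rightarrow> 'f uprod) \<Rightarrow> bool" where
  "dual_planar_graphings M E Ms Es fcyc flen \<sigma> \<longleftrightarrow>
     graphing M E \<and> emeasure M (space M) = 1 \<and> graphing Ms Es \<and>
     \<comment> \<open>components: 2-connected, planar, embedded with the given facial cycles\<close>
     (\<forall>x. two_connected E (gcomp E x) \<and> planar_component E fcyc flen (gcomp E x)) \<and>
     \<comment> \<open>faces are finite cycles of uniformly bounded length, encoded in a Borel way\<close>
     (\<forall>f. is_cycle E (face_list fcyc flen f)) \<and>
     (\<exists>L. \<forall>f. flen f \<le> L) \<and>
     flen \<in> measurable Ms (count_space UNIV) \<and>
     (\<forall>i. (\<lambda>f. fcyc f i) \<in> measurable Ms M) \<and>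
     \<comment> \<open>the canonical bijection: e* joins the two faces containing e\<close>
     bij_betw \<sigma> E Es \<and>
     (\<forall>e\<in>E. \<exists>f g. f \<noteq> g \<and> {h. e \<in> cycle_edges (face_list fcyc flen h)} = {f, g} \<and>
                  \<sigma> e = Upair f g) \<and>
     \<sigma> \<in> measurable (edge_space M E) (edge_space Ms Es) \<and>
     the_inv_into E \<sigma> \<in> measurable (edge_space Ms Es) (edge_space M E) \<and>
     (\<forall>A\<in>sets (edge_space M E). eta Ms Es (\<sigma> ` A) = eta M E A)"

section \<open>The two measures in the theorem\<close>

definition wired_measure :: "'a measure \<Rightarrow> 'a uprod set \<Rightarrow> ('a uprod \<times> 'a uprod) set \<Rightarrow> 'a uprod measure" where
  "wired_measure M E R =
     measure_of E (sets (edge_space M E)) (\<lambda>A. ennreal (eta M E (A \<inter> wired_msf E R)))"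

definition free_dual_measure ::
    "'a measure \<Rightarrow> 'a uprod set \<Rightarrow> 'f measure \<Rightarrow> 'f uprod set \<Rightarrow> ('a uprod \<Rightarrow> 'f uprod) \<Rightarrow>
     ('a uprod \<times> 'a uprod) set \<Rightarrow> 'f uprod measure" where
  "free_dual_measure M E Ms Es \<sigma> R =
     measure_of Es (sets (edge_space Ms Es))
       (\<lambda>A. ennreal (eta M E ((\<sigma> -` A \<inter> E) \<inter> free_msf E R)))"

end

theory Submission
  imports Defs
begin

text \<open>
  Let \<open>T\<close> be a Borel set of edges with \<open>\<eta>(A \<inter> T) \<le> \<phi>(A) \<le> \<eta>(A)\<close> for all Borel \<open>A\<close> and
  \<open>\<eta>(T) = \<phi>(E)\<close>. Then the indicator function of \<open>T\<close> exposes the restriction of \<open>\<eta>\<close> to \<open>T\<close>, so no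
  weight function realising the given order is needed, and everything reduces to a rank computation.

  By compactness an edge \<open>e\<close> lies in the wired forest iff its endpoints lie in different clusters of
  the graph of the edges above \<open>e\<close>, at least one of which is finite. Lowering the threshold, a vertex
  \<open>z\<close> sees an increasing sequence of finite clusters. When the cluster of \<open>z\<close> grows from \<open>S\<close> to \<open>S'\<close>,
  the forest edge responsible sends mass \<open>1/|S| - 1/|S'|\<close> to \<open>z\<close>. Each forest edge sends total
  mass 1, each vertex receives \<open>1 - 1/|V(G\<^sub>z)|\<close>, and mass transport gives \<open>\<eta>(T) = \<rho>(E)\<close>.
  The same identity for Borel subgraphs \<open>F\<close> yields \<open>\<rho>(F) \<le> \<eta>(F)\<close>, and, since a subset of the wired
  forest of \<open>E\<close> is its own wired forest, also \<open>\<eta>(F \<inter> T) \<le> \<rho>(F)\<close>.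

  In the plane, \<open>e\<close> is minimal on a cycle iff its dual edge is the extreme edge of a finite cut of the
  dual graph. Hence the complement of the free forest is dual to the wired forest of the dual graphing
  for the reversed order, and the claim on the cocycle rank follows by complementation.

  All integrals are over Borel functions, so the numbers of neighbours and the cluster sizes have
  to be Borel; this rests on the Lusin--Souslin theorem.
\<close>

text \<open>The order on the edges may be dense, so lowering the threshold is not a process with
  successive steps. Cluster size stays discrete: for every n, a vertex whose component has more than
  n vertices leaves its clusters of size at most n through exactly one oriented edge. Weights
  1/(n(n+1)) recover the differences 1/|S| - 1/|S'| by telescoping, and each single n is an ordinary
  mass transport problem. Measurability is not a formality here. The Bochner integral of a
  nonmeasurable function is 0 by convention, so \<open>eta\<close> and \<open>grank\<close> carry no
  information until degrees and component sizes are known to be Borel. A graphing supplies only a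
  Borel set of pairs with bounded sections, and projections of Borel sets need not be Borel.
  Injective projections are, and listing each section in increasing order produces that injectivity.
  In the plane, one direction of the duality is parity of facial boundaries. The other needs a cycle
  to separate the two faces at an edge; this comes from comparing the cycle, near one point of the
  edge, with the facial cycle that bounds one of these faces.\<close>

section \<open>The Lusin--Souslin theorem\<close>

text \<open>Sequences of reals play the role of Baire space: a natural number is coded by its image in
  the reals, whose range is closed and uniformly discrete.\<close>

definition closed_lift :: "'a::topological_space set \<Rightarrow> ('a \<times> (nat \<Rightarrow> real)) set \<Rightarrow> bool" where
  "closed_lift B C \<longleftrightarrow> closed C \<and> inj_on fst C \<and> fst ` C = B"

lemma continuous_on_snd_coord [continuous_intros]:
  "continuous_on S (\<lambda>p::'a::topological_space \<times> ('i \<Rightarrow> 'b::topological_space). snd p k)"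
  by (rule continuous_on_product_then_coordinatewise[OF continuous_on_snd[OF continuous_on_id]])

lemma closed_lift_closed:
  fixes B :: "'a::metric_space set"
  assumes "closed B" shows "closed_lift B (B \<times> {\<lambda>_. 0})"
  using assms unfolding closed_lift_def
  by (auto simp: inj_on_def image_iff intro!: closed_Times)

text \<open>The extra coordinate records the reciprocal of the distance to the complement. It
  diverges at the boundary, so the equation \<open>infdist * t = 1\<close> defines a closed set. The
  whole space is treated apart because \<open>infdist\<close> to the empty set is 0.\<close>

lemma closed_lift_open:
  fixes U :: "'a::metric_space set"
  assumes "open U" shows "\<exists>C. closed_lift U C"
proof (cases "U = UNIV")
  case True
  then show ?thesis using closed_lift_closed[of U] by auto
next
  case False
  define C where "C = {p::'a \<times> (nat \<Rightarrow> real). infdist (fst p) (-U) * snd p 0 = 1} \<inter>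
     {p. snd p = (\<lambda>n. if n = 0 then snd p 0 else 0)}"
  have "closed C" unfolding C_def
    by (intro closed_Int closed_Collect_eq continuous_intros continuous_on_coordinatewise_then_product)
       (case_tac "i = 0"; simp add: continuous_on_snd_coord)
  moreover have "inj_on fst C"
  proof (rule inj_onI)
    fix p q assume p: "p \<in> C" and q: "q \<in> C" and pq: "fst p = fst q"
    have "infdist (fst p) (-U) * snd p 0 = infdist (fst p) (-U) * snd q 0" "infdist (fst p) (-U) \<noteq> 0"
      using p q pq unfolding C_def by auto
    then have "snd p 0 = snd q 0" by simp
    moreover have "snd p = (\<lambda>n. if n = 0 then snd p 0 else 0)" "snd q = (\<lambda>n. if n = 0 then snd q 0 else 0)"
      using p q unfolding C_def by blast+
    ultimately have "snd p = snd q" by metis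
    then show "p = q" using pq by (simp add: prod_eq_iff)
  qed
  moreover have "fst ` C = U"
  proof (intro set_eqI iffI)
    fix x assume "x \<in> fst ` C"
    then have "infdist x (-U) \<noteq> 0" unfolding C_def by auto
    then show "x \<in> U" by (metis ComplI infdist_zero)
  next
    fix x assume x: "x \<in> U"
    have "infdist x (-U) \<noteq> 0"
      using in_closed_iff_infdist_zero[of "-U" x] assms False x by (auto simp: closed_Compl)
    then have "(x, \<lambda>n. if n = 0 then 1 / infdist x (-U) else 0) \<in> C"
      unfolding C_def by auto
    then show "x \<in> fst ` C" by force
  qed
  ultimately show ?thesis unfolding closed_lift_def by blast
qed

text \<open>One witness sequence for each \<open>n\<close> is interleaved into a single sequence by
  \<open>prod_encode\<close>; closedness and uniqueness are checked on each subsequence.\<close>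

lemma closed_lift_INT:
  assumes "\<And>n::nat. \<exists>C. closed_lift (B n) C"
  shows "\<exists>C. closed_lift (\<Inter>n. B n) C"
proof -
  obtain C where C: "\<And>n. closed_lift (B n) (C n)" using assms by metis
  define sec where "sec n p = (fst p, \<lambda>m. snd p (prod_encode (n, m)))" for n and p :: "'a \<times> (nat \<Rightarrow> real)"
  define K where "K = (\<Inter>n. sec n -` C n)"
  have cont: "continuous_on UNIV (sec n)" for n
    unfolding sec_def
    by (intro continuous_on_Pair continuous_on_fst continuous_on_id continuous_on_coordinatewise_then_product
        continuous_on_snd_coord)
  have "closed K" unfolding K_def
    by (intro closed_INT ballI closed_vimage cont) (use C in \<open>auto simp: closed_lift_def\<close>)
  moreover have "inj_on fst K"
  proof (rule inj_onI)
    fix p q assume p: "p \<in> K" and q: "q \<in> K" and pq: "fst p = fst q"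
    have "sec n p = sec n q" for n
    proof -
      have "sec n p \<in> C n" "sec n q \<in> C n" "fst (sec n p) = fst (sec n q)"
        using p q pq by (auto simp: K_def sec_def)
      then show ?thesis using C[of n] unfolding closed_lift_def by (meson inj_onD)
    qed
    then have "snd p (prod_encode (n, m)) = snd q (prod_encode (n, m))" for n m
      unfolding sec_def by (auto simp: fun_eq_iff)
    then have "snd p k = snd q k" for k
      by (metis prod_decode_inverse surj_pair)
    then show "p = q" using pq by (simp add: prod_eq_iff fun_eq_iff)
  qed
  moreover have "fst ` K = (\<Inter>n. B n)"
  proof (intro set_eqI iffI)
    fix x assume "x \<in> fst ` K"
    then obtain p where p: "p \<in> K" "x = fst p" by auto
    have "x \<in> B n" for n
    proof -
      have "sec n p \<in> C n" using p by (auto simp: K_def)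
      then have "fst (sec n p) \<in> B n" using C[of n] by (auto simp: closed_lift_def)
      then show ?thesis using p by (simp add: sec_def)
    qed
    then show "x \<in> (\<Inter>n. B n)" by auto
  next
    fix x assume x: "x \<in> (\<Inter>n. B n)"
    have "\<exists>t. (x, t) \<in> C n" for n
    proof -
      have "x \<in> fst ` C n" using x C[of n] by (auto simp: closed_lift_def)
      then show ?thesis by force
    qed
    then obtain t where t: "\<And>n. (x, t n) \<in> C n" by metis
    have "(x, \<lambda>k. t (fst (prod_decode k)) (snd (prod_decode k))) \<in> K"
      using t by (auto simp: K_def sec_def)
    then show "x \<in> fst ` K" by force
  qed
  ultimately show ?thesis unfolding closed_lift_def by blast
qed

text \<open>The leading coordinate names the member of the family that contains the point.
  Disjointness makes this name unique, so the projection stays injective.\<close>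

lemma closed_lift_disjoint_UN:
  assumes "\<And>n::nat. \<exists>C. closed_lift (B n) C" "disjoint_family B"
  shows "\<exists>C. closed_lift (\<Union>n. B n) C"
proof -
  obtain C where C: "\<And>n. closed_lift (B n) (C n)" using assms(1) by metis
  define sh where "sh p = (fst p, \<lambda>m. snd p (Suc m))" for p :: "'a \<times> (nat \<Rightarrow> real)"
  have cont: "continuous_on UNIV sh"
    unfolding sh_def
    by (intro continuous_on_Pair continuous_on_fst continuous_on_id continuous_on_coordinatewise_then_product
        continuous_on_snd_coord)
  have cont0: "continuous_on UNIV (\<lambda>p::'a \<times> (nat \<Rightarrow> real). snd p 0)"
    by (rule continuous_on_snd_coord)
  \<comment> \<open>The union over \<open>n\<close> is rewritten as an intersection of closed
    conditions: distinct naturals are at distance at least 1, so a natural leading coordinate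
    satisfies the first alternative for every \<open>n\<close> but itself.\<close>
  define K where "K = (\<lambda>p. snd p 0) -` \<nat> \<inter> (\<Inter>n. {p. 1 \<le> \<bar>snd p 0 - real n\<bar>} \<union> sh -` C n)"
  have K: "p \<in> K \<longleftrightarrow> (\<exists>n. snd p 0 = real n \<and> sh p \<in> C n)" for p
  proof
    assume p: "p \<in> K"
    then obtain n where n: "snd p 0 = real n" by (auto simp: K_def Nats_def)
    have "p \<in> {p. 1 \<le> \<bar>snd p 0 - real n\<bar>} \<union> sh -` C n" using p unfolding K_def by blast
    then show "\<exists>n. snd p 0 = real n \<and> sh p \<in> C n" using n by auto
  next
    assume "\<exists>n. snd p 0 = real n \<and> sh p \<in> C n"
    then obtain n where n: "snd p 0 = real n" "sh p \<in> C n" by auto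
    have "1 \<le> \<bar>real n - real m\<bar>" if "m \<noteq> n" for m
      using that by linarith
    then show "p \<in> K" using n by (auto simp: K_def) metis
  qed
  have "closed K" unfolding K_def
    by (intro closed_Int closed_INT ballI closed_Un closed_vimage cont cont0 closed_Nats
         closed_Collect_le continuous_intros)
       (use C in \<open>auto simp: closed_lift_def\<close>)
  moreover have "inj_on fst K"
  proof (rule inj_onI)
    fix p q assume p: "p \<in> K" and q: "q \<in> K" and pq: "fst p = fst q"
    obtain n where n: "snd p 0 = real n" "sh p \<in> C n" using K p by auto
    obtain m where m: "snd q 0 = real m" "sh q \<in> C m" using K q by auto
    have "fst (sh p) \<in> B n" "fst (sh q) \<in> B m" using n m C[of n] C[of m] by (auto simp: closed_lift_def)
    then have "fst p \<in> B n" "fst p \<in> B m" using pq by (auto simp: sh_def)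
    then have nm: "n = m" using assms(2) by (auto simp: disjoint_family_on_def)
    have "fst (sh p) = fst (sh q)" using pq by (simp add: sh_def)
    then have "sh p = sh q" using C[of n] n m nm unfolding closed_lift_def by (meson inj_onD)
    then have "snd p (Suc k) = snd q (Suc k)" for k by (auto simp: sh_def fun_eq_iff)
    moreover have "snd p 0 = snd q 0" using n m nm by simp
    ultimately have "snd p k = snd q k" for k by (cases k) auto
    then show "p = q" using pq by (simp add: prod_eq_iff fun_eq_iff)
  qed
  moreover have "fst ` K = (\<Union>n. B n)"
  proof (intro set_eqI iffI)
    fix x assume "x \<in> fst ` K"
    then obtain p where p: "p \<in> K" "x = fst p" by auto
    then obtain n where n: "snd p 0 = real n" "sh p \<in> C n" using K by auto
    then have "fst (sh p) \<in> B n" using C[of n] by (auto simp: closed_lift_def)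
    then show "x \<in> (\<Union>n. B n)" using p by (auto simp: sh_def)
  next
    fix x assume "x \<in> (\<Union>n. B n)"
    then obtain n where "x \<in> B n" by auto
    then have "x \<in> fst ` C n" using C[of n] by (auto simp: closed_lift_def)
    then obtain t where t: "(x, t) \<in> C n" by force
    have "(x, \<lambda>k. if k = 0 then real n else t (k - 1)) \<in> K"
      unfolding K using t by (auto simp: sh_def)
    then show "x \<in> fst ` K" by force
  qed
  ultimately show ?thesis unfolding closed_lift_def by blast
qed

text \<open>Injectivity survives countable intersections and disjoint unions only. A general union
  must be made disjoint first, which uses complements, so the induction treats a set together with
  its complement.\<close>

lemma borel_closed_lift:
  fixes B :: "'a::metric_space set"
  assumes "B \<in> sets borel" shows "\<exists>C. closed_lift B C"
proof -
  have "B \<in> sigma_sets UNIV {S. open S}" using assms by (simp add: borel_def)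
  then have "(\<exists>C. closed_lift B C) \<and> (\<exists>C. closed_lift (-B) C)"
  proof induction
    case (Basic a)
    then have "open a" "closed (-a)" by auto
    then show ?case by (meson closed_lift_open closed_lift_closed)
  next
    case Empty
    then show ?case using closed_lift_closed[of "{}::'a set"] closed_lift_closed[of "UNIV::'a set"] by auto
  next
    case (Compl a)
    then show ?case by (simp add: Compl_eq_Diff_UNIV[symmetric])
  next
    case (Union a)
    have "\<exists>C. closed_lift (disjointed a n) C" for n
    proof -
      have eq: "disjointed a n = (\<Inter>k. if k < n then - a k else a n)"
      proof (intro set_eqI iffI)
        fix x assume "x \<in> (\<Inter>k. if k < n then - a k else a n)"
        then have *: "x \<in> (if k < n then - a k else a n)" for k by blast
        from *[of n] *[THEN if_split[of "\<lambda>S. x \<in> S", THEN iffD1]] show "x \<in> disjointed a n"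
          by (auto simp: disjointed_def)
      qed (auto simp: disjointed_def)
      have "\<exists>C. closed_lift (if k < n then - a k else a n) C" for k using Union by auto
      then show ?thesis unfolding eq by (rule closed_lift_INT)
    qed
    then have "\<exists>C. closed_lift (\<Union>n. disjointed a n) C"
      by (rule closed_lift_disjoint_UN) (rule disjoint_family_disjointed)
    moreover have "\<exists>C. closed_lift (\<Inter>n. - a n) C" using Union by (intro closed_lift_INT) auto
    ultimately show ?case by (simp add: UN_disjointed_eq Compl_UN)
  qed
  then show ?thesis ..
qed

section \<open>Separation of disjoint images by Borel sets\<close>

definition borel_separated :: "'a::topological_space set \<Rightarrow> 'a set \<Rightarrow> bool" where
  "borel_separated P Q \<longleftrightarrow> (\<exists>B\<in>sets borel. P \<subseteq> B \<and> B \<inter> Q = {})"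

lemma borel_separated_UN:
  assumes "\<And>(m::nat) (n::nat). borel_separated (P m) (Q n)"
  shows "borel_separated (\<Union>m. P m) (\<Union>n. Q n)"
proof -
  obtain B where B: "\<And>m n. B m n \<in> sets borel" "\<And>m n. P m \<subseteq> B m n" "\<And>m n. B m n \<inter> Q n = {}"
    using assms unfolding borel_separated_def by metis
  have "(\<Inter>n. B m n) \<in> sets borel" for m
    using B(1) by (intro sets.countable_INT) auto
  then have "(\<Union>m. \<Inter>n. B m n) \<in> sets borel" by (intro sets.countable_UN) auto
  moreover have "(\<Union>m. P m) \<subseteq> (\<Union>m. \<Inter>n. B m n)" using B(2) by blast
  moreover have "(\<Union>m. \<Inter>n. B m n) \<inter> (\<Union>n. Q n) = {}" using B(3) by blast
  ultimately show ?thesis unfolding borel_separated_def by blast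
qed

lemma small_cball_cover:
  obtains d :: "nat \<Rightarrow> 's::{metric_space,second_countable_topology}"
  where "\<And>r. r > 0 \<Longrightarrow> (\<Union>k. cball (d k) r) = UNIV"
proof -
  obtain D :: "'s set" where D: "countable D" "\<And>X. open X \<Longrightarrow> X \<noteq> {} \<Longrightarrow> \<exists>d\<in>D. d \<in> X"
    by (erule countable_dense_setE)
  have ne: "D \<noteq> {}" using D(2)[of UNIV] by auto
  have "(\<Union>k. cball (from_nat_into D k) r) = UNIV" if "r > 0" for r
  proof -
    have "\<exists>k. x \<in> cball (from_nat_into D k) r" for x
    proof -
      obtain y where y: "y \<in> D" "y \<in> ball x r" using D(2)[of "ball x r"] \<open>r > 0\<close> by auto
      obtain k where "from_nat_into D k = y" using from_nat_into_surj[OF D(1) y(1)] by auto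
      then show ?thesis using y by (auto simp: dist_commute intro!: exI[of _ k])
    qed
    then show ?thesis by auto
  qed
  then show ?thesis using that by blast
qed

lemma cball_half_pow_small:
  assumes "e > 0" obtains n where "\<And>x y z::'a::metric_space. x \<in> cball z ((1/2)^n) \<Longrightarrow> y \<in> cball z ((1/2)^n) \<Longrightarrow> dist x y < e"
proof -
  obtain n where n: "(1/2)^n < e/2" using real_arch_pow_inv[of "e/2" "1/2"] assms by auto
  have "dist x y < e" if "x \<in> cball z ((1/2)^n)" "y \<in> cball z ((1/2)^n)" for x y z :: 'a
    using that n dist_triangle[of x y z] by (auto simp: dist_commute)
  then show ?thesis using that by blast
qed

text \<open>If the images were inseparable, \<open>borel_separated_UN\<close> would leave an
  inseparable pair of pieces of radius \<open>(1/2)^n\<close> at every stage. The pieces shrink to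
  points \<open>a\<close> and \<open>b\<close> of \<open>A\<close> and \<open>B\<close> by
  completeness, and disjoint neighbourhoods of \<open>f a\<close> and \<open>g b\<close> separate
  the images of late pieces after all.\<close>

theorem lusin_separation:
  fixes f g :: "'s::{complete_space,second_countable_topology} \<Rightarrow> 'y::t2_space"
  assumes "closed A" "closed B" and f: "continuous_on UNIV f" and g: "continuous_on UNIV g"
    and disj: "f ` A \<inter> g ` B = {}"
  shows "borel_separated (f ` A) (g ` B)"
proof (rule ccontr)
  assume neg: "\<not> ?thesis"
  obtain d :: "nat \<Rightarrow> 's" where d: "\<And>r. r > 0 \<Longrightarrow> (\<Union>k. cball (d k) r) = UNIV"
    using small_cball_cover by blast
  define bad where "bad S T \<longleftrightarrow> closed S \<and> closed T \<and> \<not> borel_separated (f ` S) (g ` T)" for S T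
  define P where "P n X \<longleftrightarrow> bad (fst X) (snd X)" for n :: nat and X
  define Q where "Q n X Y \<longleftrightarrow> (\<exists>k l. fst Y = fst X \<inter> cball (d k) ((1/2)^n) \<and> snd Y = snd X \<inter> cball (d l) ((1/2)^n))" for n :: nat and X Y
  have "\<exists>X. P 0 X \<and> X = (A, B)" using assms neg by (auto simp: P_def bad_def)
  moreover have "\<exists>Y. P (Suc n) Y \<and> Q n X Y" if "P n X" for n X
  proof (rule ccontr)
    assume no: "\<nexists>Y. P (Suc n) Y \<and> Q n X Y"
    have "borel_separated (f ` (fst X \<inter> cball (d k) ((1/2)^n))) (g ` (snd X \<inter> cball (d l) ((1/2)^n)))" for k l
      using no that unfolding P_def Q_def bad_def
      by (metis closed_Int closed_cball fst_conv snd_conv)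
    then have "borel_separated (\<Union>k. f ` (fst X \<inter> cball (d k) ((1/2)^n))) (\<Union>l. g ` (snd X \<inter> cball (d l) ((1/2)^n)))"
      by (rule borel_separated_UN)
    moreover have "(\<Union>k. f ` (fst X \<inter> cball (d k) ((1/2)^n))) = f ` fst X"
      unfolding image_UN[symmetric] Int_UN_distrib[symmetric] by (simp add: d)
    moreover have "(\<Union>k. g ` (snd X \<inter> cball (d k) ((1/2)^n))) = g ` snd X"
      unfolding image_UN[symmetric] Int_UN_distrib[symmetric] by (simp add: d)
    ultimately show False using that by (simp add: P_def bad_def)
  qed
  ultimately obtain X where X: "\<And>n. P n (X n)" "X 0 = (A, B)" "\<And>n. Q n (X n) (X (Suc n))"
    using dependent_nat_choice[of "\<lambda>n Y. P n Y \<and> (n = 0 \<longrightarrow> Y = (A, B))" Q] by (metis Zero_not_Suc)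
  have dec: "fst (X n) \<subseteq> fst (X m) \<and> snd (X n) \<subseteq> snd (X m)" if "m \<le> n" for m n
    using that
  proof (induction rule: dec_induct)
    case (step n)
    then show ?case using X(3)[of n] unfolding Q_def by blast
  qed auto
  have ne: "fst (X n) \<noteq> {}" "snd (X n) \<noteq> {}" for n
    using X(1)[of n] unfolding P_def bad_def borel_separated_def by auto
  have cl: "closed (fst (X n))" "closed (snd (X n))" for n
    using X(1)[of n] unfolding P_def bad_def by auto
  have small: "\<exists>n. (\<forall>x\<in>fst (X n). \<forall>y\<in>fst (X n). dist x y < e) \<and> (\<forall>x\<in>snd (X n). \<forall>y\<in>snd (X n). dist x y < e)"
    if "e > 0" for e
  proof -
    obtain n where n: "\<And>x y z::'s. x \<in> cball z ((1/2)^n) \<Longrightarrow> y \<in> cball z ((1/2)^n) \<Longrightarrow> dist x y < e"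
      using cball_half_pow_small[OF \<open>e > 0\<close>] by blast
    show ?thesis
      using X(3)[of n] n unfolding Q_def by (intro exI[of _ "Suc n"]) auto
  qed
  obtain a where a: "\<And>n. a \<in> fst (X n)"
    by (rule decreasing_closed_nest[of "\<lambda>n. fst (X n)"]) (use cl ne dec small in blast)+
  obtain b where b: "\<And>n. b \<in> snd (X n)"
    by (rule decreasing_closed_nest[of "\<lambda>n. snd (X n)"]) (use cl ne dec small in blast)+
  have "f a \<noteq> g b" using a[of 0] b[of 0] X(2) disj by auto
  then obtain U V where UV: "open U" "open V" "f a \<in> U" "g b \<in> V" "U \<inter> V = {}"
    using hausdorff by metis
  obtain e1 where e1: "e1 > 0" "ball a e1 \<subseteq> f -` U"
    using open_vimage[OF UV(1) f] UV(3) openE by blast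
  obtain e2 where e2: "e2 > 0" "ball b e2 \<subseteq> g -` V"
    using open_vimage[OF UV(2) g] UV(4) openE by blast
  obtain n where n: "\<forall>x\<in>fst (X n). \<forall>y\<in>fst (X n). dist x y < min e1 e2"
     "\<forall>x\<in>snd (X n). \<forall>y\<in>snd (X n). dist x y < min e1 e2"
    using small[of "min e1 e2"] e1 e2 by auto
  have "f ` fst (X n) \<subseteq> U" using n(1) a[of n] e1(2) by (auto simp: subset_eq)
  moreover have "g ` snd (X n) \<subseteq> V" using n(2) b[of n] e2(2) by (auto simp: subset_eq)
  ultimately have "borel_separated (f ` fst (X n)) (g ` snd (X n))"
    unfolding borel_separated_def using UV by (intro bexI[of _ U]) auto
  then show False using X(1)[of n] by (simp add: P_def bad_def)
qed

text \<open>Closed lifts turn Borel domains into closed ones, at the price of replacing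
  \<open>h\<close> by \<open>h \<circ> fst\<close>.\<close>

lemma borel_separated_images:
  fixes h :: "'s::{complete_space,second_countable_topology} \<Rightarrow> 'y::t2_space"
  assumes "A \<in> sets borel" "B \<in> sets borel" "continuous_on UNIV h" "h ` A \<inter> h ` B = {}"
  shows "borel_separated (h ` A) (h ` B)"
proof -
  obtain C D where C: "closed_lift A C" and D: "closed_lift B D"
    using borel_closed_lift assms by metis
  have "continuous_on UNIV (h \<circ> fst :: 's \<times> (nat \<Rightarrow> real) \<Rightarrow> 'y)"
    by (intro continuous_on_compose continuous_intros continuous_on_subset[OF assms(3)]) auto
  then have "borel_separated ((h \<circ> fst) ` C) ((h \<circ> fst) ` D)"
    using C D assms(4) unfolding closed_lift_def by (intro lusin_separation) (simp_all only: image_comp[symmetric])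
  then show ?thesis using C D unfolding closed_lift_def image_comp[symmetric] by simp
qed

text \<open>The space is cut into Borel cells of shrinking diameter, indexed by finite sequences.
  Injectivity makes the images of disjoint cells disjoint, so they have disjoint Borel enclosures
  \<open>D s\<close> inside the closures of the images. A point that lies in enclosures of every
  length picks out one branch of cells, and this branch converges to its preimage.\<close>

theorem lusin_souslin:
  fixes h :: "'s::{complete_space,second_countable_topology} \<Rightarrow> 'y::metric_space"
  assumes C: "closed C" and h: "continuous_on UNIV h" and inj: "inj_on h C"
  shows "h ` C \<in> sets borel"
proof -
  obtain d :: "nat \<Rightarrow> 's" where d: "\<And>r. r > 0 \<Longrightarrow> (\<Union>k. cball (d k) r) = UNIV"
    using small_cball_cover by blast
  define c where "c n = disjointed (\<lambda>k. cball (d k) ((1/2)^n))" for n :: nat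
  have cb: "c n k \<in> sets borel" for n k
    unfolding c_def disjointed_def by (intro sets.Diff sets.finite_UN) auto
  have cU: "(\<Union>k. c n k) = UNIV" for n unfolding c_def UN_disjointed_eq by (simp add: d)
  have cd: "k = l" if "x \<in> c n k" "x \<in> c n l" for n k l x
    using that disjoint_family_disjointed[of "\<lambda>k. cball (d k) ((1/2)^n)"]
    unfolding c_def disjoint_family_on_def by blast
  have csub: "c n k \<subseteq> cball (d k) ((1/2)^n)" for n k unfolding c_def by (rule disjointed_subset)
  define CC where "CC s = C \<inter> (\<Inter>i\<in>{..<length s}. c i (s ! i))" for s :: "nat list"
  have CCi: "x \<in> CC s \<longleftrightarrow> x \<in> C \<and> (\<forall>i<length s. x \<in> c i (s ! i))" for x s
    by (auto simp: CC_def)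
  have CCb: "CC s \<in> sets borel" for s
  proof (cases "s = []")
    case True
    then show ?thesis using C by (simp add: CC_def)
  next
    case False
    then show ?thesis unfolding CC_def using C cb by (intro sets.Int sets.finite_INT) auto
  qed
  have "\<exists>B. B \<in> sets borel \<and> (CC s \<inter> CC t = {} \<longrightarrow> h ` CC s \<subseteq> B \<and> B \<inter> h ` CC t = {})" for s t
  proof (cases "CC s \<inter> CC t = {}")
    case True
    have "h ` CC s \<inter> h ` CC t = h ` (CC s \<inter> CC t)"
      using inj by (intro inj_on_image_Int[symmetric]) (auto simp: CC_def)
    then have "borel_separated (h ` CC s) (h ` CC t)"
      using True CCb h by (intro borel_separated_images) auto
    then show ?thesis unfolding borel_separated_def by blast
  qed auto
  then obtain S where S: "\<And>s t. S s t \<in> sets borel"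
     "\<And>s t. CC s \<inter> CC t = {} \<Longrightarrow> h ` CC s \<subseteq> S s t \<and> S s t \<inter> h ` CC t = {}" by metis
  \<comment> \<open>Using the separator of each pair in both orders makes \<open>D s\<close> and
    \<open>D t\<close> disjoint; the intersection is countable because \<open>t\<close> ranges over
    lists of naturals.\<close>
  define D where "D s = closure (h ` CC s) \<inter> (\<Inter>t. if CC s \<inter> CC t = {} then S s t \<inter> - S t s else UNIV)" for s
  have Db: "D s \<in> sets borel" for s
    unfolding D_def using S(1)
    by (intro sets.Int sets.countable_INT'') (auto intro!: borel_comp)
  have hD: "h ` CC s \<subseteq> D s" for s
  proof -
    have "h ` CC s \<subseteq> S s t \<inter> - S t s" if "CC s \<inter> CC t = {}" for t
      using S(2)[of s t] S(2)[of t s] that by blast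
    then show ?thesis unfolding D_def using closure_subset[of "h ` CC s"] by (auto split: if_splits)
  qed
  have Dd: "D s \<inter> D t = {}" if "CC s \<inter> CC t = {}" for s t
  proof -
    have "CC t \<inter> CC s = {}" using that by blast
    then have "D t \<subseteq> - S s t" unfolding D_def by (auto split: if_splits)
    moreover have "D s \<subseteq> S s t" using that unfolding D_def by (auto split: if_splits)
    ultimately show ?thesis by blast
  qed
  have CCd: "CC s \<inter> CC t = {}" if st: "length s = length t" "s \<noteq> t" for s t
  proof -
    obtain i where "i < length s" "s ! i \<noteq> t ! i" using st by (meson nth_equalityI)
    then have "CC s \<subseteq> c i (s ! i)" "CC t \<subseteq> c i (t ! i)" using st(1) by (auto simp: CC_def)
    then show ?thesis using cd \<open>s ! i \<noteq> t ! i\<close> by blast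
  qed
  define K where "K = (\<Inter>n. \<Union>s\<in>{s. length s = n}. \<Inter>i\<in>{..n}. D (take i s))"
  have "(\<Inter>i\<in>{..n}. D (take i s)) \<in> sets borel" for n s
    by (intro sets.finite_INT Db) auto
  then have "K \<in> sets borel" unfolding K_def
    by (intro sets.countable_INT'' sets.countable_UN') auto
  moreover have "h ` C \<subseteq> K"
  proof
    fix y assume "y \<in> h ` C"
    then obtain x where x: "x \<in> C" "y = h x" by auto
    have "\<exists>k. x \<in> c n k" for n using cU[of n] by blast
    then obtain b where b: "\<And>n. x \<in> c n (b n)" by metis
    have "x \<in> CC (map b [0..<n])" for n using x b by (auto simp: CC_def)
    then have "y \<in> D (map b [0..<n])" for n using hD x by blast
    moreover have "take i (map b [0..<n]) = map b [0..<i]" if "i \<le> n" for i n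
      using that by (simp add: take_map)
    ultimately have "\<exists>s. length s = n \<and> (\<forall>i\<le>n. y \<in> D (take i s))" for n
      by (intro exI[of _ "map b [0..<n]"]) simp
    then show "y \<in> K" unfolding K_def INT_iff UN_iff mem_Collect_eq atMost_iff Ball_def Bex_def by blast
  qed
  moreover have "K \<subseteq> h ` C"
  proof
    fix y assume "y \<in> K"
    then have "\<exists>s. length s = n \<and> (\<forall>i\<le>n. y \<in> D (take i s))" for n
      unfolding K_def INT_iff UN_iff mem_Collect_eq atMost_iff Ball_def Bex_def by blast
    then obtain s where s: "\<And>n. length (s n) = n" "\<And>n i. i \<le> n \<Longrightarrow> y \<in> D (take i (s n))" by metis
    \<comment> \<open>A different prefix of the same length would put \<open>y\<close> into two
      disjoint enclosures, so the sequences found for separate \<open>n\<close> are initial segments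
      of a single branch.\<close>
    have tk: "take i (s n) = s i" if "i \<le> n" for i n
    proof (rule ccontr)
      assume "take i (s n) \<noteq> s i"
      then have "D (take i (s n)) \<inter> D (s i) = {}" using s(1) that by (intro Dd CCd) auto
      moreover have "y \<in> D (take i (s n))" "y \<in> D (s i)" using s(2)[OF that] s(2)[of i i] s(1) by auto
      ultimately show False by blast
    qed
    have ycl: "y \<in> closure (h ` CC (s n))" for n
      using s(2)[of n n] s(1) by (simp add: D_def)
    have dec: "CC (s n) \<subseteq> CC (s m)" if "m \<le> n" for m n
    proof -
      have "s n ! i = s m ! i" if "i < m" for i
        using tk[OF \<open>m \<le> n\<close>] that by (metis nth_take)
      note eq = this
      show ?thesis
      proof
        fix x assume x: "x \<in> CC (s n)"
        have "x \<in> c i (s m ! i)" if "i < m" for i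
        proof -
          have "x \<in> c i (s n ! i)" using x \<open>m \<le> n\<close> that by (simp add: CCi s(1))
          then show ?thesis using eq[OF that] by simp
        qed
        then show "x \<in> CC (s m)" using x by (simp add: CCi s(1))
      qed
    qed
    have small: "\<exists>n. \<forall>x\<in>closure (CC (s n)). \<forall>y\<in>closure (CC (s n)). dist x y < e" if "e > 0" for e
    proof -
      obtain n where n: "\<And>x y z::'s. x \<in> cball z ((1/2)^n) \<Longrightarrow> y \<in> cball z ((1/2)^n) \<Longrightarrow> dist x y < e"
        using cball_half_pow_small[OF \<open>e > 0\<close>] by blast
      have "CC (s (Suc n)) \<subseteq> cball (d (s (Suc n) ! n)) ((1/2)^n)"
        using csub[of n "s (Suc n) ! n"] by (auto simp: CCi s(1))
      then have "closure (CC (s (Suc n))) \<subseteq> cball (d (s (Suc n) ! n)) ((1/2)^n)"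
        by (rule closure_minimal) simp
      then have "\<forall>x\<in>closure (CC (s (Suc n))). \<forall>y\<in>closure (CC (s (Suc n))). dist x y < e"
        using n by (meson subsetD)
      then show ?thesis ..
    qed
    obtain a where a: "\<And>n. a \<in> closure (CC (s n))"
    proof (rule decreasing_closed_nest[of "\<lambda>n. closure (CC (s n))"])
      show "closure (CC (s n)) \<noteq> {}" for n using ycl[of n] by auto
      show "closure (CC (s n)) \<subseteq> closure (CC (s m))" if "m \<le> n" for m n
        using dec[OF that] by (rule closure_mono)
    qed (use small in auto)
    have "closure (CC (s 0)) \<subseteq> C" using C by (intro closure_minimal) (auto simp: CC_def)
    then have "a \<in> C" using a by blast
    \<comment> \<open>By continuity the images of late cells lie close to \<open>h a\<close>, while
      \<open>y\<close> lies in the closure of each of them.\<close>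
    moreover have "h a = y"
    proof (rule ccontr)
      assume ne: "h a \<noteq> y"
      define e where "e = dist (h a) y / 2"
      have "e > 0" using ne by (simp add: e_def)
      obtain r where r: "r > 0" "ball a r \<subseteq> h -` ball (h a) e"
        using openE[OF open_vimage[OF open_ball h], of a "h a" e] \<open>e > 0\<close> by auto
      obtain n where "\<forall>x\<in>closure (CC (s n)). \<forall>y\<in>closure (CC (s n)). dist x y < r" using small[OF r(1)] by auto
      then have "CC (s n) \<subseteq> ball a r" using a[of n] closure_subset[of "CC (s n)"] by (auto simp: subset_eq)
      then have "h ` CC (s n) \<subseteq> cball (h a) e" using r(2) by (auto simp: subset_eq less_imp_le)
      then have "closure (h ` CC (s n)) \<subseteq> cball (h a) e" by (rule closure_minimal) simp
      then have "dist (h a) y \<le> e" using ycl[of n] by auto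
      then show False using \<open>e > 0\<close> by (simp add: e_def)
    qed
    ultimately show "y \<in> h ` C" by blast
  qed
  ultimately show ?thesis by (metis subset_antisym)
qed

text \<open>The first projection is composed with that of a closed lift; the composite is continuous
  and injective on a closed set, where \<open>lusin_souslin\<close> applies.\<close>

corollary borel_fst_image:
  fixes B :: "('a::{complete_space,second_countable_topology} \<times> 'b::{complete_space,second_countable_topology}) set"
  assumes "B \<in> sets borel" "inj_on fst B"
  shows "fst ` B \<in> sets borel"
proof -
  obtain C where C: "closed_lift B C" using borel_closed_lift assms(1) by blast
  have "(fst \<circ> fst) ` C \<in> sets borel"
    using C assms(2) unfolding closed_lift_def
    by (intro lusin_souslin comp_inj_on) (auto intro!: continuous_intros simp: o_def)
  then show ?thesis using C unfolding closed_lift_def image_comp[symmetric] by simp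
qed

section \<open>Borel enumeration of bounded sections\<close>

text \<open>With digits 0 and 1 in base 3, the first differing digit contributes
  \<open>(1/3)^n\<close>, while all later digits together contribute at most half of that. Base 2
  would allow ties.\<close>

lemma ternary_expansion_inj:
  fixes a b :: "nat \<Rightarrow> bool"
  assumes "(\<Sum>n. of_bool (a n) * (1/3)^n :: real) = (\<Sum>n. of_bool (b n) * (1/3)^n)"
  shows "a = b"
proof (rule ccontr)
  assume "a \<noteq> b"
  then obtain n0 where "a n0 \<noteq> b n0" by auto
  define n where "n = (LEAST n. a n \<noteq> b n)"
  have n: "a n \<noteq> b n" unfolding n_def using \<open>a n0 \<noteq> b n0\<close> by (rule LeastI)
  have less: "a m = b m" if "m < n" for m using not_less_Least that unfolding n_def by blast
  define d :: "nat \<Rightarrow> real" where "d m = of_bool (a m) - of_bool (b m)" for m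
  have geo: "summable (\<lambda>m. (1/3::real)^m)" by (rule summable_geometric) simp
  have sa: "summable (\<lambda>m. of_bool (c m) * (1/3::real)^m)" for c
    by (rule summable_comparison_test[OF _ geo]) (auto intro!: exI[of _ 0])
  have sd: "summable (\<lambda>m. d m * (1/3)^m)"
    using summable_diff[OF sa[of a] sa[of b]] by (simp add: d_def algebra_simps)
  have "(\<Sum>m. d m * (1/3)^m) = 0"
    using suminf_diff[OF sa[of a] sa[of b]] assms by (simp add: d_def algebra_simps)
  moreover have "(\<Sum>m. d m * (1/3)^m) = (\<Sum>m. d (m + Suc n) * (1/3)^(m + Suc n)) + (\<Sum>m<Suc n. d m * (1/3)^m)"
    by (rule suminf_split_initial_segment[OF sd])
  moreover have "(\<Sum>m<Suc n. d m * (1/3)^m) = d n * (1/3)^n"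
    using less by (simp add: d_def)
  ultimately have "\<bar>d n * (1/3)^n\<bar> = \<bar>\<Sum>m. d (m + Suc n) * (1/3)^(m + Suc n)\<bar>" by linarith
  also have "\<dots> \<le> (\<Sum>m. (1/3)^m * (1/3)^Suc n)"
  proof -
    have le: "\<bar>d (m + Suc n) * (1/3)^(m + Suc n)\<bar> \<le> (1/3)^m * (1/3)^Suc n" for m
      by (auto simp: d_def abs_mult power_add)
    have s2: "summable (\<lambda>m. (1/3::real)^m * (1/3)^Suc n)" by (rule summable_mult2[OF geo])
    have s1: "summable (\<lambda>m. \<bar>d (m + Suc n) * (1/3)^(m + Suc n)\<bar>)"
      using le by (intro summable_comparison_test[OF _ s2]) (auto intro!: exI[of _ 0])
    have "\<bar>\<Sum>m. d (m + Suc n) * (1/3)^(m + Suc n)\<bar> \<le> (\<Sum>m. \<bar>d (m + Suc n) * (1/3)^(m + Suc n)\<bar>)"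
      by (rule summable_rabs[OF s1])
    also have "\<dots> \<le> (\<Sum>m. (1/3)^m * (1/3)^Suc n)" by (rule suminf_le[OF le s1 s2])
    finally show ?thesis .
  qed
  also have "\<dots> = (1/3)^n / 2"
    by (subst suminf_mult2[OF geo, symmetric], subst suminf_geometric) auto
  also have "\<bar>d n * (1/3)^n\<bar> = (1/3)^n" using n by (auto simp: d_def)
  finally show False by simp
qed

text \<open>A point is coded by the members of a countable basis that contain it. Its purpose is to
  give every section a linear order that is compatible with the Borel structure.\<close>

lemma borel_injection_to_real:
  obtains \<phi> :: "'a::{t2_space,second_countable_topology} \<Rightarrow> real"
  where "\<phi> \<in> borel_measurable borel" "inj \<phi>"
proof -
  obtain \<B> :: "'a set set" where B: "countable \<B>" "topological_basis \<B>"
    using ex_countable_basis by auto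
  have ne: "\<B> \<noteq> {}" using topological_basisE[OF B(2) open_UNIV] by blast
  define U where "U = from_nat_into \<B>"
  have op: "open (U n)" for n
    unfolding U_def using topological_basis_open[OF B(2)] from_nat_into[OF ne] by auto
  define \<phi> where "\<phi> x = (\<Sum>n. of_bool (x \<in> U n) * (1/3::real)^n)" for x
  have [measurable]: "U n \<in> sets borel" for n using op by simp
  have "\<phi> \<in> borel_measurable borel" unfolding \<phi>_def
    by (intro borel_measurable_suminf borel_measurable_times) (auto simp: of_bool_def)
  moreover have "inj \<phi>"
  proof (rule injI, rule ccontr)
    fix x y assume eq: "\<phi> x = \<phi> y" and "x \<noteq> y"
    then obtain V where V: "open V" "x \<in> V" "y \<notin> V" using t1_space by metis
    obtain W where W: "W \<in> \<B>" "x \<in> W" "W \<subseteq> V" using topological_basisE[OF B(2) V(1,2)] by blast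
    obtain n where "U n = W" using from_nat_into_surj[OF B(1) W(1)] unfolding U_def by auto
    moreover have "(\<lambda>n. x \<in> U n) = (\<lambda>n. y \<in> U n)"
      using eq unfolding \<phi>_def by (rule ternary_expansion_inj)
    then have "x \<in> U n \<longleftrightarrow> y \<in> U n" by meson
    ultimately show False using W V by auto
  qed
  ultimately show ?thesis using that by blast
qed

lemma pred_borel_eq [measurable (raw)]:
  fixes g h :: "'b \<Rightarrow> 'a::{second_countable_topology,t2_space}"
  assumes [measurable]: "g \<in> borel_measurable N" "h \<in> borel_measurable N"
  shows "Measurable.pred N (\<lambda>x. g x = h x)"
proof -
  have "closed {p::'a \<times> 'a. fst p = snd p}"
    by (intro closed_Collect_eq continuous_intros)
  then have [measurable]: "Measurable.pred borel (\<lambda>p::'a \<times> 'a. fst p = snd p)"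
    by (simp add: pred_def)
  have "Measurable.pred N (\<lambda>x. fst (g x, h x) = snd (g x, h x))"
    by measurable
  then show ?thesis by simp
qed

text \<open>An increasing choice of \<open>k\<close> points from a section is forced only if the
  section has exactly \<open>k\<close> points. Over such base points the projection is injective,
  hence Borel. Base points with larger sections have to be removed beforehand, which is why sizes
  are handled from the bound \<open>D\<close> downwards.\<close>

lemma bounded_sections_enumeration:
  fixes B :: "('a::polish_space \<times> 'a) set"
  assumes B: "B \<in> sets borel" and bd: "\<And>x. finite {y. (x, y) \<in> B} \<and> card {y. (x, y) \<in> B} \<le> D"
  obtains f :: "nat \<Rightarrow> 'a \<Rightarrow> 'a" where
    "\<And>i. f i \<in> borel_measurable borel"
    "\<And>x. bij_betw (\<lambda>i. f i x) {..<card {y. (x, y) \<in> B}} {y. (x, y) \<in> B}"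
    "\<And>i x. i \<ge> card {y. (x, y) \<in> B} \<Longrightarrow> f i x = x"
    "(\<lambda>x. card {y. (x, y) \<in> B}) \<in> measurable borel (count_space UNIV)"
proof -
  obtain \<phi> :: "'a \<Rightarrow> real" where \<phi>[measurable]: "\<phi> \<in> borel_measurable borel" and inj: "inj \<phi>"
    using borel_injection_to_real by blast
  define S where "S x = {y. (x, y) \<in> B}" for x
  have fin: "finite (S x)" and cD: "card (S x) \<le> D" for x using bd unfolding S_def by auto
  define L where "L x = sorted_list_of_set (\<phi> ` S x)" for x
  define f where "f i x = (if i < card (S x) then inv \<phi> (L x ! i) else x)" for i x
  have lenL: "length (L x) = card (S x)" for x
    unfolding L_def by (simp add: card_image inj_on_subset[OF inj])
  have setL: "set (L x) = \<phi> ` S x" for x unfolding L_def using fin by simp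
  have sortL: "sorted_wrt (<) (L x)" for x unfolding L_def by simp
  have phif: "\<phi> (f i x) = L x ! i" if "i < card (S x)" for i x
  proof -
    have "L x ! i \<in> \<phi> ` S x" using that lenL setL nth_mem by metis
    then show ?thesis using that by (auto simp: f_def f_inv_into_f)
  qed
  have fS: "f i x \<in> S x" if "i < card (S x)" for i x
  proof -
    have "L x ! i \<in> \<phi> ` S x" using that lenL setL nth_mem by metis
    then obtain y where "y \<in> S x" "L x ! i = \<phi> y" by auto
    then show ?thesis using phif[OF that] injD[OF inj, of "f i x" y] by simp
  qed
  \<comment> \<open>Filling the sequence with the base point beyond \<open>k\<close> determines the
    remaining coordinates, so that the whole witness sequence can be unique.\<close>
  define Q where "Q k = {p::'a \<times> (nat \<Rightarrow> 'a). (\<forall>i. i < k \<longrightarrow> (fst p, snd p i) \<in> B) \<and>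
     (\<forall>i j. i < j \<and> j < k \<longrightarrow> \<phi> (snd p i) < \<phi> (snd p j)) \<and> (\<forall>i. k \<le> i \<longrightarrow> snd p i = fst p)}" for k
  have sm[measurable]: "(\<lambda>p::'a \<times> (nat \<Rightarrow> 'a). snd p i) \<in> borel_measurable borel" for i
    by (intro borel_measurable_continuous_onI continuous_on_snd_coord)
  have [measurable]: "fst \<in> borel_measurable (borel :: ('a \<times> (nat \<Rightarrow> 'a)) measure)"
    by (intro borel_measurable_continuous_onI continuous_intros)
  have [measurable]: "Measurable.pred borel (\<lambda>p::'a \<times> (nat \<Rightarrow> 'a). (fst p, snd p i) \<in> B)" for i
    using B by measurable
  have Qb: "Q k \<in> sets borel" for k
  proof -
    have "Measurable.pred borel (\<lambda>p::'a \<times> (nat \<Rightarrow> 'a). (\<forall>i. i < k \<longrightarrow> (fst p, snd p i) \<in> B) \<and>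
     (\<forall>i j. i < j \<and> j < k \<longrightarrow> \<phi> (snd p i) < \<phi> (snd p j)) \<and> (\<forall>i. k \<le> i \<longrightarrow> snd p i = fst p))"
      by measurable
    then show ?thesis by (simp add: pred_def Q_def)
  qed
  have Qf: "(x, \<lambda>i. f i x) \<in> Q (card (S x))" for x
  proof -
    have "\<phi> (f i x) < \<phi> (f j x)" if "i < j" "j < card (S x)" for i j
      using sorted_wrt_nth_less[OF sortL[of x] that(1)] that lenL by (simp add: phif)
    moreover have "(x, f i x) \<in> B" if "i < card (S x)" for i using fS[OF that] by (simp add: S_def)
    moreover have "f i x = x" if "card (S x) \<le> i" for i using that by (simp add: f_def)
    ultimately show ?thesis unfolding Q_def by simp
  qed
  have Qle: "k \<le> card (S x)" and Quniq: "card (S x) = k \<Longrightarrow> t = (\<lambda>i. f i x)" if q: "(x, t) \<in> Q k" for x t k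
  proof -
    have t: "\<And>i. i < k \<Longrightarrow> t i \<in> S x" "\<And>i j. i < j \<Longrightarrow> j < k \<Longrightarrow> \<phi> (t i) < \<phi> (t j)" "\<And>i. k \<le> i \<Longrightarrow> t i = x"
      using q by (auto simp: Q_def S_def)
    have it: "inj_on t {..<k}"
      by (rule linorder_inj_onI) (use t(2) in force)+
    have sub: "t ` {..<k} \<subseteq> S x" using t(1) by auto
    show "k \<le> card (S x)" using card_mono[OF fin sub] card_image[OF it] by simp
    assume k: "card (S x) = k"
    have "t ` {..<k} = S x" using sub k card_image[OF it] by (intro card_subset_eq fin) auto
    then have st: "set (map (\<lambda>i. \<phi> (t i)) [0..<k]) = \<phi> ` S x" by (simp add: atLeast0LessThan image_image[symmetric])
    have "sorted_wrt (<) (map (\<lambda>i. \<phi> (t i)) [0..<k])"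
      using t(2) by (auto simp: sorted_wrt_iff_nth_less)
    then have "map (\<lambda>i. \<phi> (t i)) [0..<k] = L x"
      using st fin unfolding L_def by (metis sorted_list_of_set.idem_if_sorted_distinct strict_sorted_iff)
    then have "\<phi> (t i) = \<phi> (f i x)" if "i < k" for i
      using that phif[of i x] k by (metis (no_types, lifting) add_0 diff_zero length_upt nth_map nth_upt)
    then have "t i = f i x" if "i < k" for i using that inj by (auto simp: inj_def)
    moreover have "t i = f i x" if "k \<le> i" for i using that t(3) k by (auto simp: f_def)
    ultimately have "t i = f i x" for i by (cases "i < k") auto
    then show "t = (\<lambda>i. f i x)" ..
  qed
  have exact: "{x. card (S x) = k} \<inter> {x. f i x \<in> U} \<in> sets borel"
    if N: "{x. Suc k \<le> card (S x)} \<in> sets borel" and U: "U \<in> sets borel" for k i U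
  proof -
    define R where "R = Q k \<inter> fst -` (- {x. Suc k \<le> card (S x)}) \<inter> (\<lambda>p. snd p i) -` U"
    have R: "(x, t) \<in> R \<longleftrightarrow> (x, t) \<in> Q k \<and> card (S x) = k \<and> t i \<in> U" for x t
      using Qle[of x t k] by (auto simp: R_def)
    have "fst -` (- {x. Suc k \<le> card (S x)}) \<in> sets (borel :: ('a \<times> (nat \<Rightarrow> 'a)) measure)"
      using measurable_sets[of fst "borel :: ('a \<times> (nat \<Rightarrow> 'a)) measure" borel "- {x. Suc k \<le> card (S x)}"] N
      by (simp add: borel_comp)
    moreover have "(\<lambda>p. snd p i) -` U \<in> sets (borel :: ('a \<times> (nat \<Rightarrow> 'a)) measure)"
      using measurable_sets[OF sm[of i] U] by simp
    ultimately have "R \<in> sets borel" unfolding R_def using Qb[of k] by (intro sets.Int)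
    moreover have "inj_on fst R"
    proof (rule inj_onI)
      fix p q assume pq: "p \<in> R" "q \<in> R" "fst p = fst q"
      obtain x t t' where eq: "p = (x, t)" "q = (x, t')" using pq(3) by (metis prod.collapse)
      have "t = (\<lambda>i. f i x)" using pq(1) unfolding eq R by (intro Quniq) auto
      moreover have "t' = (\<lambda>i. f i x)" using pq(2) unfolding eq R by (intro Quniq) auto
      ultimately show "p = q" by (simp add: eq)
    qed
    ultimately have "fst ` R \<in> sets borel" by (rule borel_fst_image)
    moreover have "fst ` R = {x. card (S x) = k} \<inter> {x. f i x \<in> U}"
    proof (intro set_eqI iffI)
      fix x assume "x \<in> fst ` R"
      then obtain t where t: "(x, t) \<in> R" by force
      then have "t = (\<lambda>i. f i x)" unfolding R by (intro Quniq) auto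
      then show "x \<in> {x. card (S x) = k} \<inter> {x. f i x \<in> U}" using t unfolding R by simp
    next
      fix x assume "x \<in> {x. card (S x) = k} \<inter> {x. f i x \<in> U}"
      then have "(x, \<lambda>i. f i x) \<in> R" using Qf[of x] unfolding R by simp
      then show "x \<in> fst ` R" by force
    qed
    ultimately show ?thesis by simp
  qed
  \<comment> \<open>Induction on the distance \<open>m\<close> from \<open>Suc D\<close>, a size
    that no section reaches.\<close>
  have ge: "{x. Suc D - m \<le> card (S x)} \<in> sets borel" for m
  proof (induction m)
    case 0
    have "{x. Suc D - 0 \<le> card (S x)} = {}" using cD by (auto simp: not_less_eq_eq)
    then show ?case by simp
  next
    case (Suc m)
    show ?case
    proof (cases "m \<le> D")
      case True
      then have "Suc (Suc D - Suc m) = Suc D - m" by simp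
      then have "{x. card (S x) = Suc D - Suc m} \<inter> {x. f 0 x \<in> UNIV} \<in> sets borel"
        using Suc by (intro exact) auto
      then have "{x. card (S x) = Suc D - Suc m} \<in> sets borel" by simp
      moreover have "{x. Suc D - Suc m \<le> card (S x)} = {x. card (S x) = Suc D - Suc m} \<union> {x. Suc D - m \<le> card (S x)}"
        using True by auto
      ultimately show ?thesis using Suc by auto
    qed auto
  qed
  have ge': "{x. k \<le> card (S x)} \<in> sets borel" for k
  proof (cases "k \<le> Suc D")
    case True
    then show ?thesis using ge[of "Suc D - k"] by simp
  next
    case False
    then have "{x. k \<le> card (S x)} = {}" using cD by (metis (no_types, lifting) Collect_empty_eq le_SucI le_trans)
    then show ?thesis by simp
  qed
  have "f i \<in> borel_measurable borel" for i
  proof (rule measurableI)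
    fix U :: "'a set" assume U: "U \<in> sets borel"
    have "(\<Union>k. {x. card (S x) = k} \<inter> {x. f i x \<in> U}) \<in> sets borel"
      by (rule sets.countable_UN) (use exact[OF ge' U] in blast)
    moreover have "(\<Union>k. {x. card (S x) = k} \<inter> {x. f i x \<in> U}) = f i -` U \<inter> space borel" by auto
    ultimately show "f i -` U \<inter> space borel \<in> sets borel" by simp
  qed simp
  moreover have "(\<lambda>x. card (S x)) \<in> measurable borel (count_space UNIV)"
  proof (subst measurable_count_space_eq2_countable, safe)
    fix k :: nat
    have "{x. card (S x) = k} \<inter> {x. f 0 x \<in> UNIV} \<in> sets borel" using ge' by (intro exact) auto
    then show "(\<lambda>x. card (S x)) -` {k} \<inter> space borel \<in> sets borel" by (simp add: vimage_def)
  qed auto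
  moreover have "bij_betw (\<lambda>i. f i x) {..<card (S x)} (S x)" for x
  proof -
    have "inj_on (\<lambda>i. f i x) {..<card (S x)}"
    proof (rule inj_onI)
      fix i j assume "i \<in> {..<card (S x)}" "j \<in> {..<card (S x)}" "f i x = f j x"
      then have "L x ! i = L x ! j" "i < length (L x)" "j < length (L x)" using phif lenL by (auto, metis)
      moreover have "distinct (L x)" unfolding L_def by simp
      ultimately show "i = j" by (simp add: nth_eq_iff_index_eq)
    qed
    moreover have "(\<lambda>i. f i x) ` {..<card (S x)} = S x"
      using fS card_image[OF calculation] by (intro card_subset_eq fin) auto
    ultimately show ?thesis by (simp add: bij_betw_def)
  qed
  moreover have "f i x = x" if "i \<ge> card (S x)" for i x using that by (simp add: f_def)
  ultimately show ?thesis using that unfolding S_def by blast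
qed

section \<open>Graphings with a Borel enumeration of neighbours\<close>

text \<open>Preimages commute with complements and countable unions, so the generating family is
  already a sigma-algebra and \<open>sigma\<close> adds no sets to it.\<close>

lemma sets_upair_space_iff:
  fixes M :: "'a::{second_countable_topology} measure"
  assumes "sets M = sets borel"
  shows "A \<in> sets (upair_space M) \<longleftrightarrow> adj A \<in> sets borel"
proof -
  define pre where "pre A = (\<lambda>p. Upair (fst p) (snd p)) -` A \<inter> space (M \<Otimes>\<^sub>M M)" for A :: "'a uprod set"
  have sp: "space M = UNIV" using sets_eq_imp_space_eq[OF assms] by simp
  have st: "sets (M \<Otimes>\<^sub>M M) = sets borel"
    using sets_pair_measure_cong[OF assms assms] borel_prod[where 'a='a and 'b='a] by metis
  have pre: "pre A = adj A" for A by (auto simp: pre_def adj_def space_pair_measure sp)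
  have "sets (upair_space M) = sigma_sets UNIV {A. pre A \<in> sets (M \<Otimes>\<^sub>M M)}"
    unfolding upair_space_def pre_def by (rule sets_measure_of) simp
  moreover have "pre A \<in> sets (M \<Otimes>\<^sub>M M)" if "A \<in> sigma_sets UNIV {A. pre A \<in> sets (M \<Otimes>\<^sub>M M)}"
    using that
  proof induction
    case (Compl a)
    have "pre (UNIV - a) = space (M \<Otimes>\<^sub>M M) - pre a" by (auto simp: pre_def)
    then show ?case using Compl by auto
  next
    case (Union a)
    have "pre (\<Union>i. a i) = (\<Union>i. pre (a i))" by (auto simp: pre_def)
    then show ?case using Union by auto
  qed (auto simp: pre_def)
  ultimately have "A \<in> sets (upair_space M) \<longleftrightarrow> pre A \<in> sets (M \<Otimes>\<^sub>M M)"
    using sigma_sets.Basic[of A "{A. pre A \<in> sets (M \<Otimes>\<^sub>M M)}" UNIV] by (metis mem_Collect_eq)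
  then show ?thesis unfolding st pre .
qed

lemma nbhd_eq: "nbhd F x = {y. (x, y) \<in> adj F}" by (simp add: nbhd_def adj_def)

lemma adj_iff [simp]: "(x, y) \<in> adj F \<longleftrightarrow> Upair x y \<in> F" by (simp add: adj_def)

lemma Upair_commute: "Upair x y = Upair y x" by simp

lemma sym_adj: "sym (adj F)" by (auto simp: sym_def Upair_commute)

lemma gcomp_refl [simp]: "x \<in> gcomp F x" by (simp add: gcomp_def)

lemma gcomp_sym: "y \<in> gcomp F x \<Longrightarrow> x \<in> gcomp F y"
  unfolding gcomp_def mem_Collect_eq by (rule symD[OF sym_rtrancl[OF sym_adj]])

lemma gcomp_trans: "y \<in> gcomp F x \<Longrightarrow> z \<in> gcomp F y \<Longrightarrow> z \<in> gcomp F x"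
  unfolding gcomp_def by auto

lemma gcomp_eq: "y \<in> gcomp F x \<Longrightarrow> gcomp F y = gcomp F x"
  using gcomp_trans gcomp_sym by (metis subsetI subset_antisym)

lemma gcomp_mono: "F \<subseteq> G \<Longrightarrow> gcomp F x \<subseteq> gcomp G x"
  unfolding gcomp_def by (auto intro: rtrancl_mono[THEN subsetD, rotated] simp: adj_def)

lemma gcomp_edge: "y \<in> gcomp F x \<Longrightarrow> Upair y z \<in> F \<Longrightarrow> z \<in> gcomp F x"
  unfolding gcomp_def by (auto intro: rtrancl_into_rtrancl)

lemma gcomp_subset_closed:
  assumes "x \<in> S" "\<And>y z. y \<in> S \<Longrightarrow> Upair y z \<in> F \<Longrightarrow> z \<in> S"
  shows "gcomp F x \<subseteq> S"
proof
  fix y assume "y \<in> gcomp F x"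
  then have "(x, y) \<in> (adj F)\<^sup>*" by (simp add: gcomp_def)
  then show "y \<in> S" by (induction) (use assms in auto)
qed

text \<open>The value \<open>f i x = x\<close> marks an index without a neighbour. It cannot be
  mistaken for a neighbour because there are no loops.\<close>

locale borel_graph =
  fixes M :: "'a::polish_space measure" and E :: "'a uprod set" and f :: "nat \<Rightarrow> 'a \<Rightarrow> 'a" and D :: nat
  assumes finite_M: "finite_measure M" and sets_M [measurable_cong]: "sets M = sets borel"
    and adj_E: "adj E \<in> sets (borel \<Otimes>\<^sub>M borel)"
    and no_loops: "\<And>x. Upair x x \<notin> E"
    and finite_nbhd: "\<And>x. finite (nbhd E x)" and card_nbhd: "\<And>x. card (nbhd E x) \<le> D"
    and symm: "\<And>A B. A \<in> sets borel \<Longrightarrow> B \<in> sets borel \<Longrightarrow>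
        (\<integral>\<^sup>+x\<in>A. ennreal (real (degin E B x)) \<partial>M) = (\<integral>\<^sup>+x\<in>B. ennreal (real (degin E A x)) \<partial>M)"
    and f_meas [measurable]: "\<And>i. f i \<in> borel_measurable borel"
    and f_bij: "\<And>x. bij_betw (\<lambda>i. f i x) {..<card (nbhd E x)} (nbhd E x)"
    and f_default: "\<And>i x. card (nbhd E x) \<le> i \<Longrightarrow> f i x = x"
    and deg_meas [measurable]: "(\<lambda>x. card (nbhd E x)) \<in> measurable borel (count_space UNIV)"

lemma graphing_borel_graph:
  fixes M :: "'a::polish_space measure"
  assumes "graphing M E" obtains f D where "borel_graph M E f D"
proof -
  from assms have M: "finite_measure M" "sets M = sets borel" and E: "E \<in> sets (upair_space M)"
    and nl: "\<And>x. Upair x x \<notin> E" and symm: "\<forall>A\<in>sets M. \<forall>B\<in>sets M.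
        (\<integral>\<^sup>+x\<in>A. ennreal (real (degin E B x)) \<partial>M) = (\<integral>\<^sup>+x\<in>B. ennreal (real (degin E A x)) \<partial>M)"
    unfolding graphing_def by blast+
  obtain D where D: "\<And>x. finite (nbhd E x) \<and> card (nbhd E x) \<le> D" using assms unfolding graphing_def by blast
  have adj: "adj E \<in> sets borel" using E sets_upair_space_iff[OF M(2)] by blast
  show ?thesis
  proof (rule bounded_sections_enumeration[OF adj, of D, folded nbhd_eq])
    show "finite (nbhd E x) \<and> card (nbhd E x) \<le> D" for x by (rule D)
    fix f :: "nat \<Rightarrow> 'a \<Rightarrow> 'a"
    assume f: "\<And>i. f i \<in> borel_measurable borel"
      "\<And>x. bij_betw (\<lambda>i. f i x) {..<card (nbhd E x)} (nbhd E x)"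
      "\<And>i x. i \<ge> card (nbhd E x) \<Longrightarrow> f i x = x"
      "(\<lambda>x. card (nbhd E x)) \<in> measurable borel (count_space UNIV)"
    have "adj E \<in> sets (borel \<Otimes>\<^sub>M borel)" using adj by (simp only: borel_prod)
    then show ?thesis using M nl symm D f by (intro that[of f D]) (intro borel_graph.intro, simp_all)
  qed
qed

context borel_graph
begin

lemma space_M [simp]: "space M = UNIV" using sets_eq_imp_space_eq[OF sets_M] by simp

lemma pred_E [measurable (raw)]:
  assumes "a \<in> borel_measurable N" "b \<in> borel_measurable N"
  shows "Measurable.pred N (\<lambda>q. Upair (a q) (b q) \<in> E)"
proof -
  have "Measurable.pred (borel \<Otimes>\<^sub>M borel) (\<lambda>p. p \<in> adj E)" using adj_E by (simp add: pred_def space_pair_measure)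
  from measurable_compose[OF measurable_Pair[OF assms] this] show ?thesis by simp
qed

section \<open>Neighbour sums, reachability and component sizes as Borel data\<close>

lemma nbhd_iff: "y \<in> nbhd E x \<longleftrightarrow> y \<noteq> x \<and> (\<exists>i. y = f i x)"
proof
  assume y: "y \<in> nbhd E x"
  then have "y \<noteq> x" using no_loops by (auto simp: nbhd_def)
  moreover have "y \<in> (\<lambda>i. f i x) ` {..<card (nbhd E x)}" using y f_bij[of x] by (simp add: bij_betw_def)
  ultimately show "y \<noteq> x \<and> (\<exists>i. y = f i x)" by auto
next
  assume "y \<noteq> x \<and> (\<exists>i. y = f i x)"
  then obtain i where i: "y \<noteq> x" "y = f i x" by auto
  then have "i < card (nbhd E x)" using f_default[of x i] by (metis leI)
  then show "y \<in> nbhd E x" using i f_bij[of x] by (auto simp: bij_betw_def)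
qed

lemma edge_iff: "Upair x y \<in> E \<longleftrightarrow> y \<noteq> x \<and> (\<exists>i. y = f i x)"
  using nbhd_iff[of y x] by (simp add: nbhd_def)

text \<open>The range \<open>i < D\<close> is independent of \<open>x\<close>, so neighbour sums of
  Borel weights become finite sums of Borel functions.\<close>

lemma sum_nbhd:
  fixes w :: "'a \<Rightarrow> 'b::comm_monoid_add"
  shows "sum w (nbhd E x) = (\<Sum>i<D. if i < card (nbhd E x) then w (f i x) else 0)"
proof -
  have "sum w (nbhd E x) = (\<Sum>i<card (nbhd E x). w (f i x))"
    using sum.reindex_bij_betw[OF f_bij[of x], of w] by simp
  also have "\<dots> = (\<Sum>i<card (nbhd E x). if i < card (nbhd E x) then w (f i x) else 0)" by simp
  also have "\<dots> = (\<Sum>i<D. if i < card (nbhd E x) then w (f i x) else 0)"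
    using card_nbhd[of x] by (intro sum.mono_neutral_left) auto
  finally show ?thesis .
qed

lemma sum_nbhd_measurable [measurable (raw)]:
  fixes w :: "'p \<Rightarrow> 'a \<Rightarrow> ennreal"
  assumes w: "(\<lambda>q. w (fst q) (snd q)) \<in> borel_measurable (N \<Otimes>\<^sub>M borel)" and [measurable]: "g \<in> borel_measurable N"
  shows "(\<lambda>p. sum (w p) (nbhd E (g p))) \<in> borel_measurable N"
proof -
  have [measurable]: "(\<lambda>p. w p (f i (g p))) \<in> borel_measurable N" for i
    using measurable_compose[OF measurable_Pair[of "\<lambda>p. p" N N "\<lambda>p. f i (g p)" borel] w] by simp
  show ?thesis unfolding sum_nbhd by measurable
qed

text \<open>Words of indices form a countable type, so every component is swept out by countably
  many Borel maps.\<close>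

primrec walk :: "nat list \<Rightarrow> 'a \<Rightarrow> 'a" where
  "walk [] x = x" | "walk (i # w) x = walk w (f i x)"

lemma walk_measurable [measurable]: "walk w \<in> borel_measurable borel"
proof (induction w)
  case (Cons i w)
  from measurable_compose[OF f_meas this] show ?case by simp
qed simp

lemma range_walk: "range (\<lambda>w. walk w x) = gcomp E x"
proof (intro set_eqI iffI)
  fix y assume "y \<in> range (\<lambda>w. walk w x)"
  then obtain w where "y = walk w x" by auto
  then show "y \<in> gcomp E x"
  proof (induction w arbitrary: x)
    case (Cons i w)
    have "f i x \<in> gcomp E x"
    proof (cases "f i x = x")
      case False
      then show ?thesis using edge_iff[of x "f i x"] by (intro gcomp_edge[OF gcomp_refl]) auto
    qed simp
    moreover have "y \<in> gcomp E (f i x)" using Cons by simp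
    ultimately show ?case by (rule gcomp_trans)
  qed simp
next
  fix y assume "y \<in> gcomp E x"
  then have "(x, y) \<in> (adj E)\<^sup>*" by (simp add: gcomp_def)
  then have "\<exists>w. y = walk w x"
  proof (induction rule: converse_rtrancl_induct)
    case base
    then show ?case by (intro exI[of _ "[]"]) simp
  next
    case (step x z)
    then obtain w where "y = walk w z" by auto
    moreover obtain i where "z = f i x" using step(1) edge_iff by auto
    ultimately show ?case by (intro exI[of _ "i # w"]) simp
  qed
  then show "y \<in> range (\<lambda>w. walk w x)" by auto
qed

text \<open>The last vertex but one of a path in \<open>U p\<close> that ends in \<open>y\<close> is
  some \<open>f i y\<close>, because \<open>U p\<close> lies in \<open>E\<close>. The quantifier
  over vertices thus becomes a countable one. The parameter \<open>p\<close> will be the threshold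
  edge.\<close>

lemma gcomp_measurable:
  assumes U: "Measurable.pred (N \<Otimes>\<^sub>M borel \<Otimes>\<^sub>M borel) (\<lambda>q. Upair (fst (snd q)) (snd (snd q)) \<in> U (fst q))"
    and sub: "\<And>p. U p \<subseteq> E"
  shows "Measurable.pred (N \<Otimes>\<^sub>M borel \<Otimes>\<^sub>M borel) (\<lambda>q. snd (snd q) \<in> gcomp (U (fst q)) (fst (snd q)))"
proof -
  have *: "Measurable.pred (N \<Otimes>\<^sub>M borel \<Otimes>\<^sub>M borel) (\<lambda>q. (fst (snd q), snd (snd q)) \<in> adj (U (fst q)) ^^ n)" for n
  proof (induction n)
    case 0
    show ?case unfolding relpow.simps pair_in_Id_conv by measurable
  next
    case (Suc n)
    have eq: "(x, y) \<in> adj (U p) ^^ Suc n \<longleftrightarrow> (\<exists>i. (x, f i y) \<in> adj (U p) ^^ n \<and> Upair (f i y) y \<in> U p)" for p x y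
    proof
      assume "(x, y) \<in> adj (U p) ^^ Suc n"
      then obtain z where z: "(x, z) \<in> adj (U p) ^^ n" "Upair z y \<in> U p" by auto
      then have "Upair y z \<in> E" using sub by (auto simp: Upair_commute)
      then obtain i where "z = f i y" using edge_iff by auto
      then show "\<exists>i. (x, f i y) \<in> adj (U p) ^^ n \<and> Upair (f i y) y \<in> U p" using z by auto
    qed auto
    have 1: "Measurable.pred (N \<Otimes>\<^sub>M borel \<Otimes>\<^sub>M borel) (\<lambda>q. (fst (snd q), f i (snd (snd q))) \<in> adj (U (fst q)) ^^ n)" for i
    proof -
      have "(\<lambda>q. (fst q, fst (snd q), f i (snd (snd q)))) \<in> measurable (N \<Otimes>\<^sub>M borel \<Otimes>\<^sub>M borel) (N \<Otimes>\<^sub>M borel \<Otimes>\<^sub>M borel)"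
        by measurable
      from measurable_compose[OF this Suc] show ?thesis by simp
    qed
    have 2: "Measurable.pred (N \<Otimes>\<^sub>M borel \<Otimes>\<^sub>M borel) (\<lambda>q. Upair (f i (snd (snd q))) (snd (snd q)) \<in> U (fst q))" for i
    proof -
      have "(\<lambda>q. (fst q, f i (snd (snd q)), snd (snd q))) \<in> measurable (N \<Otimes>\<^sub>M borel \<Otimes>\<^sub>M borel) (N \<Otimes>\<^sub>M borel \<Otimes>\<^sub>M borel)"
        by measurable
      from measurable_compose[OF this U] show ?thesis by simp
    qed
    show ?case unfolding eq using 1 2 by measurable
  qed
  have "y \<in> gcomp (U p) x \<longleftrightarrow> (\<exists>n. (x, y) \<in> adj (U p) ^^ n)" for p x y
    unfolding gcomp_def by (simp add: rtrancl_is_UN_relpow)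
  then show ?thesis using * by simp
qed

text \<open>At most \<open>n\<close> words suffice to reach every vertex of the cluster precisely
  when it has at most \<open>n\<close> vertices, and lists of words are countable in number.\<close>

lemma card_gcomp_measurable:
  assumes U: "Measurable.pred (N \<Otimes>\<^sub>M borel \<Otimes>\<^sub>M borel) (\<lambda>q. Upair (fst (snd q)) (snd (snd q)) \<in> U (fst q))"
    and sub: "\<And>p. U p \<subseteq> E"
  shows "Measurable.pred (N \<Otimes>\<^sub>M borel) (\<lambda>q. finite (gcomp (U (fst q)) (snd q)) \<and> card (gcomp (U (fst q)) (snd q)) \<le> n)"
proof -
  have eq: "finite (gcomp (U p) x) \<and> card (gcomp (U p) x) \<le> n \<longleftrightarrow>
    (\<exists>W::nat list list. length W \<le> n \<and> (\<forall>w. walk w x \<in> gcomp (U p) x \<longrightarrow> (\<exists>v. v \<in> set W \<and> walk v x = walk w x)))" for p x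
  proof
    assume fin: "finite (gcomp (U p) x) \<and> card (gcomp (U p) x) \<le> n"
    obtain ys where ys: "set ys = gcomp (U p) x" "distinct ys" using finite_distinct_list fin by blast
    have "\<exists>w. walk w x = y" if "y \<in> gcomp (U p) x" for y
      using that gcomp_mono[OF sub] range_walk[of x] by (metis imageE subsetD)
    then obtain g where g: "\<And>y. y \<in> gcomp (U p) x \<Longrightarrow> walk (g y) x = y" by metis
    have "length (map g ys) \<le> n" using ys fin distinct_card by fastforce
    moreover have "\<forall>w. walk w x \<in> gcomp (U p) x \<longrightarrow> (\<exists>v. v \<in> set (map g ys) \<and> walk v x = walk w x)"
      using g ys(1) by (auto intro!: exI[of _ "g (walk w x)" for w])
    ultimately show "\<exists>W::nat list list. length W \<le> n \<and> (\<forall>w. walk w x \<in> gcomp (U p) x \<longrightarrow> (\<exists>v. v \<in> set W \<and> walk v x = walk w x))"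
      by blast
  next
    assume "\<exists>W::nat list list. length W \<le> n \<and> (\<forall>w. walk w x \<in> gcomp (U p) x \<longrightarrow> (\<exists>v. v \<in> set W \<and> walk v x = walk w x))"
    then obtain W :: "nat list list" where W: "length W \<le> n"
      "\<And>w. walk w x \<in> gcomp (U p) x \<Longrightarrow> (\<exists>v. v \<in> set W \<and> walk v x = walk w x)" by blast
    have sb: "gcomp (U p) x \<subseteq> (\<lambda>v. walk v x) ` set W"
    proof
      fix y assume y: "y \<in> gcomp (U p) x"
      then have "y \<in> range (\<lambda>w. walk w x)" using gcomp_mono[OF sub] range_walk[of x] by blast
      then obtain w where "y = walk w x" by auto
      then show "y \<in> (\<lambda>v. walk v x) ` set W" using W(2)[of w] y by (metis imageI)
    qed
    have "card (gcomp (U p) x) \<le> card ((\<lambda>v. walk v x) ` set W)" by (rule card_mono[OF _ sb]) simp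
    also have "\<dots> \<le> card (set W)" by (rule card_image_le) simp
    also have "\<dots> \<le> length W" by (rule card_length)
    finally show "finite (gcomp (U p) x) \<and> card (gcomp (U p) x) \<le> n"
      using W(1) finite_subset[OF sb] by simp
  qed
  have [measurable]: "Measurable.pred (N \<Otimes>\<^sub>M borel) (\<lambda>q. walk w (snd q) \<in> gcomp (U (fst q)) (snd q))" for w
  proof -
    have "(\<lambda>q. (fst q, snd q, walk w (snd q))) \<in> measurable (N \<Otimes>\<^sub>M borel) (N \<Otimes>\<^sub>M borel \<Otimes>\<^sub>M borel)"
      by measurable
    from measurable_compose[OF this gcomp_measurable[OF U sub]] show ?thesis by simp
  qed
  show ?thesis unfolding eq by measurable
qed

end

section \<open>The mass transport principle\<close>

context borel_graph
begin

text \<open>The symmetry condition of a graphing says that two measures on ordered pairs agree on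
  rectangles. Rectangles are stable under intersection and generate the product sigma-algebra, and
  the degree bound makes the measures finite. Hence they coincide, and so do their
  integrals.\<close>

lemma edge_mass_transport:
  fixes w :: "'a \<Rightarrow> 'a \<Rightarrow> ennreal"
  assumes w: "(\<lambda>p. w (fst p) (snd p)) \<in> borel_measurable (borel \<Otimes>\<^sub>M borel)"
  shows "(\<integral>\<^sup>+x. (\<Sum>y\<in>nbhd E x. w x y) \<partial>M) = (\<integral>\<^sup>+x. (\<Sum>y\<in>nbhd E x. w y x) \<partial>M)"
proof -
  interpret finite_measure M by (rule finite_M)
  define N where "N = count_space {..<D} \<Otimes>\<^sub>M M"
  interpret C: sigma_finite_measure "count_space {..<D}" by (rule sigma_finite_measure_count_space_countable) simp
  interpret P: pair_sigma_finite "count_space {..<D}" M ..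
  \<comment> \<open>The density discards the indices beyond the degree, so pushing forward along
    \<open>g\<close> counts each neighbour once.\<close>
  define h :: "nat \<times> 'a \<Rightarrow> ennreal" where "h q = (if fst q < card (nbhd E (snd q)) then 1 else 0)" for q
  define g where "g q = (snd q, f (fst q) (snd q))" for q :: "nat \<times> 'a"
  have h[measurable]: "h \<in> borel_measurable N"
    unfolding N_def by (rule measurable_pair_measure_countable1) (auto simp: h_def)
  have g[measurable]: "g \<in> measurable N (borel \<Otimes>\<^sub>M borel)"
    unfolding N_def by (rule measurable_pair_measure_countable1) (auto simp: g_def)
  define m where "m = distr (density N h) (borel \<Otimes>\<^sub>M borel) g"
  have int: "(\<integral>\<^sup>+p. u p \<partial>m) = (\<integral>\<^sup>+x. (\<Sum>y\<in>nbhd E x. u (x, y)) \<partial>M)"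
    if u[measurable]: "u \<in> borel_measurable (borel \<Otimes>\<^sub>M borel)" for u
  proof -
    have "(\<integral>\<^sup>+p. u p \<partial>m) = (\<integral>\<^sup>+q. u (g q) \<partial>(density N h))"
      unfolding m_def using g by (intro nn_integral_distr) auto
    also have "\<dots> = (\<integral>\<^sup>+q. h q * u (g q) \<partial>N)"
      by (rule nn_integral_density) measurable
    also have "\<dots> = (\<integral>\<^sup>+x. (\<integral>\<^sup>+i. h (i, x) * u (g (i, x)) \<partial>count_space {..<D}) \<partial>M)"
    proof -
      have "(\<lambda>q. h q * u (g q)) \<in> borel_measurable N" by measurable
      from P.nn_integral_snd[OF this[unfolded N_def]] show ?thesis by (simp add: N_def)
    qed
    also have "\<dots> = (\<integral>\<^sup>+x. (\<Sum>y\<in>nbhd E x. u (x, y)) \<partial>M)"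
      unfolding sum_nbhd
      by (intro nn_integral_cong) (auto simp: nn_integral_count_space_finite h_def g_def intro!: sum.cong)
    finally show ?thesis .
  qed
  have sets_m[simp]: "sets m = sets (borel \<Otimes>\<^sub>M borel)" by (simp add: m_def)
  define m' where "m' = distr m (borel \<Otimes>\<^sub>M borel) (\<lambda>p. (snd p, fst p))"
  have swap: "(\<lambda>p. (snd p, fst p)) \<in> measurable m (borel \<Otimes>\<^sub>M borel)"
    unfolding measurable_cong_sets[OF sets_m refl] by measurable
  have int': "(\<integral>\<^sup>+p. u p \<partial>m') = (\<integral>\<^sup>+x. (\<Sum>y\<in>nbhd E x. u (y, x)) \<partial>M)"
    if u: "u \<in> borel_measurable (borel \<Otimes>\<^sub>M borel)" for u
  proof -
    have "(\<integral>\<^sup>+p. u p \<partial>m') = (\<integral>\<^sup>+p. u (snd p, fst p) \<partial>m)"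
      unfolding m'_def using u by (intro nn_integral_distr[OF swap]) simp
    moreover have "(\<lambda>p. u (snd p, fst p)) \<in> borel_measurable (borel \<Otimes>\<^sub>M borel)" using u by measurable
    from int[OF this] have "(\<integral>\<^sup>+p. u (snd p, fst p) \<partial>m) = (\<integral>\<^sup>+x. (\<Sum>y\<in>nbhd E x. u (y, x)) \<partial>M)" by simp
    ultimately show ?thesis by simp
  qed
  have rect: "emeasure m (A \<times> B) = (\<integral>\<^sup>+x\<in>A. ennreal (real (degin E B x)) \<partial>M)"
    and rect': "emeasure m' (A \<times> B) = (\<integral>\<^sup>+x\<in>B. ennreal (real (degin E A x)) \<partial>M)"
    if [measurable]: "A \<in> sets borel" "B \<in> sets borel" for A B
  proof -
    have AB: "A \<times> B \<in> sets (borel \<Otimes>\<^sub>M borel)" by measurable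
    have d: "(\<Sum>y\<in>nbhd E x. indicator B y :: ennreal) = ennreal (real (degin E B x))" for x B
    proof -
      have "(\<Sum>y\<in>nbhd E x. indicator B y :: ennreal) = of_nat (card (nbhd E x \<inter> B))"
        by (simp add: indicator_def of_bool_def sum.If_cases finite_nbhd)
      also have "nbhd E x \<inter> B = {y \<in> B. Upair x y \<in> E}" by (auto simp: nbhd_def)
      finally show ?thesis by (simp add: degin_def ennreal_of_nat_eq_real_of_nat)
    qed
    have "emeasure m (A \<times> B) = (\<integral>\<^sup>+p. indicator (A \<times> B) p \<partial>m)" using AB by simp
    also have "\<dots> = (\<integral>\<^sup>+x. (\<Sum>y\<in>nbhd E x. indicator (A \<times> B) (x, y)) \<partial>M)" using AB by (intro int) simp
    also have "\<dots> = (\<integral>\<^sup>+x\<in>A. ennreal (real (degin E B x)) \<partial>M)"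
      unfolding d[symmetric] sum_distrib_right by (intro nn_integral_cong sum.cong) (auto simp: indicator_def)
    finally show "emeasure m (A \<times> B) = (\<integral>\<^sup>+x\<in>A. ennreal (real (degin E B x)) \<partial>M)" .
    have "emeasure m' (A \<times> B) = (\<integral>\<^sup>+p. indicator (A \<times> B) p \<partial>m')" using AB by (simp add: m'_def)
    also have "\<dots> = (\<integral>\<^sup>+x. (\<Sum>y\<in>nbhd E x. indicator (A \<times> B) (y, x)) \<partial>M)" using AB by (intro int') simp
    also have "\<dots> = (\<integral>\<^sup>+x\<in>B. ennreal (real (degin E A x)) \<partial>M)"
      unfolding d[symmetric] sum_distrib_right by (intro nn_integral_cong sum.cong) (auto simp: indicator_def)
    finally show "emeasure m' (A \<times> B) = (\<integral>\<^sup>+x\<in>B. ennreal (real (degin E A x)) \<partial>M)" .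
  qed
  have fin: "emeasure m (UNIV \<times> UNIV) \<noteq> \<infinity>"
  proof -
    have U: "(UNIV :: 'a set) \<in> sets borel" by simp
    have "emeasure m (UNIV \<times> UNIV) \<le> (\<integral>\<^sup>+x. ennreal (real D) \<partial>M)"
      unfolding rect[OF U U]
      using card_nbhd by (intro nn_integral_mono) (auto simp: degin_def nbhd_def)
    also have "\<dots> < \<infinity>" using emeasure_finite[of UNIV]
      by (simp add: ennreal_mult_eq_top_iff less_top[symmetric])
    finally show ?thesis by simp
  qed
  have "m = m'"
  proof (rule measure_eqI_generator_eq)
    show "Int_stable {a \<times> b | a b. a \<in> sets (borel::'a measure) \<and> b \<in> sets (borel::'a measure)}"
      by (rule Int_stable_pair_measure_generator)
    show "{a \<times> b | a b. a \<in> sets (borel::'a measure) \<and> b \<in> sets (borel::'a measure)} \<subseteq> Pow UNIV" by simp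
    show "emeasure m X = emeasure m' X" if "X \<in> {a \<times> b | a b. a \<in> sets borel \<and> b \<in> sets borel}" for X
      using that rect rect' symm by auto
    show "sets m = sigma_sets UNIV {a \<times> b | a b. a \<in> sets borel \<and> b \<in> sets borel}"
      by (simp add: sets_pair_measure)
    show "sets m' = sigma_sets UNIV {a \<times> b | a b. a \<in> sets borel \<and> b \<in> sets borel}"
      by (simp add: m'_def sets_pair_measure)
    show "range (\<lambda>i::nat. UNIV \<times> UNIV) \<subseteq> {a \<times> b | a b. a \<in> sets (borel::'a measure) \<and> b \<in> sets (borel::'a measure)}"
      by (intro image_subsetI CollectI exI[of _ UNIV]) auto
    show "(\<Union>i::nat. UNIV \<times> UNIV) = (UNIV :: ('a \<times> 'a) set)" by simp
    show "emeasure m (UNIV \<times> UNIV) \<noteq> \<infinity>" for i :: nat by (rule fin)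
  qed
  then show ?thesis using int[OF w] int'[OF w] by simp
qed

text \<open>A partial Borel injection \<open>\<phi>\<close> on \<open>A\<close> with inverse \<open>\<psi>\<close> that preserves the measure; stated for
  integrals so that composition needs no change of variables.\<close>

definition partial_iso :: "'a set \<Rightarrow> ('a \<Rightarrow> 'a) \<Rightarrow> ('a \<Rightarrow> 'a) \<Rightarrow> bool" where
  "partial_iso A \<phi> \<psi> \<longleftrightarrow> A \<in> sets borel \<and> \<phi> \<in> borel_measurable borel \<and> \<psi> \<in> borel_measurable borel \<and>
    (\<forall>x\<in>A. \<psi> (\<phi> x) = x) \<and> (\<forall>u\<in>borel_measurable borel.
      (\<integral>\<^sup>+x. u (\<phi> x) * indicator A x \<partial>M) = (\<integral>\<^sup>+y. u y * indicator {y. \<psi> y \<in> A \<and> \<phi> (\<psi> y) = y} y \<partial>M))"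

lemma partial_isoD:
  assumes "partial_iso A \<phi> \<psi>" "u \<in> borel_measurable borel"
  shows "(\<integral>\<^sup>+x. u (\<phi> x) * indicator A x \<partial>M) = (\<integral>\<^sup>+y. u y * indicator {y. \<psi> y \<in> A \<and> \<phi> (\<psi> y) = y} y \<partial>M)"
  using assms unfolding partial_iso_def by blast

text \<open>Fixing the index of the way back as well makes \<open>f i\<close> injective on this set,
  with inverse \<open>f j\<close>.\<close>

definition edge_dom :: "nat \<Rightarrow> nat \<Rightarrow> 'a set" where
  "edge_dom i j = {x. f i x \<noteq> x \<and> f j (f i x) = x}"

text \<open>Edge mass transport for the weight that sends \<open>u y\<close> along the single edge
  from \<open>x\<close> to \<open>y = f i x\<close>; the inflow at \<open>y\<close> can then come
  only from \<open>f j y\<close>.\<close>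

lemma partial_iso_edge: "partial_iso (edge_dom i j) (f i) (f j)"
proof -
  define A where "A = edge_dom i j"
  have "Measurable.pred borel (\<lambda>x. f i x \<noteq> x \<and> f j (f i x) = x)" by measurable
  then have A[measurable]: "A \<in> sets borel" by (simp add: A_def edge_dom_def pred_def)
  have "(\<integral>\<^sup>+x. u (f i x) * indicator A x \<partial>M) = (\<integral>\<^sup>+y. u y * indicator {y. f j y \<in> A \<and> f i (f j y) = y} y \<partial>M)"
    if [measurable]: "u \<in> borel_measurable borel" for u :: "'a \<Rightarrow> ennreal"
  proof -
    define w where "w x y = (if x \<in> A \<and> y = f i x then u y else 0)" for x y
    have "(\<lambda>p. w (fst p) (snd p)) \<in> borel_measurable (borel \<Otimes>\<^sub>M borel)" unfolding w_def by measurable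
    then have "(\<integral>\<^sup>+x. (\<Sum>y\<in>nbhd E x. w x y) \<partial>M) = (\<integral>\<^sup>+x. (\<Sum>y\<in>nbhd E x. w y x) \<partial>M)"
      by (rule edge_mass_transport)
    moreover have "(\<Sum>y\<in>nbhd E x. w x y) = u (f i x) * indicator A x" for x
    proof (cases "x \<in> A")
      case True
      then have "f i x \<in> nbhd E x" using nbhd_iff[of "f i x" x] by (auto simp: A_def edge_dom_def)
      then show ?thesis using True finite_nbhd by (simp add: w_def)
    qed (simp add: w_def)
    moreover have "(\<Sum>y\<in>nbhd E x. w y x) = u x * indicator {y. f j y \<in> A \<and> f i (f j y) = y} x" for x
    proof -
      have "w y x = (if y = f j x then (if f j x \<in> A \<and> f i (f j x) = x then u x else 0) else 0)" for y
        by (auto simp: w_def A_def edge_dom_def)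
      then have "(\<Sum>y\<in>nbhd E x. w y x) = (if f j x \<in> nbhd E x then (if f j x \<in> A \<and> f i (f j x) = x then u x else 0) else 0)"
        using finite_nbhd by (simp add: sum.delta)
      also have "\<dots> = u x * indicator {y. f j y \<in> A \<and> f i (f j y) = y} x"
      proof (cases "f j x \<in> A \<and> f i (f j x) = x")
        case True
        then have "f j x \<in> nbhd E x" using nbhd_iff[of "f j x" x] by (auto simp: A_def edge_dom_def)
        then show ?thesis using True by simp
      qed auto
      finally show ?thesis .
    qed
    ultimately show ?thesis by simp
  qed
  then show ?thesis unfolding partial_iso_def using A by (auto simp: A_def[symmetric]) (simp add: A_def edge_dom_def)
qed

lemma partial_iso_comp:
  assumes 1: "partial_iso A \<phi> \<psi>" and 2: "partial_iso A' \<phi>' \<psi>'"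
  shows "partial_iso {x \<in> A. \<phi> x \<in> A'} (\<lambda>x. \<phi>' (\<phi> x)) (\<lambda>y. \<psi> (\<psi>' y))"
proof -
  have [measurable]: "A \<in> sets borel" "A' \<in> sets borel" "\<phi> \<in> borel_measurable borel" "\<psi> \<in> borel_measurable borel"
    "\<phi>' \<in> borel_measurable borel" "\<psi>' \<in> borel_measurable borel" using 1 2 unfolding partial_iso_def by auto
  have inv: "\<And>x. x \<in> A \<Longrightarrow> \<psi> (\<phi> x) = x" "\<And>x. x \<in> A' \<Longrightarrow> \<psi>' (\<phi>' x) = x" using 1 2 unfolding partial_iso_def by auto
  have "Measurable.pred borel (\<lambda>x. x \<in> A \<and> \<phi> x \<in> A')" by measurable
  then have S: "{x \<in> A. \<phi> x \<in> A'} \<in> sets borel" by (simp add: pred_def)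
  have "(\<integral>\<^sup>+x. u (\<phi>' (\<phi> x)) * indicator {x \<in> A. \<phi> x \<in> A'} x \<partial>M) =
      (\<integral>\<^sup>+y. u y * indicator {y. \<psi> (\<psi>' y) \<in> {x \<in> A. \<phi> x \<in> A'} \<and> \<phi>' (\<phi> (\<psi> (\<psi>' y))) = y} y \<partial>M)"
    if [measurable]: "u \<in> borel_measurable borel" for u :: "'a \<Rightarrow> ennreal"
  proof -
    define B where "B = {y. \<psi> y \<in> A \<and> \<phi> (\<psi> y) = y}"
    have "Measurable.pred borel (\<lambda>y. \<psi> y \<in> A \<and> \<phi> (\<psi> y) = y)" by measurable
    then have [measurable]: "B \<in> sets borel" by (simp add: B_def pred_def)
    have "(\<integral>\<^sup>+x. u (\<phi>' (\<phi> x)) * indicator {x \<in> A. \<phi> x \<in> A'} x \<partial>M)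
        = (\<integral>\<^sup>+x. (\<lambda>y. u (\<phi>' y) * indicator A' y) (\<phi> x) * indicator A x \<partial>M)"
      by (intro nn_integral_cong) (auto simp: indicator_def)
    also have "\<dots> = (\<integral>\<^sup>+y. (u (\<phi>' y) * indicator A' y) * indicator B y \<partial>M)"
    proof -
      have "(\<lambda>y. u (\<phi>' y) * indicator A' y) \<in> borel_measurable borel" by measurable
      from partial_isoD[OF 1 this] show ?thesis by (simp only: B_def)
    qed
    also have "\<dots> = (\<integral>\<^sup>+y. (\<lambda>z. u z * indicator B (\<psi>' z)) (\<phi>' y) * indicator A' y \<partial>M)"
      using inv(2) by (intro nn_integral_cong) (auto simp: indicator_def)
    also have "\<dots> = (\<integral>\<^sup>+z. (u z * indicator B (\<psi>' z)) * indicator {z. \<psi>' z \<in> A' \<and> \<phi>' (\<psi>' z) = z} z \<partial>M)"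
    proof -
      have "(\<lambda>z. u z * indicator B (\<psi>' z)) \<in> borel_measurable borel" by measurable
      from partial_isoD[OF 2 this] show ?thesis .
    qed
    also have "\<dots> = (\<integral>\<^sup>+y. u y * indicator {y. \<psi> (\<psi>' y) \<in> {x \<in> A. \<phi> x \<in> A'} \<and> \<phi>' (\<phi> (\<psi> (\<psi>' y))) = y} y \<partial>M)"
    proof (rule nn_integral_cong)
      fix z
      have "\<psi>' z \<in> B \<and> \<psi>' z \<in> A' \<and> \<phi>' (\<psi>' z) = z \<longleftrightarrow> \<psi> (\<psi>' z) \<in> {x \<in> A. \<phi> x \<in> A'} \<and> \<phi>' (\<phi> (\<psi> (\<psi>' z))) = z"
      proof
        assume r: "\<psi> (\<psi>' z) \<in> {x \<in> A. \<phi> x \<in> A'} \<and> \<phi>' (\<phi> (\<psi> (\<psi>' z))) = z"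
        then have "\<psi>' (\<phi>' (\<phi> (\<psi> (\<psi>' z)))) = \<phi> (\<psi> (\<psi>' z))" by (intro inv(2)) simp
        then have "\<psi>' z = \<phi> (\<psi> (\<psi>' z))" using r by simp
        then show "\<psi>' z \<in> B \<and> \<psi>' z \<in> A' \<and> \<phi>' (\<psi>' z) = z" using r by (auto simp: B_def)
      qed (auto simp: B_def)
      then show "(u z * indicator B (\<psi>' z)) * indicator {z. \<psi>' z \<in> A' \<and> \<phi>' (\<psi>' z) = z} z
          = u z * indicator {y. \<psi> (\<psi>' y) \<in> {x \<in> A. \<phi> x \<in> A'} \<and> \<phi>' (\<phi> (\<psi> (\<psi>' y))) = y} z"
        by (auto simp: indicator_def)
    qed
    finally show ?thesis .
  qed
  then show ?thesis unfolding partial_iso_def using S inv by auto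
qed

text \<open>A walk that carries the indices of its return, so that it is invertible on its domain.
  The words are countable in number and join every pair of vertices of a component.\<close>

fun word_map :: "(nat \<times> nat) list \<Rightarrow> 'a \<Rightarrow> 'a" where
  "word_map [] x = x" | "word_map ((i, j) # W) x = word_map W (f i x)"
fun word_inv :: "(nat \<times> nat) list \<Rightarrow> 'a \<Rightarrow> 'a" where
  "word_inv [] y = y" | "word_inv ((i, j) # W) y = f j (word_inv W y)"
fun word_dom :: "(nat \<times> nat) list \<Rightarrow> 'a set" where
  "word_dom [] = UNIV" | "word_dom ((i, j) # W) = {x \<in> edge_dom i j. f i x \<in> word_dom W}"

lemma partial_iso_word: "partial_iso (word_dom W) (word_map W) (word_inv W)"
proof (induction W rule: word_dom.induct)
  case 1
  show ?case by (simp add: partial_iso_def)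
next
  case (2 i j W)
  have "word_map ((i, j) # W) = (\<lambda>x. word_map W (f i x))" "word_inv ((i, j) # W) = (\<lambda>y. f j (word_inv W y))" by auto
  then show ?case using partial_iso_comp[OF partial_iso_edge 2] by simp
qed

lemma word_map_image: "{word_map W x | W. x \<in> word_dom W} = gcomp E x"
proof (intro set_eqI iffI)
  fix y assume "y \<in> {word_map W x | W. x \<in> word_dom W}"
  then obtain W where "y = word_map W x" "x \<in> word_dom W" by auto
  then show "y \<in> gcomp E x"
  proof (induction W arbitrary: x rule: word_dom.induct)
    case (2 i j W)
    then have "y \<in> gcomp E (f i x)" "f i x \<noteq> x" by (auto simp: edge_dom_def)
    moreover have "f i x \<in> gcomp E x"
      using edge_iff[of x "f i x"] \<open>f i x \<noteq> x\<close> by (intro gcomp_edge[OF gcomp_refl]) auto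
    ultimately show ?case using gcomp_trans by metis
  qed simp
next
  fix y assume "y \<in> gcomp E x"
  then have "(x, y) \<in> (adj E)\<^sup>*" by (simp add: gcomp_def)
  then have "\<exists>W. y = word_map W x \<and> x \<in> word_dom W"
  proof (induction rule: converse_rtrancl_induct)
    case base
    then show ?case by (intro exI[of _ "[]"]) simp
  next
    case (step x z)
    then obtain W where W: "y = word_map W z" "z \<in> word_dom W" by auto
    obtain i where i: "z = f i x" "z \<noteq> x" using step(1) edge_iff[of x z] by auto
    have "Upair z x \<in> E" using step(1) by (simp add: Upair_commute[of z x])
    then obtain j where j: "x = f j z" using edge_iff[of z x] by blast
    have "y = word_map ((i, j) # W) x \<and> x \<in> word_dom ((i, j) # W)"
      using W i(2) unfolding edge_dom_def word_map.simps word_dom.simps mem_Collect_eq i(1)[symmetric] j[symmetric] by simp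
    then show ?case by blast
  qed
  then show "y \<in> {word_map W x | W. x \<in> word_dom W}" by auto
qed

text \<open>The graphs of countably many partial isomorphisms cover the component relation, but
  several words may join the same pair. On \<open>A' n\<close> only the first word that reaches its
  target is kept, so every pair is counted once and the two sides become series whose terms are
  exchanged by the isomorphisms.\<close>

theorem mass_transport:
  fixes w :: "'a \<Rightarrow> 'a \<Rightarrow> ennreal"
  assumes w: "(\<lambda>p. w (fst p) (snd p)) \<in> borel_measurable (borel \<Otimes>\<^sub>M borel)"
  shows "(\<integral>\<^sup>+x. (\<integral>\<^sup>+y. w x y \<partial>count_space (gcomp E x)) \<partial>M) = (\<integral>\<^sup>+x. (\<integral>\<^sup>+y. w y x \<partial>count_space (gcomp E x)) \<partial>M)"
proof -
  define \<phi> where "\<phi> n = word_map (from_nat n)" for n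
  define \<psi> where "\<psi> n = word_inv (from_nat n)" for n
  define A where "A n = word_dom (from_nat n)" for n
  have fe: "partial_iso (A n) (\<phi> n) (\<psi> n)" for n unfolding \<phi>_def \<psi>_def A_def by (rule partial_iso_word)
  have [measurable]: "A n \<in> sets borel" "\<phi> n \<in> borel_measurable borel" "\<psi> n \<in> borel_measurable borel" for n
    using fe[of n] unfolding partial_iso_def by auto
  have inv: "x \<in> A n \<Longrightarrow> \<psi> n (\<phi> n x) = x" for n x using fe[of n] unfolding partial_iso_def by auto
  have [measurable]: "(\<lambda>x. w (a x) (b x)) \<in> borel_measurable borel"
    if "a \<in> borel_measurable borel" "b \<in> borel_measurable borel" for a b :: "'a \<Rightarrow> 'a"
    using measurable_compose[OF measurable_Pair[OF that] w] by simp
  define A' where "A' n = {x. x \<in> A n \<and> (\<forall>m. m < n \<longrightarrow> x \<in> A m \<longrightarrow> \<phi> m x \<noteq> \<phi> n x)}" for n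
  have "Measurable.pred borel (\<lambda>x. x \<in> A n \<and> (\<forall>m. m < n \<longrightarrow> x \<in> A m \<longrightarrow> \<phi> m x \<noteq> \<phi> n x))" for n by measurable
  then have [measurable]: "A' n \<in> sets borel" for n by (simp add: A'_def pred_def)
  have ex1: "\<exists>!n. x \<in> A' n \<and> \<phi> n x = y" if y: "y \<in> gcomp E x" for x y
  proof -
    obtain W where W: "y = word_map W x" "x \<in> word_dom W" using y unfolding word_map_image[symmetric] by auto
    have ex: "x \<in> A (to_nat W) \<and> \<phi> (to_nat W) x = y" using W by (simp add: A_def \<phi>_def)
    define n where "n = (LEAST n. x \<in> A n \<and> \<phi> n x = y)"
    have n: "x \<in> A n \<and> \<phi> n x = y" unfolding n_def by (rule LeastI[of "\<lambda>n. x \<in> A n \<and> \<phi> n x = y", OF ex])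
    have "\<phi> m x \<noteq> y" if "m < n" "x \<in> A m" for m using not_less_Least[of m "\<lambda>n. x \<in> A n \<and> \<phi> n x = y"] that unfolding n_def by auto
    then have "\<forall>m. m < n \<longrightarrow> x \<in> A m \<longrightarrow> \<phi> m x \<noteq> \<phi> n x" using n by metis
    then have An: "x \<in> A' n \<and> \<phi> n x = y" unfolding A'_def mem_Collect_eq using n by (intro conjI) simp_all
    have "k = n" if k: "x \<in> A' k \<and> \<phi> k x = y" for k
    proof (rule linorder_cases[of k n])
      assume "k < n"
      then have "\<phi> k x \<noteq> \<phi> n x" using k An unfolding A'_def mem_Collect_eq by meson
      then show ?thesis using k An by simp
    next
      assume "n < k"
      then have "\<phi> n x \<noteq> \<phi> k x" using k An unfolding A'_def mem_Collect_eq by meson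
      then show ?thesis using k An by simp
    qed simp
    with An show ?thesis by (intro ex1I)
  qed
  have in_comp: "\<phi> n x \<in> gcomp E x" if "x \<in> A' n" for n x
  proof -
    have "x \<in> word_dom (from_nat n)" using that by (simp add: A'_def A_def)
    then show ?thesis unfolding word_map_image[symmetric] \<phi>_def by blast
  qed
  define B where "B n = {y. \<psi> n y \<in> A' n \<and> \<phi> n (\<psi> n y) = y}" for n
  have sum_nat: "(\<integral>\<^sup>+n. g n \<partial>count_space {n. P n}) = (\<Sum>n. g n * indicator {n. P n} n)" for g :: "nat \<Rightarrow> ennreal" and P
    by (simp add: nn_integral_count_space_indicator nn_integral_count_space_nat)
  have L: "(\<integral>\<^sup>+y. w x y \<partial>count_space (gcomp E x)) = (\<Sum>n. w x (\<phi> n x) * indicator (A' n) x)" for x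
  proof -
    have "bij_betw (\<lambda>n. \<phi> n x) {n. x \<in> A' n} (gcomp E x)"
    proof (rule bij_betwI')
      fix n k assume nk: "n \<in> {n. x \<in> A' n}" "k \<in> {n. x \<in> A' n}"
      show "(\<phi> n x = \<phi> k x) = (n = k)" using ex1[OF in_comp[of x n]] nk by auto
    next
      fix y assume "y \<in> gcomp E x"
      from ex1[OF this] show "\<exists>n\<in>{n. x \<in> A' n}. y = \<phi> n x" by auto
    qed (use in_comp in auto)
    from nn_integral_bij_count_space[OF this, of "w x", symmetric]
    have "(\<integral>\<^sup>+y. w x y \<partial>count_space (gcomp E x)) = (\<integral>\<^sup>+n. w x (\<phi> n x) \<partial>count_space {n. x \<in> A' n})" by simp
    also have "\<dots> = (\<Sum>n. w x (\<phi> n x) * indicator {n. x \<in> A' n} n)" by (rule sum_nat)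
    finally show ?thesis by (simp add: indicator_def)
  qed
  have R: "(\<integral>\<^sup>+x. w x y \<partial>count_space (gcomp E y)) = (\<Sum>n. w (\<psi> n y) y * indicator (B n) y)" for y
  proof -
    have "bij_betw (\<lambda>n. \<psi> n y) {n. y \<in> B n} (gcomp E y)"
    proof (rule bij_betwI')
      fix n assume "n \<in> {n. y \<in> B n}"
      then have "y \<in> gcomp E (\<psi> n y)" using in_comp[of "\<psi> n y" n] by (auto simp: B_def)
      then show "\<psi> n y \<in> gcomp E y" by (rule gcomp_sym)
    next
      fix n k assume nk: "n \<in> {n. y \<in> B n}" "k \<in> {n. y \<in> B n}"
      have "y \<in> gcomp E (\<psi> n y)" using nk in_comp[of "\<psi> n y" n] by (auto simp: B_def)
      then show "(\<psi> n y = \<psi> k y) = (n = k)" using ex1[of y "\<psi> n y"] nk by (auto simp: B_def)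
    next
      fix x assume "x \<in> gcomp E y"
      then have "y \<in> gcomp E x" by (rule gcomp_sym)
      from ex1[OF this] obtain n where n: "x \<in> A' n" "\<phi> n x = y" by auto
      then have "\<psi> n y = x" using inv[of x n] by (auto simp: A'_def)
      then show "\<exists>n\<in>{n. y \<in> B n}. x = \<psi> n y" using n by (auto simp: B_def)
    qed
    from nn_integral_bij_count_space[OF this, of "\<lambda>x. w x y", symmetric]
    have "(\<integral>\<^sup>+x. w x y \<partial>count_space (gcomp E y)) = (\<integral>\<^sup>+n. w (\<psi> n y) y \<partial>count_space {n. y \<in> B n})" by simp
    also have "\<dots> = (\<Sum>n. w (\<psi> n y) y * indicator {n. y \<in> B n} n)" by (rule sum_nat)
    finally show ?thesis by (simp add: indicator_def)
  qed
  have "Measurable.pred borel (\<lambda>y. \<psi> n y \<in> A' n \<and> \<phi> n (\<psi> n y) = y)" for n by measurable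
  then have [measurable]: "B n \<in> sets borel" for n by (simp add: B_def pred_def)
  have step: "(\<integral>\<^sup>+x. w x (\<phi> n x) * indicator (A' n) x \<partial>M) = (\<integral>\<^sup>+y. w (\<psi> n y) y * indicator (B n) y \<partial>M)" for n
  proof -
    \<comment> \<open>The restriction from \<open>A n\<close> to \<open>A' n\<close> is carried
      along as a factor of the integrand, because the measure preservation is available on
      \<open>A n\<close>.\<close>
    define u where "u y = w (\<psi> n y) y * indicator (A' n) (\<psi> n y)" for y
    have u: "u \<in> borel_measurable borel" unfolding u_def by measurable
    have "w x (\<phi> n x) * indicator (A' n) x = u (\<phi> n x) * indicator (A n) x" for x
      using inv[of x n] by (auto simp: u_def indicator_def A'_def)
    then have "(\<integral>\<^sup>+x. w x (\<phi> n x) * indicator (A' n) x \<partial>M) = (\<integral>\<^sup>+x. u (\<phi> n x) * indicator (A n) x \<partial>M)" by simp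
    also have "\<dots> = (\<integral>\<^sup>+y. u y * indicator {y. \<psi> n y \<in> A n \<and> \<phi> n (\<psi> n y) = y} y \<partial>M)"
      by (rule partial_isoD[OF fe u])
    also have "\<dots> = (\<integral>\<^sup>+y. w (\<psi> n y) y * indicator (B n) y \<partial>M)"
      by (intro nn_integral_cong) (auto simp: u_def indicator_def B_def A'_def)
    finally show ?thesis .
  qed
  have "(\<integral>\<^sup>+x. (\<integral>\<^sup>+y. w x y \<partial>count_space (gcomp E x)) \<partial>M) = (\<Sum>n. \<integral>\<^sup>+x. w x (\<phi> n x) * indicator (A' n) x \<partial>M)"
    unfolding L by (rule nn_integral_suminf) measurable
  also have "\<dots> = (\<Sum>n. \<integral>\<^sup>+y. w (\<psi> n y) y * indicator (B n) y \<partial>M)" by (simp only: step)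
  also have "\<dots> = (\<integral>\<^sup>+x. (\<integral>\<^sup>+y. w y x \<partial>count_space (gcomp E x)) \<partial>M)"
    unfolding R by (rule nn_integral_suminf[symmetric]) measurable
  finally show ?thesis .
qed

end

section \<open>Clusters of upper sets of edges\<close>

definition upper :: "('a uprod \<times> 'a uprod) set \<Rightarrow> 'a uprod set \<Rightarrow> 'a uprod \<Rightarrow> 'a uprod set" where
  "upper R E e = {d \<in> E. (e, d) \<in> R}"

definition uppeq :: "('a uprod \<times> 'a uprod) set \<Rightarrow> 'a uprod set \<Rightarrow> 'a uprod \<Rightarrow> 'a uprod set" where
  "uppeq R E e = {d \<in> E. d = e \<or> (e, d) \<in> R}"

text \<open>Finiteness is demanded explicitly because \<open>card\<close> gives 0 on infinite
  sets.\<close>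

definition small :: "nat \<Rightarrow> 'a set \<Rightarrow> bool" where
  "small n S \<longleftrightarrow> finite S \<and> card S \<le> n"

definition wired_cut :: "'a uprod set \<Rightarrow> ('a uprod \<times> 'a uprod) set \<Rightarrow> 'a uprod set" where
  "wired_cut E R = {e \<in> E. \<exists>x y. e = Upair x y \<and> y \<notin> gcomp (upper R E e) x \<and> finite (gcomp (upper R E e) x)}"

text \<open>Adding the edge lets \<open>z\<close> leave the clusters of at most \<open>n\<close>
  vertices. The pair is oriented: \<open>x\<close> is the end on the side of
  \<open>z\<close>.\<close>

definition exit_edge :: "('a uprod \<times> 'a uprod) set \<Rightarrow> 'a uprod set \<Rightarrow> nat \<Rightarrow> 'a \<Rightarrow> 'a \<Rightarrow> 'a \<Rightarrow> bool" where
  "exit_edge R E n z x y \<longleftrightarrow> Upair x y \<in> E \<and> z \<in> gcomp (upper R E (Upair x y)) x \<and>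
     small n (gcomp (upper R E (Upair x y)) x) \<and> \<not> small n (gcomp (uppeq R E (Upair x y)) x)"

lemma small_mono: "small n T \<Longrightarrow> S \<subseteq> T \<Longrightarrow> small n S"
  unfolding small_def by (meson card_mono finite_subset le_trans)

lemma upper_subset: "upper R E e \<subseteq> E" and uppeq_subset: "uppeq R E e \<subseteq> E" and upper_uppeq: "upper R E e \<subseteq> uppeq R E e"
  by (auto simp: upper_def uppeq_def)

lemma uppeq_insert: "e \<in> E \<Longrightarrow> uppeq R E e = insert e (upper R E e)"
  by (auto simp: upper_def uppeq_def)

lemma mem_wired_cut:
  "Upair x y \<in> wired_cut E R \<longleftrightarrow> Upair x y \<in> E \<and> y \<notin> gcomp (upper R E (Upair x y)) x \<and>
     (finite (gcomp (upper R E (Upair x y)) x) \<or> finite (gcomp (upper R E (Upair x y)) y))"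
proof
  assume "Upair x y \<in> wired_cut E R"
  then obtain a b where ab: "Upair x y \<in> E" "Upair x y = Upair a b" "b \<notin> gcomp (upper R E (Upair x y)) a"
    "finite (gcomp (upper R E (Upair x y)) a)" unfolding wired_cut_def by blast
  then show "Upair x y \<in> E \<and> y \<notin> gcomp (upper R E (Upair x y)) x \<and>
     (finite (gcomp (upper R E (Upair x y)) x) \<or> finite (gcomp (upper R E (Upair x y)) y))"
    using gcomp_sym by (metis Upair_inject)
next
  assume a: "Upair x y \<in> E \<and> y \<notin> gcomp (upper R E (Upair x y)) x \<and>
     (finite (gcomp (upper R E (Upair x y)) x) \<or> finite (gcomp (upper R E (Upair x y)) y))"
  then have "x \<notin> gcomp (upper R E (Upair x y)) y" using gcomp_sym by metis
  then show "Upair x y \<in> wired_cut E R" unfolding wired_cut_def mem_Collect_eq using a Upair_commute by metis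
qed

section \<open>Growth of clusters under insertion of an edge\<close>

lemma gcomp_insert_edge:
  assumes "y \<notin> gcomp U x"
  shows "gcomp (insert (Upair x y) U) x = gcomp U x \<union> gcomp U y"
proof
  show "gcomp (insert (Upair x y) U) x \<subseteq> gcomp U x \<union> gcomp U y"
  proof (rule gcomp_subset_closed)
    fix a b assume "a \<in> gcomp U x \<union> gcomp U y" "Upair a b \<in> insert (Upair x y) U"
    then show "b \<in> gcomp U x \<union> gcomp U y" using gcomp_edge[of a U _ b] by auto
  qed simp
  have "gcomp U x \<subseteq> gcomp (insert (Upair x y) U) x" by (rule gcomp_mono) auto
  moreover have "y \<in> gcomp (insert (Upair x y) U) x" by (rule gcomp_edge[OF gcomp_refl]) simp
  then have "gcomp (insert (Upair x y) U) y = gcomp (insert (Upair x y) U) x" by (rule gcomp_eq)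
  moreover have "gcomp U y \<subseteq> gcomp (insert (Upair x y) U) y" by (rule gcomp_mono) auto
  ultimately show "gcomp U x \<union> gcomp U y \<subseteq> gcomp (insert (Upair x y) U) x" by simp
qed

lemma gcomp_insert_inner:
  assumes "y \<in> gcomp U x"
  shows "gcomp (insert (Upair x y) U) x = gcomp U x"
proof
  show "gcomp (insert (Upair x y) U) x \<subseteq> gcomp U x"
  proof (rule gcomp_subset_closed)
    fix a b assume "a \<in> gcomp U x" "Upair a b \<in> insert (Upair x y) U"
    then show "b \<in> gcomp U x" using gcomp_edge[of a U x b] assms by auto
  qed simp
qed (rule gcomp_mono, auto)

lemma gcomp_disjoint: "y \<notin> gcomp U x \<Longrightarrow> gcomp U x \<inter> gcomp U y = {}"
  using gcomp_sym gcomp_trans by (metis disjoint_iff)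

lemma finite_linear_greatest:
  assumes "finite A" "A \<noteq> {}" "A \<subseteq> E" "trans R" "total_on E R"
  shows "\<exists>e\<in>A. \<forall>d\<in>A. d = e \<or> (d, e) \<in> R"
  using assms
proof (induction A rule: finite_ne_induct)
  case (insert a A)
  then obtain e where e: "e \<in> A" "\<forall>d\<in>A. d = e \<or> (d, e) \<in> R" by auto
  have "a \<noteq> e" using e insert by auto
  then have "(a, e) \<in> R \<or> (e, a) \<in> R" using insert.prems e by (auto simp: total_on_def)
  then show ?case
  proof
    assume "(a, e) \<in> R" then show ?thesis using e by blast
  next
    assume ea: "(e, a) \<in> R"
    have "d = a \<or> (d, a) \<in> R" if "d \<in> insert a A" for d
    proof (cases "d = a")
      case False
      then have "d = e \<or> (d, e) \<in> R" using that e(2) by simp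
      then show ?thesis using ea transD[OF \<open>trans R\<close>, of d e a] by (elim disjE) simp_all
    qed simp
    then show ?thesis by blast
  qed
qed simp

text \<open>For existence, choose among all up-closed edge sets one that gives \<open>z\<close> the
  largest cluster \<open>P\<close> of size at most \<open>n\<close>, and let \<open>e\<close> be the
  greatest edge leaving \<open>P\<close>, which exists because \<open>P\<close> and the degrees are
  finite. The edges above \<open>e\<close> still give \<open>P\<close>, and adding \<open>e\<close>
  enlarges it, so by maximality the size exceeds \<open>n\<close>. General up-closed sets are used
  because a dense order has no next threshold. For uniqueness, the large cluster at the higher of
  two exit edges would lie inside the small cluster at the lower one.\<close>

lemma exit_edge_ex1:
  assumes R: "trans R" "irrefl R" "total_on E R" and fin: "\<And>x. finite (nbhd E x)"
    and n: "1 \<le> n" and big: "\<not> small n (gcomp E z)"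
  shows "\<exists>!p. exit_edge R E n z (fst p) (snd p)"
proof -
  define upset where "upset U \<longleftrightarrow> U \<subseteq> E \<and> (\<forall>d\<in>U. \<forall>d'\<in>E. (d, d') \<in> R \<longrightarrow> d' \<in> U)" for U
  have up1: "upset (uppeq R E e)" for e
    unfolding upset_def uppeq_def using R(1) by (auto dest: transD)
  define Pr where "Pr k \<longleftrightarrow> (\<exists>U. upset U \<and> small n (gcomp U z) \<and> card (gcomp U z) = k)" for k
  \<comment> \<open>The empty edge set is a first candidate since \<open>1 \<le> n\<close>, so the
    maximum below is taken over a nonempty set of sizes.\<close>
  have "gcomp {} z = {z}" unfolding gcomp_def adj_def by simp
  then have "Pr 1" unfolding Pr_def upset_def small_def using n by (intro exI[of _ "{}"]) simp
  moreover have "\<forall>k. Pr k \<longrightarrow> k \<le> n" unfolding Pr_def small_def by auto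
  ultimately obtain k where k: "Pr k" "\<And>l. Pr l \<Longrightarrow> l \<le> k" using ex_has_greatest_nat[of Pr 1 "\<lambda>k. k" "Suc n"] by (auto simp: less_Suc_eq_le)
  then obtain U where U: "upset U" "small n (gcomp U z)" "card (gcomp U z) = k" unfolding Pr_def by blast
  define P where "P = gcomp U z"
  have finP: "finite P" using U(2) by (simp add: P_def small_def)
  define bd where "bd = {e \<in> E. \<exists>x y. x \<in> P \<and> y \<notin> P \<and> e = Upair x y}"
  have "bd \<subseteq> (\<lambda>p. Upair (fst p) (snd p)) ` (SIGMA x:P. nbhd E x)"
    by (force simp: bd_def nbhd_def)
  then have finbd: "finite bd" using finP fin by (auto elim!: finite_subset)
  have "bd \<noteq> {}"
  proof
    assume e: "bd = {}"
    have "gcomp E z \<subseteq> P"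
    proof (rule gcomp_subset_closed)
      show "z \<in> P" by (simp add: P_def)
      fix a b assume "a \<in> P" "Upair a b \<in> E"
      then show "b \<in> P" using e by (auto simp: bd_def)
    qed
    then show False using big small_mono U(2) P_def by metis
  qed
  moreover have "bd \<subseteq> E" by (auto simp: bd_def)
  ultimately obtain e where e: "e \<in> bd" "\<forall>d\<in>bd. d = e \<or> (d, e) \<in> R"
    using finite_linear_greatest[OF finbd _ _ R(1,3)] by blast
  obtain x y where xy: "x \<in> P" "y \<notin> P" "e = Upair x y" "e \<in> E" using e(1) unfolding bd_def by blast
  have "e \<notin> U"
  proof
    assume "e \<in> U"
    then have "y \<in> gcomp U z" using xy gcomp_edge[of x U z y] unfolding P_def by simp
    then show False using xy by (simp add: P_def)
  qed
  have Uup: "U \<subseteq> upper R E e"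
  proof
    fix d assume d: "d \<in> U"
    then have "d \<in> E" "d \<noteq> e" using U(1) \<open>e \<notin> U\<close> by (auto simp: upset_def)
    moreover have "(d, e) \<notin> R" using d U(1) \<open>e \<notin> U\<close> xy(4) by (auto simp: upset_def)
    ultimately show "d \<in> upper R E e" using R(3) xy(4) by (auto simp: upper_def total_on_def)
  qed
  have "gcomp (upper R E e) z \<subseteq> P"
  proof (rule gcomp_subset_closed)
    show "z \<in> P" by (simp add: P_def)
    fix a b assume ab: "a \<in> P" "Upair a b \<in> upper R E e"
    show "b \<in> P"
    proof (rule ccontr)
      assume "b \<notin> P"
      then have "Upair a b \<in> bd" using ab by (auto simp: bd_def upper_def)
      then have "Upair a b = e \<or> (Upair a b, e) \<in> R" using e(2) by simp
      moreover have "(e, Upair a b) \<in> R" using ab by (simp add: upper_def)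
      ultimately have "(e, e) \<in> R" using transD[OF R(1), of e "Upair a b" e] by (elim disjE) simp_all
      then show False using R(2) by (simp add: irrefl_def)
    qed
  qed
  then have Pz: "gcomp (upper R E e) z = P" using gcomp_mono[OF Uup, of z] by (auto simp: P_def)
  have Px: "gcomp (upper R E e) x = P" using gcomp_eq[of x "upper R E e" z] xy(1) Pz by simp
  have notsmall: "\<not> small n (gcomp (uppeq R E e) x)"
  proof
    assume sm: "small n (gcomp (uppeq R E e) x)"
    have sub: "P \<subseteq> gcomp (uppeq R E e) x" using gcomp_mono[OF upper_uppeq, of R E e x] Px by simp
    have "y \<in> gcomp (uppeq R E e) x" using xy by (intro gcomp_edge[OF gcomp_refl]) (auto simp: uppeq_def)
    then have "P \<subset> gcomp (uppeq R E e) x" using sub xy by auto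
    then have "card P < card (gcomp (uppeq R E e) x)" using sm by (intro psubset_card_mono) (auto simp: small_def)
    moreover have "z \<in> gcomp (uppeq R E e) x" using sub by (auto simp: P_def)
    then have "gcomp (uppeq R E e) z = gcomp (uppeq R E e) x" by (rule gcomp_eq)
    then have "Pr (card (gcomp (uppeq R E e) x))" unfolding Pr_def using up1 sm by metis
    ultimately show False using k(2) U(3) P_def by (metis leD)
  qed
  have ex: "exit_edge R E n z x y"
    unfolding exit_edge_def using xy(3,4) Px notsmall U(2) by (auto simp: P_def)
  have uniq: "a = c \<and> b = d" if ab: "exit_edge R E n z a b" and cd: "exit_edge R E n z c d" for a b c d
  proof -
    have key: "\<not> (Upair a b, Upair c d) \<in> R" if "exit_edge R E n z a b" "exit_edge R E n z c d" for a b c d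
    proof
      assume r: "(Upair a b, Upair c d) \<in> R"
      have "uppeq R E (Upair c d) \<subseteq> upper R E (Upair a b)"
        using r R(1) by (auto simp: upper_def uppeq_def dest: transD)
      then have "gcomp (uppeq R E (Upair c d)) z \<subseteq> gcomp (upper R E (Upair a b)) z" by (rule gcomp_mono)
      moreover have "gcomp (upper R E (Upair a b)) z = gcomp (upper R E (Upair a b)) a"
        using that by (intro gcomp_eq) (simp add: exit_edge_def)
      moreover have "z \<in> gcomp (uppeq R E (Upair c d)) c"
        using that(2) subsetD[OF gcomp_mono[OF upper_uppeq]] unfolding exit_edge_def by metis
      then have "gcomp (uppeq R E (Upair c d)) z = gcomp (uppeq R E (Upair c d)) c" by (rule gcomp_eq)
      ultimately show False using that small_mono unfolding exit_edge_def by metis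
    qed
    have eq: "Upair a b = Upair c d"
      using key[OF ab cd] key[OF cd ab] R(3) ab cd unfolding total_on_def exit_edge_def by metis
    \<comment> \<open>The edge is now known to be the same; its orientation follows because the far
      end is not in the cluster of \<open>z\<close>.\<close>
    have "b \<notin> gcomp (upper R E (Upair a b)) a"
    proof
      assume "b \<in> gcomp (upper R E (Upair a b)) a"
      from gcomp_insert_inner[OF this] show False
        using ab uppeq_insert[of "Upair a b" E R] unfolding exit_edge_def by simp
    qed
    moreover have "z \<in> gcomp (upper R E (Upair a b)) a" "z \<in> gcomp (upper R E (Upair a b)) c"
      using ab cd unfolding exit_edge_def eq by simp_all
    then have "c \<in> gcomp (upper R E (Upair a b)) a" using gcomp_sym gcomp_trans by metis
    ultimately show ?thesis using eq by (metis Upair_inject)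
  qed
  show ?thesis
  proof (rule ex1I[of _ "(x, y)"])
    show "exit_edge R E n z (fst (x, y)) (snd (x, y))" using ex by simp
    show "p = (x, y)" if "exit_edge R E n z (fst p) (snd p)" for p
      using uniq[OF that ex] by (simp add: prod_eq_iff)
  qed
qed

lemma exit_edge_gcomp: "exit_edge R E n z x y \<Longrightarrow> x \<in> gcomp E z"
  unfolding exit_edge_def using gcomp_mono[OF upper_subset] gcomp_sym by (metis subsetD)

lemma exit_edge_big: "exit_edge R E n z x y \<Longrightarrow> \<not> small n (gcomp E z)"
proof
  assume e: "exit_edge R E n z x y" "small n (gcomp E z)"
  have "gcomp E x = gcomp E z" by (rule gcomp_eq[OF exit_edge_gcomp[OF e(1)]])
  then have "gcomp (uppeq R E (Upair x y)) x \<subseteq> gcomp E z" using gcomp_mono[OF uppeq_subset, of R E "Upair x y" x] by simp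
  then show False using e small_mono unfolding exit_edge_def by metis
qed

definition harm_wt :: "nat \<Rightarrow> real" where "harm_wt n = 1 / (real (Suc n) * real (Suc (Suc n)))"

lemma harm_wt_diff: "harm_wt n = 1 / real (Suc n) - 1 / real (Suc (Suc n))"
  by (simp add: harm_wt_def field_simps)

text \<open>The series telescopes through \<open>h\<close>, the function 1/k with k clamped between
  \<open>s\<close> and the size of \<open>T\<close>. For infinite \<open>T\<close> the limit is 0,
  in agreement with \<open>1 / real (card T)\<close> because that \<open>card\<close> is 0.\<close>

lemma suminf_harm_wt:
  fixes s :: nat and T :: "'a set"
  assumes s: "1 \<le> s" "finite T \<Longrightarrow> s \<le> card T"
  shows "(\<Sum>n. ennreal (if s \<le> Suc n \<and> \<not> small (Suc n) T then harm_wt n else 0)) = ennreal (1 / real s - 1 / real (card T))"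
proof -
  define h where "h n = (if Suc n \<le> s then 1 / real s else if finite T \<and> card T \<le> Suc n then 1 / real (card T) else 1 / real (Suc n))" for n
  have diff_h: "(if s \<le> Suc n \<and> \<not> small (Suc n) T then harm_wt n else 0) = h n - h (Suc n)" for n
  proof (cases "Suc n < s")
    case True
    then show ?thesis by (simp add: h_def)
  next
    case False
    show ?thesis
    proof (cases "small (Suc n) T")
      case True
      then show ?thesis using False s by (auto simp: h_def small_def le_Suc_eq)
    next
      case nsm: False
      then show ?thesis using False by (auto simp: h_def small_def harm_wt_diff le_Suc_eq not_le)
    qed
  qed
  have lim: "h \<longlonglongrightarrow> 1 / real (card T)"
  proof (cases "finite T")
    case True
    have "\<forall>\<^sub>F n in sequentially. h n = 1 / real (card T)"
      using eventually_ge_at_top[of "card T"] by eventually_elim (use True s in \<open>auto simp: h_def\<close>)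
    then show ?thesis by (rule tendsto_eventually)
  next
    case False
    have "\<forall>\<^sub>F n in sequentially. 1 / real (Suc n) = h n"
      using eventually_ge_at_top[of s] by eventually_elim (use False in \<open>auto simp: h_def\<close>)
    moreover have "(\<lambda>n. 1 / real (Suc n)) \<longlonglongrightarrow> 0" using LIMSEQ_inverse_real_of_nat by (simp add: inverse_eq_divide)
    ultimately show ?thesis using False by (simp add: tendsto_cong)
  qed
  have "(\<lambda>n. h n - h (Suc n)) sums (h 0 - 1 / real (card T))" by (rule telescope_sums'[OF lim])
  moreover have "h 0 = 1 / real s" using s by (simp add: h_def)
  ultimately have "(\<lambda>n. if s \<le> Suc n \<and> \<not> small (Suc n) T then harm_wt n else 0) sums (1 / real s - 1 / real (card T))"
    unfolding diff_h by simp
  moreover have "0 \<le> (if s \<le> Suc n \<and> \<not> small (Suc n) T then harm_wt n else 0)" for n by (simp add: harm_wt_def)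
  ultimately show ?thesis by (simp add: suminf_ennreal2 sums_iff)
qed

section \<open>The measure of the wired forest\<close>

text \<open>Expressed through the four endpoints, so that the condition concerns the vertex space
  alone and passes unchanged to subgraphs.\<close>

definition borel_order :: "('a::topological_space uprod \<times> 'a uprod) set \<Rightarrow> bool" where
  "borel_order R \<longleftrightarrow> Measurable.pred ((borel \<Otimes>\<^sub>M borel) \<Otimes>\<^sub>M borel \<Otimes>\<^sub>M borel)
     (\<lambda>q. (Upair (fst (fst q)) (snd (fst q)), Upair (fst (snd q)) (snd (snd q))) \<in> R)"

locale ordered_borel_graph = borel_graph +
  fixes R :: "('a uprod \<times> 'a uprod) set"
  assumes trans_R: "trans R" and irrefl_R: "irrefl R" and total_R: "total_on E R"
    and borel_R: "borel_order R"
begin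

abbreviation lcl :: "'a \<times> 'a \<Rightarrow> 'a \<Rightarrow> 'a set" where "lcl p \<equiv> gcomp (upper R E (Upair (fst p) (snd p)))"
abbreviation ucl :: "'a \<times> 'a \<Rightarrow> 'a \<Rightarrow> 'a set" where "ucl p \<equiv> gcomp (uppeq R E (Upair (fst p) (snd p)))"

lemma upper_measurable:
  "Measurable.pred ((borel \<Otimes>\<^sub>M borel) \<Otimes>\<^sub>M borel \<Otimes>\<^sub>M borel)
     (\<lambda>q. Upair (fst (snd q)) (snd (snd q)) \<in> upper R E (Upair (fst (fst q)) (snd (fst q))))"
  unfolding upper_def mem_Collect_eq using borel_R[unfolded borel_order_def] by measurable

lemma uppeq_measurable:
  "Measurable.pred ((borel \<Otimes>\<^sub>M borel) \<Otimes>\<^sub>M borel \<Otimes>\<^sub>M borel)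
     (\<lambda>q. Upair (fst (snd q)) (snd (snd q)) \<in> uppeq R E (Upair (fst (fst q)) (snd (fst q))))"
  unfolding uppeq_def mem_Collect_eq Upair_inject using borel_R[unfolded borel_order_def] by measurable

lemma lcl_measurable [measurable (raw)]:
  assumes [measurable]: "p \<in> measurable N (borel \<Otimes>\<^sub>M borel)" "a \<in> borel_measurable N" "b \<in> borel_measurable N"
  shows "Measurable.pred N (\<lambda>q. b q \<in> lcl (p q) (a q))"
proof -
  have "(\<lambda>q. (p q, a q, b q)) \<in> measurable N ((borel \<Otimes>\<^sub>M borel) \<Otimes>\<^sub>M borel \<Otimes>\<^sub>M borel)" by measurable
  from measurable_compose[OF this gcomp_measurable[OF upper_measurable upper_subset]] show ?thesis by simp
qed

lemma small_lcl_measurable [measurable (raw)]: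
  assumes [measurable]: "p \<in> measurable N (borel \<Otimes>\<^sub>M borel)" "a \<in> borel_measurable N"
  shows "Measurable.pred N (\<lambda>q. small n (lcl (p q) (a q)))"
proof -
  have "(\<lambda>q. (p q, a q)) \<in> measurable N ((borel \<Otimes>\<^sub>M borel) \<Otimes>\<^sub>M borel)" by measurable
  from measurable_compose[OF this card_gcomp_measurable[OF upper_measurable upper_subset, of n]]
  show ?thesis by (simp add: small_def)
qed

lemma small_ucl_measurable [measurable (raw)]:
  assumes [measurable]: "p \<in> measurable N (borel \<Otimes>\<^sub>M borel)" "a \<in> borel_measurable N"
  shows "Measurable.pred N (\<lambda>q. small n (ucl (p q) (a q)))"
proof -
  have "(\<lambda>q. (p q, a q)) \<in> measurable N ((borel \<Otimes>\<^sub>M borel) \<Otimes>\<^sub>M borel)" by measurable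
  from measurable_compose[OF this card_gcomp_measurable[OF uppeq_measurable uppeq_subset, of n]]
  show ?thesis by (simp add: small_def)
qed

lemma small_gcomp_measurable [measurable]: "Measurable.pred borel (\<lambda>x. small n (gcomp E x))"
proof -
  have "Measurable.pred ((borel::'a measure) \<Otimes>\<^sub>M borel \<Otimes>\<^sub>M borel) (\<lambda>q. Upair (fst (snd q)) (snd (snd q)) \<in> E)"
    by measurable
  from card_gcomp_measurable[OF this order_refl, of n]
  have *: "Measurable.pred ((borel::'a measure) \<Otimes>\<^sub>M borel) (\<lambda>q. small n (gcomp E (snd q)))" by (simp add: small_def)
  have "(\<lambda>x. (x, x)) \<in> measurable borel ((borel::'a measure) \<Otimes>\<^sub>M borel)" by measurable
  from measurable_compose[OF this *] show ?thesis by simp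
qed

lemma wired_cut_measurable [measurable]:
  "Measurable.pred (borel \<Otimes>\<^sub>M borel) (\<lambda>p. Upair (fst p) (snd p) \<in> wired_cut E R)"
proof -
  have fin: "finite S \<longleftrightarrow> (\<exists>n. small n S)" for S :: "'a set" by (auto simp: small_def)
  have "Upair (fst p) (snd p) \<in> wired_cut E R \<longleftrightarrow> Upair (fst p) (snd p) \<in> E \<and> snd p \<notin> lcl p (fst p) \<and>
     ((\<exists>n. small n (lcl p (fst p))) \<or> (\<exists>n. small n (lcl p (snd p))))" for p
    unfolding mem_wired_cut fin ..
  then show ?thesis by (simp only:) measurable
qed

text \<open>The numbers \<open>harm_wt n = 1/(n+1) - 1/(n+2)\<close> turn the mass \<open>1/|S| - 1/|T|\<close> received by a vertex
  whose cluster grows from \<open>S\<close> to \<open>T\<close> into a sum over the sizes \<open>n + 1\<close> with \<open>|S| \<le> n + 1 < |T|\<close>; for a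
  fixed size every vertex has at most one exit edge, which makes the incoming mass computable.
  \<open>share x y\<close> is the part of the unit mass of the edge \<open>xy\<close> that goes to the cluster of \<open>x\<close>.\<close>

definition excess :: "nat \<Rightarrow> 'a \<Rightarrow> 'a \<Rightarrow> ennreal" where
  "excess n x y = of_nat (card (lcl (x, y) x)) * of_bool (small (Suc n) (lcl (x, y) x) \<and> \<not> small (Suc n) (ucl (x, y) x))"

definition share :: "'a \<Rightarrow> 'a \<Rightarrow> ennreal" where
  "share x y = (\<Sum>n. ennreal (harm_wt n) * excess n x y)"

lemma excess_measurable [measurable]: "(\<lambda>p. excess n (fst p) (snd p)) \<in> borel_measurable (borel \<Otimes>\<^sub>M borel)"
proof -
  have card: "of_nat (card S) = (\<Sum>m<N. if small m S then 0 else 1 :: ennreal)" if "small N S" for N and S :: "'a set"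
  proof -
    have "(\<Sum>m<N. if small m S then 0 else 1 :: ennreal) = of_nat (card ({..<N} \<inter> - {m. small m S}))"
      by (simp add: sum.If_cases)
    also have "{..<N} \<inter> - {m. small m S} = {..<card S}" using that by (auto simp: small_def)
    finally show ?thesis by simp
  qed
  have "excess n (fst p) (snd p) = (if small (Suc n) (lcl p (fst p)) \<and> \<not> small (Suc n) (ucl p (fst p))
      then (\<Sum>m<Suc n. if small m (lcl p (fst p)) then 0 else 1) else 0)" for p
    unfolding excess_def prod.collapse using card[of "Suc n" "lcl p (fst p)"] by (simp del: sum.lessThan_Suc)
  then show ?thesis by (simp only:) measurable
qed

lemma share_measurable [measurable]: "(\<lambda>p. share (fst p) (snd p)) \<in> borel_measurable (borel \<Otimes>\<^sub>M borel)"
  unfolding share_def by measurable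

text \<open>Each vertex of the lower cluster receives a telescoped sum, and there are
  \<open>card\<close> many of them. If the upper cluster is infinite, the quotient is a division by
  0 and the share is the whole unit mass.\<close>

lemma share_eq:
  "share x y = (if finite (lcl (x, y) x) then ennreal (1 - real (card (lcl (x, y) x)) / real (card (ucl (x, y) x))) else 0)"
proof (cases "finite (lcl (x, y) x)")
  case True
  define S where "S = lcl (x, y) x"
  define T where "T = ucl (x, y) x"
  have fin: "finite S" using True by (simp add: S_def)
  have ST: "S \<subseteq> T" unfolding S_def T_def by (rule gcomp_mono[OF upper_uppeq])
  have "x \<in> S" by (simp add: S_def)
  then have "0 < card S" using fin card_gt_0_iff by blast
  then have s: "1 \<le> card S" by simp
  have le: "finite T \<Longrightarrow> card S \<le> card T" using ST by (rule card_mono[rotated])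
  have "share x y = (\<Sum>n. of_nat (card S) * ennreal (if card S \<le> Suc n \<and> \<not> small (Suc n) T then harm_wt n else 0))"
    unfolding share_def excess_def S_def[symmetric] T_def[symmetric]
    by (intro suminf_cong) (use fin in \<open>auto simp: small_def mult.commute\<close>)
  also have "\<dots> = of_nat (card S) * ennreal (1 / real (card S) - 1 / real (card T))"
    unfolding ennreal_suminf_cmult by (simp add: suminf_harm_wt[OF s le])
  also have "\<dots> = ennreal (real (card S) * (1 / real (card S) - 1 / real (card T)))"
    by (simp add: ennreal_of_nat_eq_real_of_nat ennreal_mult')
  also have "real (card S) * (1 / real (card S) - 1 / real (card T)) = 1 - real (card S) / real (card T)"
    using s by (simp add: right_diff_distrib)
  finally show ?thesis using True by (simp add: S_def T_def)
next
  case False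
  then show ?thesis by (simp add: share_def excess_def small_def)
qed

text \<open>An edge inside a cluster changes nothing, so both shares vanish. Two distinct finite
  clusters S and S' have shares |S'|/(|S|+|S'|) and |S|/(|S|+|S'|). If exactly one is finite it
  takes everything, and if both are infinite neither takes anything.\<close>

lemma share_add:
  assumes e: "Upair x y \<in> E"
  shows "share x y + share y x = of_bool (Upair x y \<in> wired_cut E R)"
proof -
  define U where "U = upper R E (Upair x y)"
  define S where "S = gcomp U"
  have yx: "Upair y x = Upair x y" by simp
  have uq: "uppeq R E (Upair x y) = insert (Upair x y) U" using uppeq_insert[OF e] by (simp add: U_def)
  have sx: "share x y = (if finite (S x) then ennreal (1 - real (card (S x)) / real (card (gcomp (insert (Upair x y) U) x))) else 0)"
    unfolding share_eq S_def U_def using uq by (simp add: U_def)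
  have sy: "share y x = (if finite (S y) then ennreal (1 - real (card (S y)) / real (card (gcomp (insert (Upair y x) U) y))) else 0)"
    unfolding share_eq S_def fst_conv snd_conv yx uq by (simp add: U_def)
  have wc: "Upair x y \<in> wired_cut E R \<longleftrightarrow> y \<notin> S x \<and> (finite (S x) \<or> finite (S y))"
    unfolding mem_wired_cut S_def U_def using e by simp
  show ?thesis
  proof (cases "y \<in> S x")
    case True
    then have xs: "x \<in> S y" unfolding S_def by (rule gcomp_sym)
    have "card (S v) > 0" if "finite (S v)" for v
      using that gcomp_refl[of v U] unfolding S_def by (metis card_gt_0_iff empty_iff)
    then show ?thesis unfolding sx sy wc using gcomp_insert_inner[of y U x] gcomp_insert_inner[of x U y] True xs
      by (auto simp: S_def)
  next
    case False
    then have xs: "x \<notin> S y" unfolding S_def using gcomp_sym by metis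
    have gx: "gcomp (insert (Upair x y) U) x = S x \<union> S y" using gcomp_insert_edge False unfolding S_def by metis
    have gy: "gcomp (insert (Upair y x) U) y = S x \<union> S y" using gcomp_insert_edge[of x U y] xs unfolding S_def by auto
    have disj: "S x \<inter> S y = {}" using gcomp_disjoint False unfolding S_def by metis
    show ?thesis
    proof (cases "finite (S x) \<and> finite (S y)")
      case True
      then have c: "card (S x \<union> S y) = card (S x) + card (S y)" using disj by (intro card_Un_disjoint) auto
      have pos: "card (S x) > 0" "card (S y) > 0"
        using True gcomp_refl[of x U] gcomp_refl[of y U] unfolding S_def by (metis card_gt_0_iff empty_iff)+
      have "share x y + share y x = ennreal ((1 - real (card (S x)) / real (card (S x) + card (S y))) + (1 - real (card (S y)) / real (card (S x) + card (S y))))"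
        unfolding sx sy gx gy c using True pos by (subst ennreal_plus) (auto simp: divide_simps)
      also have "\<dots> = ennreal (2 - (real (card (S x)) + real (card (S y))) / real (card (S x) + card (S y)))"
        by (simp only: add_divide_distrib) (simp only: algebra_simps, simp)
      also have "\<dots> = ennreal 1" using pos by simp
      finally show ?thesis using False True wc by simp
    next
      case nf: False
      then have "infinite (S x \<union> S y)" by auto
      then have "card (S x \<union> S y) = 0" by simp
      then show ?thesis unfolding sx sy gx gy wc using nf False by auto
    qed
  qed
qed

text \<open>The size of the cluster of \<open>x\<close> is the number of vertices \<open>z\<close>
  that exit through \<open>xy\<close>. Listing these receivers one by one gives the form to which
  \<open>mass_transport\<close> applies.\<close>

lemma excess_sum:
  "(\<Sum>y\<in>nbhd E x. excess n x y) = (\<integral>\<^sup>+z. (\<Sum>y\<in>nbhd E x. of_bool (exit_edge R E (Suc n) z x y)) \<partial>count_space (gcomp E x))"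
proof -
  have "excess n x y = (\<integral>\<^sup>+z. of_bool (exit_edge R E (Suc n) z x y) \<partial>count_space (gcomp E x))" if "y \<in> nbhd E x" for y
  proof (cases "small (Suc n) (lcl (x, y) x) \<and> \<not> small (Suc n) (ucl (x, y) x)")
    case True
    have "of_bool (exit_edge R E (Suc n) z x y) = (indicator (lcl (x, y) x) z :: ennreal)" for z
      using True that by (auto simp: exit_edge_def indicator_def nbhd_def)
    then have "(\<integral>\<^sup>+z. of_bool (exit_edge R E (Suc n) z x y) \<partial>count_space (gcomp E x)) = emeasure (count_space (gcomp E x)) (lcl (x, y) x)"
      using gcomp_mono[OF upper_subset, of R E "Upair x y" x] by simp
    also have "\<dots> = of_nat (card (lcl (x, y) x))"
      using True gcomp_mono[OF upper_subset, of R E "Upair x y" x]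
      by (intro emeasure_count_space_finite) (simp_all add: small_def)
    finally show ?thesis using True by (simp add: excess_def)
  next
    case False
    then have "\<not> exit_edge R E (Suc n) z x y" for z by (auto simp: exit_edge_def)
    then show ?thesis using False by (simp add: excess_def)
  qed
  then have "(\<Sum>y\<in>nbhd E x. excess n x y) = (\<Sum>y\<in>nbhd E x. \<integral>\<^sup>+z. of_bool (exit_edge R E (Suc n) z x y) \<partial>count_space (gcomp E x))"
    by (intro sum.cong) auto
  also have "\<dots> = (\<integral>\<^sup>+z. (\<Sum>y\<in>nbhd E x. of_bool (exit_edge R E (Suc n) z x y)) \<partial>count_space (gcomp E x))"
    by (rule nn_integral_sum[symmetric]) simp
  finally show ?thesis .
qed

lemma exit_count:
  "(\<integral>\<^sup>+x. (\<Sum>y\<in>nbhd E x. of_bool (exit_edge R E (Suc n) z x y)) \<partial>count_space (gcomp E z)) = of_bool (\<not> small (Suc n) (gcomp E z))"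
proof (cases "small (Suc n) (gcomp E z)")
  case True
  then have "\<not> exit_edge R E (Suc n) z x y" for x y using exit_edge_big by metis
  then show ?thesis using True by simp
next
  case False
  obtain p where p: "exit_edge R E (Suc n) z (fst p) (snd p)"
    "\<And>q. exit_edge R E (Suc n) z (fst q) (snd q) \<Longrightarrow> q = p"
    using exit_edge_ex1[OF trans_R irrefl_R total_R finite_nbhd _ False] by auto
  obtain a b where ab: "p = (a, b)" by (cases p)
  have ex: "exit_edge R E (Suc n) z x y \<longleftrightarrow> x = a \<and> y = b" for x y
    using p(1) p(2)[of "(x, y)"] by (auto simp: ab)
  have bn: "b \<in> nbhd E a" using ex[of a b] by (simp add: exit_edge_def nbhd_def)
  have "(\<Sum>y\<in>nbhd E x. of_bool (exit_edge R E (Suc n) z x y)) = (indicator {a} x :: ennreal)" for x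
  proof (cases "x = a")
    case True
    then show ?thesis using bn finite_nbhd[of a] by (simp add: ex of_bool_def)
  qed (simp add: ex)
  moreover have "a \<in> gcomp E z" using exit_edge_gcomp ex by metis
  ultimately show ?thesis using False by simp
qed

text \<open>Every forest edge is seen from both ends; moving the second share across its edge gives
  the factor 2. For a fixed size bound the excess is then transported within components, where each
  vertex of a larger component receives exactly one unit, by uniqueness of its exit edge. Summing
  the weights over the sizes beneath that of the component gives the integrand on the right.\<close>

theorem nn_integral_wired_cut:
  "(\<integral>\<^sup>+x. (\<Sum>y\<in>nbhd E x. of_bool (Upair x y \<in> wired_cut E R)) \<partial>M) = 2 * (\<integral>\<^sup>+x. ennreal (1 - 1 / real (card (gcomp E x))) \<partial>M)"
proof -
  define I where "I = (\<integral>\<^sup>+x. (\<Sum>y\<in>nbhd E x. share x y) \<partial>M)"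
  have sw: "(\<lambda>p. share (snd p) (fst p)) \<in> borel_measurable (borel \<Otimes>\<^sub>M borel)"
    using measurable_compose[OF measurable_Pair[OF measurable_snd measurable_fst] share_measurable] by simp
  have "(\<integral>\<^sup>+x. (\<Sum>y\<in>nbhd E x. of_bool (Upair x y \<in> wired_cut E R)) \<partial>M)
      = (\<integral>\<^sup>+x. (\<Sum>y\<in>nbhd E x. share x y) + (\<Sum>y\<in>nbhd E x. share y x) \<partial>M)"
    unfolding sum.distrib[symmetric] by (intro nn_integral_cong sum.cong refl) (simp add: share_add nbhd_def)
  also have "\<dots> = I + (\<integral>\<^sup>+x. (\<Sum>y\<in>nbhd E x. share y x) \<partial>M)"
    unfolding I_def using sum_nbhd_measurable[OF share_measurable measurable_ident] sum_nbhd_measurable[OF sw measurable_ident]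
    by (intro nn_integral_add) (auto simp: measurable_cong_sets[OF sets_M refl])
  also have "(\<integral>\<^sup>+x. (\<Sum>y\<in>nbhd E x. share y x) \<partial>M) = I"
    unfolding I_def by (rule edge_mass_transport[OF share_measurable, symmetric])
  finally have "(\<integral>\<^sup>+x. (\<Sum>y\<in>nbhd E x. of_bool (Upair x y \<in> wired_cut E R)) \<partial>M) = 2 * I" by (simp add: mult_2)
  moreover have "I = (\<integral>\<^sup>+x. ennreal (1 - 1 / real (card (gcomp E x))) \<partial>M)"
  proof -
    have ms: "(\<lambda>x. \<Sum>y\<in>nbhd E x. excess n x y) \<in> borel_measurable M" for n
      using sum_nbhd_measurable[OF excess_measurable measurable_ident] by (simp add: measurable_cong_sets[OF sets_M refl])
    have "I = (\<integral>\<^sup>+x. (\<Sum>n. ennreal (harm_wt n) * (\<Sum>y\<in>nbhd E x. excess n x y)) \<partial>M)"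
      unfolding I_def share_def sum_distrib_left by (subst suminf_sum) auto
    also have "\<dots> = (\<Sum>n. \<integral>\<^sup>+x. ennreal (harm_wt n) * (\<Sum>y\<in>nbhd E x. excess n x y) \<partial>M)"
      using ms by (intro nn_integral_suminf) auto
    also have "\<dots> = (\<Sum>n. ennreal (harm_wt n) * (\<integral>\<^sup>+x. (\<Sum>y\<in>nbhd E x. excess n x y) \<partial>M))"
      using ms by (intro suminf_cong nn_integral_cmult) auto
    also have "\<dots> = (\<Sum>n. ennreal (harm_wt n) * (\<integral>\<^sup>+z. of_bool (\<not> small (Suc n) (gcomp E z)) \<partial>M))"
    proof -
      have "(\<integral>\<^sup>+x. (\<Sum>y\<in>nbhd E x. excess n x y) \<partial>M) = (\<integral>\<^sup>+z. of_bool (\<not> small (Suc n) (gcomp E z)) \<partial>M)" for n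
      proof -
        define k :: "'a \<Rightarrow> 'a \<Rightarrow> ennreal" where "k x z = (\<Sum>y\<in>nbhd E x. of_bool (exit_edge R E (Suc n) z x y))" for x z
        have ee: "exit_edge R E (Suc n) z x y \<longleftrightarrow> Upair x y \<in> E \<and> z \<in> lcl (x, y) x \<and> small (Suc n) (lcl (x, y) x) \<and> \<not> small (Suc n) (ucl (x, y) x)" for x y z
          by (simp add: exit_edge_def)
        have "Measurable.pred ((borel \<Otimes>\<^sub>M borel) \<Otimes>\<^sub>M borel) (\<lambda>q. exit_edge R E (Suc n) (snd (fst q)) (fst (fst q)) (snd q))"
          unfolding ee by measurable
        then have "(\<lambda>q. of_bool (exit_edge R E (Suc n) (snd (fst q)) (fst (fst q)) (snd q)) :: ennreal) \<in> borel_measurable ((borel \<Otimes>\<^sub>M borel) \<Otimes>\<^sub>M borel)"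
          unfolding of_bool_def by measurable
        from sum_nbhd_measurable[OF this measurable_fst]
        have "(\<lambda>p. k (fst p) (snd p)) \<in> borel_measurable (borel \<Otimes>\<^sub>M borel)" unfolding k_def .
        from mass_transport[OF this] show ?thesis unfolding excess_sum unfolding k_def exit_count .
      qed
      then show ?thesis by simp
    qed
    also have "\<dots> = (\<Sum>n. \<integral>\<^sup>+z. ennreal (harm_wt n) * of_bool (\<not> small (Suc n) (gcomp E z)) \<partial>M)"
      unfolding of_bool_def by (intro suminf_cong nn_integral_cmult[symmetric]) measurable
    also have "\<dots> = (\<integral>\<^sup>+z. (\<Sum>n. ennreal (harm_wt n) * of_bool (\<not> small (Suc n) (gcomp E z))) \<partial>M)"
      unfolding of_bool_def by (intro nn_integral_suminf[symmetric]) measurable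
    also have "\<dots> = (\<integral>\<^sup>+x. ennreal (1 - 1 / real (card (gcomp E x))) \<partial>M)"
    proof (rule nn_integral_cong)
      fix z
      have "finite (gcomp E z) \<Longrightarrow> 1 \<le> card (gcomp E z)"
        using gcomp_refl[of z E] by (metis One_nat_def Suc_leI card_gt_0_iff empty_iff)
      from suminf_harm_wt[OF order_refl this]
      have "(\<Sum>n. ennreal (if 1 \<le> Suc n \<and> \<not> small (Suc n) (gcomp E z) then harm_wt n else 0)) = ennreal (1 - 1 / real (card (gcomp E z)))" by simp
      moreover have "ennreal (harm_wt n) * of_bool (\<not> small (Suc n) (gcomp E z)) = ennreal (if 1 \<le> Suc n \<and> \<not> small (Suc n) (gcomp E z) then harm_wt n else 0)" for n by simp
      ultimately show "(\<Sum>n. ennreal (harm_wt n) * of_bool (\<not> small (Suc n) (gcomp E z))) = ennreal (1 - 1 / real (card (gcomp E z)))" by simp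
    qed
    finally show ?thesis .
  qed
  ultimately show ?thesis by simp
qed

end

section \<open>Edge measure and exposed points\<close>

lemma mem_edge_space:
  fixes M :: "'a::polish_space measure"
  assumes "graphing M E"
  shows "A \<in> sets (edge_space M E) \<longleftrightarrow> A \<subseteq> E \<and> adj A \<in> sets borel"
proof -
  have s: "sets M = sets borel" and E: "E \<in> sets (upair_space M)" using assms unfolding graphing_def by auto
  have "E \<inter> space (upair_space M) \<in> sets (upair_space M)" using E by auto
  then show ?thesis unfolding edge_space_def
    by (simp add: sets_restrict_space_iff sets_upair_space_iff[OF s])
qed

lemma space_edge_space [simp]: "space (edge_space M E) = E"
  by (simp add: edge_space_def space_restrict_space upair_space_def space_measure_of_conv)

lemma (in borel_graph) graphing_E: "graphing M E"
proof -
  have "adj E \<in> sets borel" using adj_E by (simp only: borel_prod)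
  then show ?thesis
    unfolding graphing_def sets_M sets_upair_space_iff[OF sets_M]
    using finite_M no_loops finite_nbhd card_nbhd symm by auto
qed

text \<open>Edge mass transport in \<open>E\<close> for the weight supported on the pairs from
  \<open>A\<close> and \<open>B\<close> that are joined in \<open>F\<close>.\<close>

lemma (in borel_graph) graphing_subset:
  assumes F: "F \<subseteq> E" "adj F \<in> sets borel"
  shows "graphing M F"
proof -
  have sub: "nbhd F x \<subseteq> nbhd E x" for x using F by (auto simp: nbhd_def)
  have D: "finite (nbhd F x) \<and> card (nbhd F x) \<le> D" for x
    using finite_subset[OF sub finite_nbhd] card_mono[OF finite_nbhd sub[of x]] card_nbhd[of x] by auto
  have "(\<integral>\<^sup>+x\<in>A. ennreal (real (degin F B x)) \<partial>M) = (\<integral>\<^sup>+x\<in>B. ennreal (real (degin F A x)) \<partial>M)"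
    if [measurable]: "A \<in> sets borel" "B \<in> sets borel" for A B
  proof -
    define w :: "'a \<Rightarrow> 'a \<Rightarrow> ennreal" where "w x y = indicator A x * indicator B y * indicator (adj F) (x, y)" for x y
    have [measurable]: "adj F \<in> sets (borel \<Otimes>\<^sub>M borel)" using F by (simp only: borel_prod)
    have w: "(\<lambda>p. w (fst p) (snd p)) \<in> borel_measurable (borel \<Otimes>\<^sub>M borel)"
      unfolding w_def by measurable
    have deg: "(\<Sum>y\<in>nbhd E x. indicator C y * indicator F (Upair x y)) = ennreal (real (degin F C x))" for C x
    proof -
      have "(\<Sum>y\<in>nbhd E x. indicator C y * indicator F (Upair x y) :: ennreal) = (\<Sum>y\<in>nbhd E x. if y \<in> C \<and> Upair x y \<in> F then 1 else 0)"
        by (intro sum.cong) (auto simp: indicator_def)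
      also have "\<dots> = of_nat (card (nbhd E x \<inter> {y. y \<in> C \<and> Upair x y \<in> F}))"
        by (simp add: sum.If_cases finite_nbhd)
      also have "nbhd E x \<inter> {y. y \<in> C \<and> Upair x y \<in> F} = {y \<in> C. Upair x y \<in> F}" using F(1) by (auto simp: nbhd_def)
      finally show ?thesis by (simp add: degin_def ennreal_of_nat_eq_real_of_nat)
    qed
    have "(\<integral>\<^sup>+x\<in>A. ennreal (real (degin F B x)) \<partial>M) = (\<integral>\<^sup>+x. (\<Sum>y\<in>nbhd E x. w x y) \<partial>M)"
      unfolding deg[symmetric] sum_distrib_right w_def
      by (intro nn_integral_cong sum.cong) (auto simp: indicator_def)
    also have "\<dots> = (\<integral>\<^sup>+x. (\<Sum>y\<in>nbhd E x. w y x) \<partial>M)" by (rule edge_mass_transport[OF w])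
    also have "\<dots> = (\<integral>\<^sup>+x\<in>B. ennreal (real (degin F A x)) \<partial>M)"
      unfolding deg[symmetric] sum_distrib_right w_def
      by (intro nn_integral_cong sum.cong) (auto simp: indicator_def Upair_commute)
    finally show ?thesis .
  qed
  then show ?thesis
    unfolding graphing_def sets_M sets_upair_space_iff[OF sets_M]
    using finite_M F no_loops D by (intro conjI exI[of _ D]) auto
qed

context borel_graph
begin

lemma nbhd_count_measurable:
  assumes "A \<subseteq> E" "adj A \<in> sets borel"
  shows "(\<lambda>x. \<Sum>y\<in>nbhd E x. indicator A (Upair x y) :: ennreal) \<in> borel_measurable M"
proof -
  have [measurable]: "adj A \<in> sets (borel \<Otimes>\<^sub>M borel)" using assms by (simp only: borel_prod)
  have "(\<lambda>q. indicator (adj A) (fst q, snd q) :: ennreal) \<in> borel_measurable (borel \<Otimes>\<^sub>M borel)" by measurable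
  from sum_nbhd_measurable[OF this measurable_ident] show ?thesis
    by (simp add: measurable_cong_sets[OF sets_M refl] indicator_def)
qed

lemma nbhd_count:
  assumes "A \<subseteq> E"
  shows "(\<Sum>y\<in>nbhd E x. indicator A (Upair x y) :: ennreal) = ennreal (real (card (nbhd A x)))"
proof -
  have "(\<Sum>y\<in>nbhd E x. indicator A (Upair x y) :: ennreal) = of_nat (card (nbhd E x \<inter> {y. Upair x y \<in> A}))"
    by (simp add: indicator_def of_bool_def sum.If_cases finite_nbhd)
  also have "nbhd E x \<inter> {y. Upair x y \<in> A} = nbhd A x" using assms by (auto simp: nbhd_def)
  finally show ?thesis by (simp add: ennreal_of_nat_eq_real_of_nat)
qed

text \<open>The Bochner integral in \<open>eta\<close> is tied to nonnegative integrals, for which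
  transport is available. Measurability comes from the enumeration of neighbours, integrability from
  the degree bound.\<close>

lemma eta_nn_integral:
  assumes A: "A \<subseteq> E" "adj A \<in> sets borel"
  shows "ennreal (eta M E A) = (\<integral>\<^sup>+x. (\<Sum>y\<in>nbhd E x. indicator A (Upair x y)) \<partial>M) / 2" and "0 \<le> eta M E A"
    and "eta M E A = enn2real (\<integral>\<^sup>+x. ennreal (real (card (nbhd A x))) \<partial>M) / 2"
proof -
  interpret finite_measure M by (rule finite_M)
  have AE: "A \<inter> E = A" using A by auto
  have "(\<lambda>x. ennreal (real (card (nbhd A x)))) \<in> borel_measurable M"
    using nbhd_count_measurable[OF A] unfolding nbhd_count[OF A(1)] .
  then have "(\<lambda>x. enn2real (ennreal (real (card (nbhd A x))))) \<in> borel_measurable M" by measurable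
  then have m: "(\<lambda>x. real (card (nbhd A x))) \<in> borel_measurable M" by simp
  have sub: "nbhd A x \<subseteq> nbhd E x" for x using A by (auto simp: nbhd_def)
  have bd: "real (card (nbhd A x)) \<le> real D" for x
    using card_mono[OF finite_nbhd sub[of x]] card_nbhd[of x] by simp
  have int: "integrable M (\<lambda>x. real (card (nbhd A x)))"
    using m bd by (intro integrable_const_bound[where B="real D"]) auto
  have "ennreal (\<integral>x. real (card (nbhd A x)) \<partial>M) = (\<integral>\<^sup>+x. ennreal (real (card (nbhd A x))) \<partial>M)"
    using int by (intro nn_integral_eq_integral[symmetric]) auto
  then show "ennreal (eta M E A) = (\<integral>\<^sup>+x. (\<Sum>y\<in>nbhd E x. indicator A (Upair x y)) \<partial>M) / 2"
    unfolding eta_def AE nbhd_count[OF A(1)] by (simp add: ennreal_divide_numeral[symmetric] integral_nonneg_AE)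
  show "0 \<le> eta M E A" unfolding eta_def by (simp add: integral_nonneg_AE)
  show "eta M E A = enn2real (\<integral>\<^sup>+x. ennreal (real (card (nbhd A x))) \<partial>M) / 2"
    unfolding eta_def AE using m by (simp add: integral_eq_nn_integral)
qed

text \<open>\<open>measure_of\<close> collapses to the zero measure unless the given set function is
  countably additive, so its values are known only after this check.\<close>

lemma edge_measure:
  assumes T: "T \<in> sets (edge_space M E)"
  defines "v \<equiv> measure_of E (sets (edge_space M E)) (\<lambda>A. ennreal (eta M E (A \<inter> T)))"
  shows "sets v = sets (edge_space M E)" and "finite_measure v"
    and "A \<in> sets (edge_space M E) \<Longrightarrow> measure v A = eta M E (A \<inter> T)"
proof -
  have sa: "sigma_algebra E (sets (edge_space M E))"
    using sets.sigma_algebra_axioms[of "edge_space M E"] by simp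
  show sv: "sets v = sets (edge_space M E)" unfolding v_def by (rule sigma_algebra.sets_measure_of_eq[OF sa])
  have mem: "A \<inter> T \<subseteq> E" "adj (A \<inter> T) \<in> sets borel" if "A \<in> sets (edge_space M E)" for A
    using sets.Int[OF that T] mem_edge_space[OF graphing_E] by auto
  have "countably_additive (sets (edge_space M E)) (\<lambda>A. ennreal (eta M E (A \<inter> T)))"
  proof (rule countably_additiveI)
    fix A :: "nat \<Rightarrow> 'a uprod set"
    assume A: "range A \<subseteq> sets (edge_space M E)" "disjoint_family A" "(\<Union>i. A i) \<in> sets (edge_space M E)"
    have Ai: "A i \<in> sets (edge_space M E)" for i using A(1) by auto
    have disj: "disjoint_family (\<lambda>i. A i \<inter> T)" using A(2) by (auto simp: disjoint_family_on_def)
    have "(\<Sum>i. ennreal (eta M E (A i \<inter> T))) = (\<Sum>i. (\<integral>\<^sup>+x. (\<Sum>y\<in>nbhd E x. indicator (A i \<inter> T) (Upair x y)) \<partial>M) / 2)"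
      by (intro suminf_cong eta_nn_integral(1) mem Ai)
    also have "\<dots> = (\<Sum>i. (\<integral>\<^sup>+x. (\<Sum>y\<in>nbhd E x. indicator (A i \<inter> T) (Upair x y)) \<partial>M)) / 2"
      by (rule ennreal_suminf_divide)
    also have "(\<Sum>i. (\<integral>\<^sup>+x. (\<Sum>y\<in>nbhd E x. indicator (A i \<inter> T) (Upair x y)) \<partial>M)) =
        (\<integral>\<^sup>+x. (\<Sum>i. \<Sum>y\<in>nbhd E x. indicator (A i \<inter> T) (Upair x y)) \<partial>M)"
      by (intro nn_integral_suminf[symmetric] nbhd_count_measurable mem Ai)
    also have "\<dots> = (\<integral>\<^sup>+x. (\<Sum>y\<in>nbhd E x. indicator (\<Union>i. A i \<inter> T) (Upair x y)) \<partial>M)"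
      by (intro nn_integral_cong, subst suminf_sum) (auto simp: suminf_indicator[OF disj])
    also have "(\<Union>i. A i \<inter> T) = (\<Union>i. A i) \<inter> T" by auto
    also have "(\<integral>\<^sup>+x. (\<Sum>y\<in>nbhd E x. indicator ((\<Union>i. A i) \<inter> T) (Upair x y)) \<partial>M) / 2 = ennreal (eta M E ((\<Union>i. A i) \<inter> T))"
      by (rule eta_nn_integral(1)[symmetric]) (use mem[OF A(3)] in auto)
    finally show "(\<Sum>i. ennreal (eta M E (A i \<inter> T))) = ennreal (eta M E ((\<Union>i. A i) \<inter> T))" .
  qed
  moreover have "positive (sets (edge_space M E)) (\<lambda>A. ennreal (eta M E (A \<inter> T)))"
    by (simp add: positive_def eta_def nbhd_def)
  ultimately have em: "emeasure v A = ennreal (eta M E (A \<inter> T))" if "A \<in> sets (edge_space M E)" for A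
    unfolding v_def using that by (intro emeasure_measure_of_sigma[OF sa])
  show "measure v A = eta M E (A \<inter> T)" if "A \<in> sets (edge_space M E)"
    using em[OF that] eta_nn_integral(2)[OF mem[OF that]] by (simp add: measure_def)
  have "space v = E" using sets_eq_imp_space_eq[OF sv] by simp
  then show "finite_measure v" using em[of E] sets.top[of "edge_space M E"] by (intro finite_measureI) simp
qed

text \<open>The indicator of the forest exposes its measure: a competitor that puts all its mass on
  \<open>T\<close> is squeezed between the two bounds given by \<open>\<phi> \<le> \<eta>\<close> on complementary subsets of \<open>T\<close>.\<close>

theorem exposed_point_forest:
  assumes T: "T \<in> sets (edge_space M E)"
    and le: "\<And>A. A \<in> sets (edge_space M E) \<Longrightarrow> \<phi> A \<le> eta M E A"
    and indep: "\<And>A. A \<in> sets (edge_space M E) \<Longrightarrow> eta M E (A \<inter> T) \<le> \<phi> A"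
    and span: "eta M E T = \<phi> E"
  shows "exposed_point M E \<phi> (measure_of E (sets (edge_space M E)) (\<lambda>A. ennreal (eta M E (A \<inter> T))))"
    (is "exposed_point M E \<phi> ?v")
proof -
  note v = edge_measure[OF T]
  have Etop: "E \<in> sets (edge_space M E)" using sets.top[of "edge_space M E"] by simp
  have TE: "T \<subseteq> E" using sets.sets_into_space[OF T] by simp
  have vT: "measure ?v T = \<phi> E" and vE: "measure ?v E = \<phi> E"
    using v(3)[OF T] v(3)[OF Etop] span TE by (auto simp: Int_absorb1)
  have mem: "?v \<in> bmm M E \<phi>" using v vE indep unfolding bmm_def by auto
  have eta_add: "eta M E T = eta M E (A \<inter> T) + eta M E (T - A)" if A: "A \<in> sets (edge_space M E)" for A
  proof -
    interpret finite_measure ?v by (rule v(2))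
    have "measure ?v T = measure ?v (A \<inter> T) + measure ?v (T - A)"
      using A T by (subst finite_measure_Union[symmetric]) (auto simp: v(1) Un_Diff_Int intro!: arg_cong[where f="measure ?v"])
    then show ?thesis using A T by (simp add: v(3) Int_absorb2 Int_assoc)
  qed
  have int: "(\<integral>e. indicator T e \<partial>\<alpha>) = measure \<alpha> T" if "sets \<alpha> = sets (edge_space M E)" for \<alpha> :: "'a uprod measure"
    using T TE sets_eq_imp_space_eq[OF that] by (simp add: Int_absorb2)
  have "measure \<alpha> T \<le> measure ?v T \<and> (measure \<alpha> T = measure ?v T \<longrightarrow> \<alpha> = ?v)" if \<alpha>: "\<alpha> \<in> bmm M E \<phi>" for \<alpha>
  proof -
    have s: "sets \<alpha> = sets (edge_space M E)" and fin: "finite_measure \<alpha>" and \<alpha>le: "\<And>A. A \<in> sets (edge_space M E) \<Longrightarrow> measure \<alpha> A \<le> \<phi> A"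
      and \<alpha>E: "measure \<alpha> E = \<phi> E" using \<alpha> unfolding bmm_def by auto
    interpret \<alpha>: finite_measure \<alpha> by (rule fin)
    interpret v: finite_measure ?v by (rule v(2))
    have "measure \<alpha> T \<le> measure \<alpha> E" using TE Etop s by (intro \<alpha>.finite_measure_mono) auto
    moreover have "\<alpha> = ?v" if eq: "measure \<alpha> T = measure ?v T"
    proof (rule measure_eqI)
      show "sets \<alpha> = sets ?v" using s v(1) by simp
      fix A assume "A \<in> sets \<alpha>"
      then have A: "A \<in> sets (edge_space M E)" using s by simp
      then have AE: "A \<subseteq> E" using sets.sets_into_space by fastforce
      have split: "measure \<alpha> B = measure \<alpha> (B \<inter> C) + measure \<alpha> (B - C)" if "B \<in> sets (edge_space M E)" "C \<in> sets (edge_space M E)" for B C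
        using that s by (subst \<alpha>.finite_measure_Union[symmetric]) (auto intro!: arg_cong[where f="measure \<alpha>"])
      have "measure \<alpha> (E - T) = 0" using split[OF Etop T] eq vT \<alpha>E TE by (simp add: Int_absorb1)
      moreover have "measure \<alpha> (A - T) \<le> measure \<alpha> (E - T)" using AE Etop T A s by (intro \<alpha>.finite_measure_mono) auto
      ultimately have AT: "measure \<alpha> (A - T) = 0" using measure_nonneg[of \<alpha> "A - T"] by linarith
      have "measure \<alpha> (A \<inter> T) \<le> eta M E (A \<inter> T)" "measure \<alpha> (T - A) \<le> eta M E (T - A)"
        using \<alpha>le le A T by (meson order_trans sets.Int sets.Diff)+
      moreover have "measure \<alpha> T = measure \<alpha> (A \<inter> T) + measure \<alpha> (T - A)" using split[OF T A] by (simp add: Int_commute)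
      ultimately have "measure \<alpha> (A \<inter> T) = eta M E (A \<inter> T)" using eta_add[OF A] eq vT span by linarith
      then have "measure \<alpha> A = measure ?v A" using split[OF A T] AT v(3)[OF A] by simp
      then show "emeasure \<alpha> A = emeasure ?v A" by (simp add: \<alpha>.emeasure_eq_measure v.emeasure_eq_measure)
    qed
    ultimately show ?thesis using \<alpha>E vT by auto
  qed
  then have "\<forall>\<alpha>\<in>bmm M E \<phi>. (\<integral>e. (indicator T e :: real) \<partial>\<alpha>) \<le> (\<integral>e. indicator T e \<partial>?v) \<and>
      ((\<integral>e. (indicator T e :: real) \<partial>\<alpha>) = (\<integral>e. indicator T e \<partial>?v) \<longrightarrow> \<alpha> = ?v)"
    unfolding int[OF v(1)] using int by (simp add: bmm_def)
  moreover have "(indicator T :: _ \<Rightarrow> real) \<in> borel_measurable (edge_space M E)" using T by simp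
  moreover have "bounded (range (indicator T :: 'a uprod \<Rightarrow> real))"
    by (rule boundedI[of _ 1]) (auto simp: indicator_def)
  ultimately show ?thesis unfolding exposed_point_def using mem by blast
qed

end

section \<open>Wired forests as bases\<close>

text \<open>The order is measurable with respect to edges, whereas clusters are described by
  vertices. Passing from pairs of vertices to edges is measurable into the edge space only over
  adjacent pairs, hence the restriction to \<open>S\<close>. Nothing is lost there because
  \<open>R\<close> lives on \<open>E \<times> E\<close>.\<close>

lemma borel_total_order_borel_order:
  fixes M :: "'a::polish_space measure"
  assumes G: "graphing M E" and R: "borel_total_order M E R"
  shows "trans R" "irrefl R" "total_on E R" "borel_order R"
proof -
  have RE: "R \<subseteq> E \<times> E" and Rs: "R \<in> sets (edge_space M E \<Otimes>\<^sub>M edge_space M E)" and so: "strict_linear_order_on E R"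
    using R unfolding borel_total_order_def by auto
  show "trans R" "irrefl R" "total_on E R" using so by (auto simp: strict_linear_order_on_def)
  define K :: "(('a \<times> 'a) \<times> 'a \<times> 'a) measure" where "K = (borel \<Otimes>\<^sub>M borel) \<Otimes>\<^sub>M borel \<Otimes>\<^sub>M borel"
  define S where "S = {q::('a \<times> 'a) \<times> 'a \<times> 'a. fst q \<in> adj E \<and> snd q \<in> adj E}"
  define up where "up p = Upair (fst p) (snd p)" for p :: "'a \<times> 'a"
  have adjE: "adj E \<in> sets (borel \<Otimes>\<^sub>M borel)"
    unfolding borel_prod using mem_edge_space[OF G, of E] sets.top[of "edge_space M E"] by simp
  have upm: "(\<lambda>q. up (h q)) \<in> measurable (restrict_space K S) (edge_space M E)"
    if h: "h \<in> measurable K (borel \<Otimes>\<^sub>M borel)" and hS: "\<And>q. q \<in> S \<Longrightarrow> h q \<in> adj E" for h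
  proof (rule measurableI)
    fix q assume "q \<in> space (restrict_space K S)"
    then have "h q \<in> adj E" using hS by (simp add: space_restrict_space)
    then show "up (h q) \<in> space (edge_space M E)" by (cases "h q") (simp add: up_def)
  next
    fix A assume A: "A \<in> sets (edge_space M E)"
    then have "adj A \<in> sets (borel \<Otimes>\<^sub>M borel)" unfolding borel_prod using mem_edge_space[OF G] by simp
    moreover have "h \<in> measurable (restrict_space K S) (borel \<Otimes>\<^sub>M borel)" using h by (rule measurable_restrict_space1)
    ultimately have "h -` adj A \<inter> space (restrict_space K S) \<in> sets (restrict_space K S)" by (rule measurable_sets[rotated])
    moreover have "(\<lambda>q. up (h q)) -` A = h -` adj A" by (auto simp: up_def adj_def)
    ultimately show "(\<lambda>q. up (h q)) -` A \<inter> space (restrict_space K S) \<in> sets (restrict_space K S)" by simp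
  qed
  have "(\<lambda>q. up (fst q)) \<in> measurable (restrict_space K S) (edge_space M E)"
    by (rule upm) (simp_all add: K_def S_def)
  moreover have "(\<lambda>q. up (snd q)) \<in> measurable (restrict_space K S) (edge_space M E)"
    by (rule upm) (simp_all add: K_def S_def)
  ultimately have "(\<lambda>q. (up (fst q), up (snd q))) \<in> measurable (restrict_space K S) (edge_space M E \<Otimes>\<^sub>M edge_space M E)"
    by (rule measurable_Pair)
  from measurable_sets[OF this Rs]
  have *: "(\<lambda>q. (up (fst q), up (snd q))) -` R \<inter> space (restrict_space K S) \<in> sets (restrict_space K S)" .
  have "Measurable.pred K (\<lambda>q. fst q \<in> adj E \<and> snd q \<in> adj E)"
    unfolding K_def using adjE by measurable
  then have "S \<inter> space K \<in> sets K" by (simp add: S_def pred_def Int_def conj_commute)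
  moreover have spK: "space K = UNIV" by (simp add: K_def space_pair_measure)
  ultimately have "(\<lambda>q. (up (fst q), up (snd q))) -` R \<inter> space (restrict_space K S) \<in> sets K"
    using * by (simp add: sets_restrict_space_iff)
  moreover have "(\<lambda>q. (up (fst q), up (snd q))) -` R \<inter> space (restrict_space K S) = {q. (up (fst q), up (snd q)) \<in> R}"
    using RE by (auto simp: space_restrict_space spK S_def up_def)
  ultimately show "borel_order R" unfolding borel_order_def by (simp add: pred_def spK K_def[symmetric] up_def)
qed

lemma wired_cut_subset: "wired_cut E R \<subseteq> E" by (auto simp: wired_cut_def)

text \<open>Deleting edges only shrinks clusters, so an end with a finite cluster that misses the
  other end keeps this property.\<close>

lemma wired_cut_of_subset:
  assumes "F \<subseteq> wired_cut E R" shows "wired_cut F R = F"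
proof
  have FE: "F \<subseteq> E" using assms wired_cut_subset by blast
  show "F \<subseteq> wired_cut F R"
  proof
    fix e assume e: "e \<in> F"
    then obtain x y where xy: "e = Upair x y" "y \<notin> gcomp (upper R E e) x" "finite (gcomp (upper R E e) x)"
      using assms unfolding wired_cut_def by blast
    have "gcomp (upper R F e) x \<subseteq> gcomp (upper R E e) x" using FE by (intro gcomp_mono) (auto simp: upper_def)
    then have "y \<notin> gcomp (upper R F e) x" "finite (gcomp (upper R F e) x)" using xy(2,3) finite_subset by blast+
    then show "e \<in> wired_cut F R" unfolding wired_cut_def using e xy(1) by blast
  qed
qed (rule wired_cut_subset)

text \<open>For infinite \<open>T\<close> the right side is 1, by \<open>card T = 0\<close> and
  division by 0.\<close>

lemma one_minus_inverse_card_mono: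
  assumes "S \<subseteq> T" "S \<noteq> {}"
  shows "1 - 1 / real (card S) \<le> 1 - 1 / real (card T)"
proof (cases "finite T")
  case True
  then have "0 < card S" "card S \<le> card T" using assms by (auto simp: card_gt_0_iff card_mono intro: finite_subset)
  then show ?thesis by (simp add: frac_le)
next
  case False
  then show ?thesis by simp
qed

locale ordered_graphing =
  fixes M :: "'a::polish_space measure" and E :: "'a uprod set" and R :: "('a uprod \<times> 'a uprod) set"
  assumes graphing: "graphing M E" and order: "borel_total_order M E R"
begin

text \<open>The enumeration of neighbours is constructed anew for \<open>F\<close>, so that the
  transport identity can be read inside \<open>F\<close>; the order is inherited.\<close>

lemma subset_graph:
  assumes "F \<in> sets (edge_space M E)"
  obtains f D where "ordered_borel_graph M F f D R"
proof -
  obtain f D where "borel_graph M E f D" using graphing_borel_graph[OF graphing] by blast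
  then interpret G: borel_graph M E f D .
  have F: "F \<subseteq> E" "adj F \<in> sets borel" using assms mem_edge_space[OF graphing] by auto
  obtain f' D' where b: "borel_graph M F f' D'" using graphing_borel_graph[OF G.graphing_subset[OF F]] by blast
  have "total_on F R" using borel_total_order_borel_order(3)[OF graphing order] F(1) by (auto simp: total_on_def)
  then show ?thesis using b borel_total_order_borel_order[OF graphing order]
    by (intro that[of f' D']) (simp add: ordered_borel_graph_def ordered_borel_graph_axioms_def)
qed

lemma grank_facts:
  assumes F: "F \<in> sets (edge_space M E)"
  shows "integrable M (\<lambda>x. 1 - 1 / real (card (gcomp F x)))"
    and "wired_cut F R \<in> sets (edge_space M E)" and "eta M E (wired_cut F R) = grank M E F"
proof -
  have FE: "F \<subseteq> E" using F mem_edge_space[OF graphing] by auto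
  obtain f D where "ordered_borel_graph M F f D R" using subset_graph[OF F] by blast
  then interpret G: ordered_borel_graph M F f D R .
  interpret finite_measure M by (rule G.finite_M)
  have pos: "0 \<le> 1 - 1 / real (card (gcomp F x))" for x
    using one_minus_inverse_card_mono[of "{x}" "gcomp F x"] by simp
  have "(\<lambda>x. ennreal (1 - 1 / real (card (gcomp F x)))) \<in> borel_measurable borel"
  proof -
    \<comment> \<open>The rank integrand is written as a series in the conditions
      \<open>small\<close>, whose measurability is already known.\<close>
    have "ennreal (1 - 1 / real (card (gcomp F x))) = (\<Sum>n. if small (Suc n) (gcomp F x) then 0 else ennreal (harm_wt n))" for x
    proof -
      have "finite (gcomp F x) \<Longrightarrow> 1 \<le> card (gcomp F x)"
        using gcomp_refl[of x F] by (metis One_nat_def Suc_leI card_gt_0_iff empty_iff)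
      from suminf_harm_wt[OF order_refl this]
      have "ennreal (1 - 1 / real (card (gcomp F x))) = (\<Sum>n. ennreal (if 1 \<le> Suc n \<and> \<not> small (Suc n) (gcomp F x) then harm_wt n else 0))" by simp
      also have "\<dots> = (\<Sum>n. if small (Suc n) (gcomp F x) then 0 else ennreal (harm_wt n))"
        by (intro suminf_cong) simp
      finally show ?thesis .
    qed
    then show ?thesis by (simp only:) measurable
  qed
  then have "(\<lambda>x. enn2real (ennreal (1 - 1 / real (card (gcomp F x))))) \<in> borel_measurable borel" by measurable
  then have m: "(\<lambda>x. 1 - 1 / real (card (gcomp F x))) \<in> borel_measurable M"
    using pos by (simp add: measurable_cong_sets[OF G.sets_M refl])
  show "integrable M (\<lambda>x. 1 - 1 / real (card (gcomp F x)))"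
    using m pos by (intro integrable_const_bound[where B=1]) auto
  have W: "wired_cut F R \<subseteq> F" by (rule wired_cut_subset)
  have "adj (wired_cut F R) = {p. Upair (fst p) (snd p) \<in> wired_cut F R}" by auto
  then have "adj (wired_cut F R) \<in> sets (borel \<Otimes>\<^sub>M borel)"
    using G.wired_cut_measurable by (simp add: pred_def space_pair_measure)
  then have Wb: "adj (wired_cut F R) \<in> sets borel" by (simp only: borel_prod)
  then show WE: "wired_cut F R \<in> sets (edge_space M E)" using W FE mem_edge_space[OF graphing] by auto
  have "eta M E (wired_cut F R) = eta M F (wired_cut F R)" using W FE by (simp add: eta_def Int_absorb2)
  also have "\<dots> = enn2real (\<integral>\<^sup>+x. ennreal (real (card (nbhd (wired_cut F R) x))) \<partial>M) / 2"
    by (rule G.eta_nn_integral(3)[OF W Wb])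
  also have "(\<integral>\<^sup>+x. ennreal (real (card (nbhd (wired_cut F R) x))) \<partial>M) = 2 * (\<integral>\<^sup>+x. ennreal (1 - 1 / real (card (gcomp F x))) \<partial>M)"
    using G.nn_integral_wired_cut unfolding G.nbhd_count[OF W, symmetric] indicator_def .
  also have "enn2real (2 * (\<integral>\<^sup>+x. ennreal (1 - 1 / real (card (gcomp F x))) \<partial>M)) / 2 = enn2real (\<integral>\<^sup>+x. ennreal (1 - 1 / real (card (gcomp F x))) \<partial>M)"
    by (simp add: enn2real_mult)
  also have "\<dots> = grank M E F"
    unfolding grank_def using m pos FE by (simp add: integral_eq_nn_integral Int_absorb2)
  finally show "eta M E (wired_cut F R) = grank M E F" .
qed

lemma edge_graph: obtains f D where "ordered_borel_graph M E f D R"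
  using subset_graph[of E] sets.top[of "edge_space M E"] by auto

lemma eta_split:
  assumes "A \<in> sets (edge_space M E)" "B \<in> sets (edge_space M E)"
  shows "eta M E A = eta M E (A \<inter> B) + eta M E (A - B)"
proof -
  obtain f D where "ordered_borel_graph M E f D R" using edge_graph by blast
  then interpret G: ordered_borel_graph M E f D R .
  have top: "E \<in> sets (edge_space M E)" using sets.top[of "edge_space M E"] by simp
  note v = G.edge_measure[OF top]
  let ?v = "measure_of E (sets (edge_space M E)) (\<lambda>A. ennreal (eta M E (A \<inter> E)))"
  interpret finite_measure ?v by (rule v(2))
  have m: "measure ?v C = eta M E C" if "C \<in> sets (edge_space M E)" for C
    using v(3)[OF that] sets.sets_into_space[OF that] by (simp add: Int_absorb2)
  have "measure ?v A = measure ?v (A \<inter> B) + measure ?v (A - B)"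
    using assms by (subst finite_measure_Union[symmetric]) (auto simp: v(1) intro!: arg_cong[where f="measure ?v"])
  then show ?thesis using assms by (simp add: m)
qed

lemma eta_nonneg: "0 \<le> eta M E A"
  unfolding eta_def by (simp add: integral_nonneg_AE)

lemma grank_mono:
  assumes "A \<in> sets (edge_space M E)" "B \<in> sets (edge_space M E)" "A \<subseteq> B"
  shows "grank M E A \<le> grank M E B"
proof -
  have "A \<inter> E = A" "B \<inter> E = B" using assms sets.sets_into_space by fastforce+
  moreover have "1 - 1 / real (card (gcomp A x)) \<le> 1 - 1 / real (card (gcomp B x))" for x
    using gcomp_refl[of x A] by (intro one_minus_inverse_card_mono gcomp_mono[OF assms(3)]) blast
  ultimately show ?thesis unfolding grank_def
    using grank_facts(1)[OF assms(1)] grank_facts(1)[OF assms(2)] by (intro integral_mono) simp_all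
qed

lemma grank_le_eta:
  assumes A: "A \<in> sets (edge_space M E)" shows "grank M E A \<le> eta M E A"
proof -
  have "eta M E A = eta M E (A \<inter> wired_cut A R) + eta M E (A - wired_cut A R)"
    by (rule eta_split[OF A grank_facts(2)[OF A]])
  moreover have "0 \<le> eta M E (A - wired_cut A R)" by (rule eta_nonneg)
  moreover have "A \<inter> wired_cut A R = wired_cut A R" using wired_cut_subset by blast
  ultimately show ?thesis using grank_facts(3)[OF A] by simp
qed

text \<open>The part of the forest inside \<open>A\<close> is its own wired forest, so its measure
  equals its rank; monotonicity of the rank does the rest.\<close>

lemma eta_wired_le_grank:
  assumes A: "A \<in> sets (edge_space M E)" shows "eta M E (A \<inter> wired_cut E R) \<le> grank M E A"
proof -
  have W: "wired_cut E R \<in> sets (edge_space M E)" using grank_facts(2)[of E] sets.top[of "edge_space M E"] by simp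
  have F: "A \<inter> wired_cut E R \<in> sets (edge_space M E)" using A W by auto
  have "wired_cut (A \<inter> wired_cut E R) R = A \<inter> wired_cut E R" by (rule wired_cut_of_subset[of _ E]) auto
  then have "eta M E (A \<inter> wired_cut E R) = grank M E (A \<inter> wired_cut E R)" using grank_facts(3)[OF F] by simp
  also have "\<dots> \<le> grank M E A" by (rule grank_mono[OF F A]) auto
  finally show ?thesis .
qed

theorem exposed_wired_cut:
  "exposed_point M E (grank M E) (measure_of E (sets (edge_space M E)) (\<lambda>A. ennreal (eta M E (A \<inter> wired_cut E R))))"
proof -
  obtain f D where "ordered_borel_graph M E f D R" using edge_graph by blast
  then interpret G: ordered_borel_graph M E f D R .
  have top: "E \<in> sets (edge_space M E)" using sets.top[of "edge_space M E"] by simp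
  show ?thesis
    using grank_facts[OF top] grank_le_eta eta_wired_le_grank by (intro G.exposed_point_forest) auto
qed

text \<open>As with complements of bases in a dual matroid: the lower bound for \<open>A\<close> is
  the independence inequality for the forest on \<open>E - A\<close>, once
  \<open>eta M E W = grank M E E\<close> has been split along \<open>A\<close>.\<close>

theorem exposed_wired_cut_complement:
  "exposed_point M E (corank M E) (measure_of E (sets (edge_space M E)) (\<lambda>A. ennreal (eta M E (A \<inter> (E - wired_cut E R)))))"
proof -
  obtain f D where "ordered_borel_graph M E f D R" using edge_graph by blast
  then interpret G: ordered_borel_graph M E f D R .
  have top: "E \<in> sets (edge_space M E)" using sets.top[of "edge_space M E"] by simp
  define W where "W = wired_cut E R"
  have W: "W \<in> sets (edge_space M E)" "eta M E W = grank M E E" "W \<subseteq> E"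
    using grank_facts[OF top] wired_cut_subset by (auto simp: W_def)
  have "exposed_point M E (corank M E) (measure_of E (sets (edge_space M E)) (\<lambda>A. ennreal (eta M E (A \<inter> (E - W)))))"
  proof (rule G.exposed_point_forest)
    show "E - W \<in> sets (edge_space M E)" using top W by auto
    fix A assume A: "A \<in> sets (edge_space M E)"
    then have EA: "E - A \<in> sets (edge_space M E)" and AE: "A \<subseteq> E" using top sets.sets_into_space by fastforce+
    show "corank M E A \<le> eta M E A" unfolding corank_def using grank_mono[OF EA top] by simp
    have "eta M E W = eta M E (W \<inter> A) + eta M E (W - A)" by (rule eta_split[OF W(1) A])
    moreover have "W - A = (E - A) \<inter> W" using W(3) by auto
    moreover have "eta M E ((E - A) \<inter> W) \<le> grank M E (E - A)" using eta_wired_le_grank[OF EA] by (simp add: W_def)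
    moreover have "eta M E A = eta M E (A \<inter> W) + eta M E (A - W)" by (rule eta_split[OF A W(1)])
    moreover have "A \<inter> (E - W) = A - W" "A \<inter> W = W \<inter> A" using AE by auto
    ultimately show "eta M E (A \<inter> (E - W)) \<le> corank M E A" unfolding corank_def using W(2) by simp
  next
    have "gcomp {} x = {x}" for x :: 'a unfolding gcomp_def adj_def by simp
    then have "grank M E (E - E) = 0" by (simp add: grank_def)
    moreover have "eta M E E = eta M E (E \<inter> W) + eta M E (E - W)" by (rule eta_split[OF top W(1)])
    ultimately show "eta M E (E - W) = corank M E E" unfolding corank_def using W by (simp add: Int_absorb1)
  qed
  then show ?thesis by (simp add: W_def)
qed

end

section \<open>Cycles, rays and spanning forests\<close>

definition path_edges :: "'a list \<Rightarrow> 'a uprod set" where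
  "path_edges xs = {Upair (xs ! k) (xs ! Suc k) | k. Suc k < length xs}"

lemma simple_path_exists:
  assumes "y \<in> gcomp U x"
  shows "\<exists>xs. distinct xs \<and> xs \<noteq> [] \<and> hd xs = x \<and> last xs = y \<and> path_edges xs \<subseteq> U"
proof -
  have "(x, y) \<in> (adj U)\<^sup>*" using assms by (simp add: gcomp_def)
  then show ?thesis
  proof (induction rule: rtrancl_induct)
    case base
    show ?case by (intro exI[of _ "[x]"]) (simp add: path_edges_def)
  next
    case (step y z)
    then obtain xs where xs: "distinct xs" "xs \<noteq> []" "hd xs = x" "last xs = y" "path_edges xs \<subseteq> U" by blast
    show ?case
    proof (cases "z \<in> set xs")
      case True
      then obtain as bs where ab: "xs = as @ z # bs" by (meson split_list)
      have "path_edges (as @ [z]) \<subseteq> path_edges xs"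
      proof
        fix d assume "d \<in> path_edges (as @ [z])"
        then obtain k where k: "d = Upair ((as @ [z]) ! k) ((as @ [z]) ! Suc k)" "Suc k < length (as @ [z])"
          unfolding path_edges_def by blast
        have "(as @ [z]) ! i = xs ! i" if "i < length (as @ [z])" for i
          using that unfolding ab by (auto simp: nth_append)
        then show "d \<in> path_edges xs" unfolding path_edges_def using k ab by (intro CollectI exI[of _ k]) simp
      qed
      moreover have "hd (as @ [z]) = x" using xs(3) ab by (cases as) auto
      ultimately show ?thesis using xs ab by (intro exI[of _ "as @ [z]"]) auto
    next
      case False
      have "path_edges (xs @ [z]) \<subseteq> U"
      proof
        fix d assume "d \<in> path_edges (xs @ [z])"
        then obtain k where k: "d = Upair ((xs @ [z]) ! k) ((xs @ [z]) ! Suc k)" "Suc k < length (xs @ [z])"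
          unfolding path_edges_def by blast
        show "d \<in> U"
        proof (cases "Suc k < length xs")
          case True
          then have "d \<in> path_edges xs" unfolding path_edges_def using k(1) by (auto simp: nth_append intro!: exI[of _ k])
          then show ?thesis using xs(5) by blast
        next
          case False
          then have "k = length xs - 1" "length xs > 0" using k(2) xs(2) by auto
          then have "d = Upair y z" using k(1) xs(2,4) by (simp add: nth_append last_conv_nth)
          then show ?thesis using step(2) by simp
        qed
      qed
      then show ?thesis using xs False by (intro exI[of _ "xs @ [z]"]) auto
    qed
  qed
qed

lemma cycle_closing:
  assumes "x \<noteq> y" "Upair x y \<in> E" "U \<subseteq> E" "Upair x y \<notin> U" "y \<in> gcomp U x"
  shows "\<exists>cs. is_cycle E cs \<and> Upair x y \<in> cycle_edges cs \<and> cycle_edges cs \<subseteq> insert (Upair x y) U"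
proof -
  obtain xs where xs: "distinct xs" "xs \<noteq> []" "hd xs = x" "last xs = y" "path_edges xs \<subseteq> U"
    using simple_path_exists[OF assms(5)] by blast
  define n where "n = length xs"
  have x0: "xs ! 0 = x" and xn: "xs ! (n - 1) = y" using xs by (auto simp: hd_conv_nth last_conv_nth n_def)
  have "n \<noteq> 0" using xs(2) by (simp add: n_def)
  moreover have "n \<noteq> 1" using x0 xn assms(1) by auto
  \<comment> \<open>A path with two vertices would be the edge itself, which is not in
    \<open>U\<close>.\<close>
  moreover have "n \<noteq> 2"
  proof
    assume n2: "n = 2"
    then have "Upair (xs ! 0) (xs ! Suc 0) \<in> path_edges xs" unfolding path_edges_def n_def by auto
    then show False using xs(5) assms(4) x0 xn n2 by auto
  qed
  ultimately have n3: "3 \<le> n" by linarith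
  have "cycle_edges xs \<subseteq> insert (Upair x y) U"
  proof
    fix d assume "d \<in> cycle_edges xs"
    then obtain i where i: "d = Upair (xs ! i) (xs ! ((i + 1) mod n))" "i < n" unfolding cycle_edges_def n_def by blast
    show "d \<in> insert (Upair x y) U"
    proof (cases "Suc i < n")
      case True
      then have "d \<in> path_edges xs" unfolding path_edges_def using i by (auto simp: n_def)
      then show ?thesis using xs(5) by blast
    next
      case False
      then have "i = n - 1" "Suc i = n" using i by auto
      then have "d = Upair y x" using i(1) x0 xn by simp
      then show ?thesis by simp
    qed
  qed
  moreover have "Upair x y \<in> cycle_edges xs"
  proof -
    have "Upair (xs ! (n - 1)) (xs ! ((n - 1 + 1) mod n)) \<in> cycle_edges xs" unfolding cycle_edges_def
      using n3 by (intro CollectI exI[of _ "n - 1"]) (simp add: n_def)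
    moreover have "(n - 1 + 1) mod n = 0" using n3 by simp
    ultimately have "Upair y x \<in> cycle_edges xs" by (simp only: xn x0)
    then show ?thesis by (simp only: Upair_commute[of y x])
  qed
  moreover have "insert (Upair x y) U \<subseteq> E" using assms by blast
  ultimately show ?thesis using xs(1) n3 unfolding is_cycle_def n_def by (intro exI[of _ xs]) blast
qed

text \<open>Rotation moves the chosen edge to the wrap-around position. With at least three distinct
  vertices it differs from all edges of the remaining path.\<close>

lemma cycle_cut_open:
  assumes cs: "distinct cs" "3 \<le> length cs" and i: "i < length cs"
  obtains ds where "distinct ds" "length ds = length cs" "last ds = cs ! i" "hd ds = cs ! ((i + 1) mod length cs)"
    "cycle_edges cs = insert (Upair (last ds) (hd ds)) (path_edges ds)" "Upair (last ds) (hd ds) \<notin> path_edges ds"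
proof -
  define n where "n = length cs"
  define ds where "ds = rotate (Suc i) cs"
  have n: "3 \<le> n" "i < n" using cs i by (auto simp: n_def)
  have len: "length ds = n" by (simp add: ds_def n_def)
  have nth: "ds ! k = cs ! ((Suc i + k) mod n)" if "k < n" for k
    using nth_rotate[of k cs "Suc i"] that by (simp add: ds_def n_def)
  have dist: "distinct ds" using cs by (simp add: ds_def)
  have ne: "ds \<noteq> []" using len n by auto
  have hd: "hd ds = ds ! 0" using ne by (simp add: hd_conv_nth)
  have last: "last ds = ds ! (n - 1)" using ne len by (simp add: last_conv_nth)
  have hd': "hd ds = cs ! ((i + 1) mod n)" using hd nth[of 0] n by simp
  have "(Suc i + (n - 1)) mod n = i" using n by simp
  then have last': "last ds = cs ! i" using last nth[of "n - 1"] n by simp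
  have pe: "path_edges ds = {Upair (cs ! j) (cs ! ((j + 1) mod n)) | j. j < n \<and> j \<noteq> i}"
  proof (intro set_eqI iffI)
    fix d assume "d \<in> path_edges ds"
    then obtain k where k: "d = Upair (ds ! k) (ds ! Suc k)" "Suc k < n" unfolding path_edges_def len by blast
    define j where "j = (Suc i + k) mod n"
    have "ds ! k = cs ! j" using nth[of k] k by (simp add: j_def)
    moreover have "ds ! Suc k = cs ! ((j + 1) mod n)" using nth[of "Suc k"] k by (simp add: j_def mod_Suc_eq)
    moreover have "j < n" using n by (simp add: j_def)
    moreover have "j \<noteq> i"
    proof (cases "Suc i + k < n")
      case False
      then have "j = Suc i + k - n" using k n by (simp add: j_def mod_if)
      then show ?thesis using k n False by linarith
    qed (simp add: j_def)
    ultimately show "d \<in> {Upair (cs ! j) (cs ! ((j + 1) mod n)) | j. j < n \<and> j \<noteq> i}" using k(1) by (intro CollectI exI[of _ j]) simp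
  next
    fix d assume "d \<in> {Upair (cs ! j) (cs ! ((j + 1) mod n)) | j. j < n \<and> j \<noteq> i}"
    then obtain j where j: "d = Upair (cs ! j) (cs ! ((j + 1) mod n))" "j < n" "j \<noteq> i" by blast
    define k where "k = (if i < j then j - Suc i else j + n - Suc i)"
    have k: "Suc k < n" using j n by (auto simp: k_def)
    have kj: "(Suc i + k) mod n = j" using j n by (auto simp: k_def)
    have "ds ! k = cs ! j" using nth[of k] k kj by simp
    moreover have "(Suc i + Suc k) mod n = (j + 1) mod n" using kj by (metis add.commute add_Suc_right mod_Suc_eq plus_1_eq_Suc)
    then have "ds ! Suc k = cs ! ((j + 1) mod n)" using nth[of "Suc k"] k by simp
    ultimately show "d \<in> path_edges ds" unfolding path_edges_def len using j(1) k by (intro CollectI exI[of _ k]) simp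
  qed
  have "cycle_edges cs = insert (Upair (last ds) (hd ds)) (path_edges ds)"
    unfolding pe cycle_edges_def last' hd' n_def[symmetric] using n by auto
  moreover have "Upair (last ds) (hd ds) \<notin> path_edges ds"
  proof
    assume "Upair (last ds) (hd ds) \<in> path_edges ds"
    then obtain k where k: "Upair (ds ! (n - 1)) (ds ! 0) = Upair (ds ! k) (ds ! Suc k)" "Suc k < n"
      unfolding path_edges_def len hd last by blast
    have "n - 1 < length ds" "0 < length ds" "k < length ds" "Suc k < length ds" using n k len by auto
    then show False using k n nth_eq_iff_index_eq[OF dist] by (auto simp: Upair_inject)
  qed
  ultimately show ?thesis using that[OF dist] len hd' last' by (simp add: n_def)
qed

lemma path_gcomp:
  assumes "path_edges ds \<subseteq> U" "k < length ds"
  shows "ds ! k \<in> gcomp U (ds ! 0)"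
  using assms(2)
proof (induction k)
  case (Suc k)
  then have "Upair (ds ! k) (ds ! Suc k) \<in> U" using assms(1) unfolding path_edges_def by blast
  then show ?case using Suc gcomp_edge[of "ds ! k" U] by simp
qed simp

text \<open>Cutting a cycle open at its least edge leaves a path of larger edges between the two
  ends. Conversely, such a path can be made simple and closed up by the edge.\<close>

lemma not_free_msf_iff:
  assumes e: "Upair x y \<in> E" "x \<noteq> y" and R: "irrefl R"
  shows "Upair x y \<notin> free_msf E R \<longleftrightarrow> y \<in> gcomp (upper R E (Upair x y)) x"
proof
  assume "Upair x y \<notin> free_msf E R"
  then obtain cs where cs: "is_cycle E cs" "Upair x y \<in> cycle_edges cs"
     "\<forall>e'\<in>cycle_edges cs. e' \<noteq> Upair x y \<longrightarrow> (Upair x y, e') \<in> R"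
    using e(1) unfolding free_msf_def by blast
  obtain i where i: "i < length cs" "Upair x y = Upair (cs ! i) (cs ! ((i + 1) mod length cs))"
    using cs(2) unfolding cycle_edges_def by blast
  have c: "distinct cs" "3 \<le> length cs" "cycle_edges cs \<subseteq> E" using cs(1) unfolding is_cycle_def by auto
  obtain ds where ds: "length ds = length cs" "last ds = cs ! i" "hd ds = cs ! ((i + 1) mod length cs)"
    "cycle_edges cs = insert (Upair (last ds) (hd ds)) (path_edges ds)" "Upair (last ds) (hd ds) \<notin> path_edges ds"
    using cycle_cut_open[OF c(1,2) i(1)] by metis
  have eq: "Upair (last ds) (hd ds) = Upair x y" unfolding ds(2,3) i(2) ..
  have "path_edges ds \<subseteq> upper R E (Upair x y)"
  proof
    fix d assume d: "d \<in> path_edges ds"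
    then have "d \<noteq> Upair x y" using ds(5) eq by metis
    then show "d \<in> upper R E (Upair x y)" using d ds(4) cs(3) c(3) unfolding upper_def by blast
  qed
  moreover have "length ds - 1 < length ds" "ds \<noteq> []" using ds(1) c by auto
  ultimately have "last ds \<in> gcomp (upper R E (Upair x y)) (hd ds)"
    using path_gcomp[of ds "upper R E (Upair x y)" "length ds - 1"] by (simp add: last_conv_nth hd_conv_nth)
  moreover have "last ds = x \<and> hd ds = y \<or> last ds = y \<and> hd ds = x" using eq by simp
  ultimately show "y \<in> gcomp (upper R E (Upair x y)) x" using gcomp_sym by metis
next
  assume y: "y \<in> gcomp (upper R E (Upair x y)) x"
  have "Upair x y \<notin> upper R E (Upair x y)" using R by (simp add: upper_def irrefl_def)
  from cycle_closing[OF e(2,1) upper_subset this y]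
  obtain cs where "is_cycle E cs" "Upair x y \<in> cycle_edges cs" "cycle_edges cs \<subseteq> insert (Upair x y) (upper R E (Upair x y))" by blast
  then show "Upair x y \<notin> free_msf E R" unfolding free_msf_def upper_def by blast
qed

text \<open>Koenig's lemma for the relation \<open>A\<close> of edges that increase the distance
  from \<open>x\<close> by one. Each vertex has finitely many successors, so some successor again
  reaches infinitely many vertices. Distances grow along the ray, which makes it injective.\<close>

lemma infinite_component_ray:
  assumes fin: "\<And>x. finite (nbhd E x)" and U: "U \<subseteq> E" and inf: "infinite (gcomp U x)"
  obtains r :: "nat \<Rightarrow> 'a" where "inj r" "r 0 = x" "\<And>n. Upair (r n) (r (Suc n)) \<in> U" "\<And>n. r n \<in> gcomp U x"
proof -
  define d where "d v = (LEAST n. (x, v) \<in> adj U ^^ n)" for v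
  have ex: "\<exists>n. (x, v) \<in> adj U ^^ n" if "v \<in> gcomp U x" for v
    using that by (simp add: gcomp_def rtrancl_is_UN_relpow)
  have dI: "(x, v) \<in> adj U ^^ d v" if "v \<in> gcomp U x" for v
    using ex[OF that] unfolding d_def by (rule LeastI_ex)
  have dle: "d v \<le> n" if "(x, v) \<in> adj U ^^ n" for v n unfolding d_def using that by (rule Least_le)
  have relc: "v \<in> gcomp U x" if "(x, v) \<in> adj U ^^ n" for v n
    using that by (auto simp: gcomp_def rtrancl_is_UN_relpow)
  define A where "A = {(v, w). Upair v w \<in> U \<and> d w = Suc (d v)}"
  have reach: "(x, v) \<in> A\<^sup>*" if "v \<in> gcomp U x" "d v = n" for n v
    using that
  proof (induction n arbitrary: v)
    case 0
    then have "v = x" using dI[of v] by simp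
    then show ?case by simp
  next
    case (Suc n)
    have "(x, v) \<in> adj U ^^ Suc n" using dI[of v] Suc.prems by simp
    then obtain u where u: "(x, u) \<in> adj U ^^ n" "Upair u v \<in> U" by auto
    have "(x, v) \<in> adj U ^^ Suc (d u)" using dI[OF relc[OF u(1)]] u(2) by auto
    then have "Suc n \<le> Suc (d u)" using dle Suc.prems by metis
    then have du: "d u = n" using dle[OF u(1)] by simp
    then have "(x, u) \<in> A\<^sup>*" using Suc.IH relc[OF u(1)] by simp
    moreover have "(u, v) \<in> A" using u(2) du Suc.prems by (simp add: A_def)
    ultimately show ?case by (rule rtrancl_into_rtrancl)
  qed
  have "gcomp U x \<subseteq> A\<^sup>* `` {x}" using reach by auto
  then have infx: "infinite (A\<^sup>* `` {x})" using inf finite_subset by blast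
  have step: "\<exists>w. infinite (A\<^sup>* `` {w}) \<and> (v, w) \<in> A" if v: "infinite (A\<^sup>* `` {v})" for v
  proof (rule ccontr)
    assume no: "\<not> ?thesis"
    have "A `` {v} \<subseteq> nbhd E v" using U by (auto simp: A_def nbhd_def)
    then have "finite (A `` {v})" using fin finite_subset by blast
    moreover have "finite (A\<^sup>* `` {w})" if "w \<in> A `` {v}" for w using no that by blast
    ultimately have "finite (\<Union>w\<in>A `` {v}. A\<^sup>* `` {w})" by blast
    moreover have "A\<^sup>* `` {v} \<subseteq> insert v (\<Union>w\<in>A `` {v}. A\<^sup>* `` {w})"
    proof
      fix u assume "u \<in> A\<^sup>* `` {v}"
      then have "(v, u) \<in> A\<^sup>*" by simp
      then show "u \<in> insert v (\<Union>w\<in>A `` {v}. A\<^sup>* `` {w})" by (cases rule: converse_rtranclE) auto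
    qed
    ultimately show False using v finite_subset by blast
  qed
  obtain r where r: "\<And>n. infinite (A\<^sup>* `` {r n})" "r 0 = x" "\<And>n. (r n, r (Suc n)) \<in> A"
  proof -
    have "\<exists>f. \<forall>n. (infinite (A\<^sup>* `` {f n}) \<and> (n = 0 \<longrightarrow> f n = x)) \<and> (f n, f (Suc n)) \<in> A"
      by (rule dependent_nat_choice) (use infx step in auto)
    then show ?thesis using that by metis
  qed
  have dr: "d (r n) = n + d x" for n by (induction n) (use r in \<open>auto simp: A_def\<close>)
  have "inj r" by (rule injI) (metis add_right_cancel dr)
  moreover have e: "Upair (r n) (r (Suc n)) \<in> U" for n using r(3)[of n] by (simp add: A_def)
  moreover have "r n \<in> gcomp U x" for n
  proof (induction n)
    case 0 then show ?case using r(2) by simp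
  next
    case (Suc n) then show ?case using e[of n] gcomp_edge by metis
  qed
  ultimately show ?thesis using that r(2) by blast
qed

section \<open>Two-way infinite paths and pairs of infinite clusters\<close>

lemma biinf_path_infinite:
  fixes p :: "int \<Rightarrow> 'a"
  assumes p: "inj p" and U: "\<And>j. j \<noteq> i \<Longrightarrow> Upair (p j) (p (j + 1)) \<in> U"
  shows "infinite (gcomp U (p i))" "infinite (gcomp U (p (i + 1)))"
proof -
  have l: "p (i - int k) \<in> gcomp U (p i)" for k
  proof (induction k)
    case (Suc k)
    have "Upair (p (i - int (Suc k))) (p (i - int (Suc k) + 1)) \<in> U" by (rule U) simp
    then have "Upair (p (i - int k)) (p (i - int (Suc k))) \<in> U" by (simp add: Upair_commute algebra_simps)
    then show ?case using Suc gcomp_edge by metis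
  qed simp
  have r: "p (i + 1 + int k) \<in> gcomp U (p (i + 1))" for k
  proof (induction k)
    case (Suc k)
    have "Upair (p (i + 1 + int k)) (p (i + 1 + int k + 1)) \<in> U" by (rule U) simp
    then have "Upair (p (i + 1 + int k)) (p (i + 1 + int (Suc k))) \<in> U" by (simp add: algebra_simps)
    then show ?case using Suc gcomp_edge by metis
  qed simp
  have "inj (\<lambda>k::nat. p (i - int k))" "inj (\<lambda>k::nat. p (i + 1 + int k))"
    by (auto intro!: injI dest!: injD[OF p])
  then have "infinite (range (\<lambda>k::nat. p (i - int k)))" "infinite (range (\<lambda>k::nat. p (i + 1 + int k)))"
    by (auto dest: finite_imageD)
  moreover have "range (\<lambda>k::nat. p (i - int k)) \<subseteq> gcomp U (p i)" "range (\<lambda>k::nat. p (i + 1 + int k)) \<subseteq> gcomp U (p (i + 1))"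
    using l r by auto
  ultimately show "infinite (gcomp U (p i))" "infinite (gcomp U (p (i + 1)))" using finite_subset by blast+
qed

text \<open>If the ends of an edge lie in different clusters that are both infinite, rays inside
  these clusters are disjoint and combine with the edge to a two-way infinite path on which it is
  least. Conversely, the two halves of such a path are infinite and lie in the clusters of the two
  ends.\<close>

theorem wired_msf_eq_wired_cut:
  fixes E :: "'a uprod set"
  assumes fin: "\<And>x. finite (nbhd E x)" and nl: "\<And>x. Upair x x \<notin> E" and R: "irrefl R"
  shows "wired_msf E R = wired_cut E R"
proof (rule set_eqI)
  fix e :: "'a uprod"
  obtain x y where xy: "e = Upair x y" by (cases e) auto
  show "e \<in> wired_msf E R \<longleftrightarrow> e \<in> wired_cut E R"
  proof (cases "e \<in> E")
    case False
    then show ?thesis by (auto simp: wired_msf_def free_msf_def wired_cut_def)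
  next
    case True
    then have ne: "x \<noteq> y" using nl xy by auto
    define U where "U = upper R E (Upair x y)"
    have eU: "Upair x y \<notin> U" using R by (simp add: U_def upper_def irrefl_def)
    have free: "e \<in> free_msf E R \<longleftrightarrow> y \<notin> gcomp U x"
      using not_free_msf_iff[of x y E R] True ne R xy unfolding U_def by blast
    define B where "B \<longleftrightarrow> (\<exists>p::int \<Rightarrow> 'a. inj p \<and> biinf_path_edges p \<subseteq> E \<and> e \<in> biinf_path_edges p \<and>
            (\<forall>e'\<in>biinf_path_edges p. e' \<noteq> e \<longrightarrow> (e, e') \<in> R))"
    have w: "e \<in> wired_msf E R \<longleftrightarrow> e \<in> free_msf E R \<and> \<not> B" unfolding wired_msf_def B_def by blast
    have c: "e \<in> wired_cut E R \<longleftrightarrow> y \<notin> gcomp U x \<and> (finite (gcomp U x) \<or> finite (gcomp U y))"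
      using mem_wired_cut[of x y E R] True xy unfolding U_def by metis
    have "B \<longleftrightarrow> infinite (gcomp U x) \<and> infinite (gcomp U y)" if y: "y \<notin> gcomp U x"
    proof
      assume B
      then obtain p :: "int \<Rightarrow> 'a" where p: "inj p" "biinf_path_edges p \<subseteq> E" "e \<in> biinf_path_edges p"
        "\<forall>e'\<in>biinf_path_edges p. e' \<noteq> e \<longrightarrow> (e, e') \<in> R" unfolding B_def by blast
      obtain i where i: "e = Upair (p i) (p (i + 1))" using p(3) unfolding biinf_path_edges_def by blast
      have "Upair (p j) (p (j + 1)) \<in> U" if "j \<noteq> i" for j
      proof -
        have mem: "Upair (p j) (p (j + 1)) \<in> biinf_path_edges p" unfolding biinf_path_edges_def by blast
        have "Upair (p j) (p (j + 1)) \<noteq> e"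
          unfolding i Upair_inject inj_eq[OF p(1)] using that by linarith
        then have "(e, Upair (p j) (p (j + 1))) \<in> R" using bspec[OF p(4) mem] by simp
        then show ?thesis using mem p(2) unfolding U_def upper_def xy[symmetric] by (simp add: subset_iff)
      qed
      from biinf_path_infinite[OF p(1) this] have "infinite (gcomp U (p i))" "infinite (gcomp U (p (i + 1)))" by blast+
      moreover have "x = p i \<and> y = p (i + 1) \<or> x = p (i + 1) \<and> y = p i" using i xy by simp
      ultimately show "infinite (gcomp U x) \<and> infinite (gcomp U y)" by auto
    next
      assume inf: "infinite (gcomp U x) \<and> infinite (gcomp U y)"
      have UE: "U \<subseteq> E" unfolding U_def by (rule upper_subset)
      obtain r where r: "inj r" "r 0 = x" "\<And>n. Upair (r n) (r (Suc n)) \<in> U" "\<And>n. r n \<in> gcomp U x"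
        using infinite_component_ray[OF fin UE, of x] inf by metis
      obtain s where s: "inj s" "s 0 = y" "\<And>n. Upair (s n) (s (Suc n)) \<in> U" "\<And>n. s n \<in> gcomp U y"
        using infinite_component_ray[OF fin UE, of y] inf by metis
      have disj: "r n \<noteq> s m" for n m using gcomp_disjoint[OF y] r(4)[of n] s(4)[of m] by (metis disjoint_iff)
      \<comment> \<open>The ray from \<open>x\<close> occupies the indices -1, -2, and so on, so the
        step from -1 to 0 is the edge \<open>e\<close>.\<close>
      define p :: "int \<Rightarrow> 'a" where "p j = (if 0 \<le> j then s (nat j) else r (nat (- j - 1)))" for j
      have "inj p"
      proof (rule injI)
        fix j k assume eq: "p j = p k"
        show "j = k"
        proof (cases "0 \<le> j"; cases "0 \<le> k")
          assume "0 \<le> j" "0 \<le> k" then show ?thesis using eq s(1) by (auto simp: p_def dest: injD)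
        next
          assume "\<not> 0 \<le> j" "\<not> 0 \<le> k"
          then have "nat (- j - 1) = nat (- k - 1)" using eq r(1) by (auto simp: p_def dest: injD)
          then show ?thesis using \<open>\<not> 0 \<le> j\<close> \<open>\<not> 0 \<le> k\<close> by simp
        next
          assume "0 \<le> j" "\<not> 0 \<le> k" then show ?thesis using eq disj by (simp add: p_def) metis
        next
          assume "\<not> 0 \<le> j" "0 \<le> k" then show ?thesis using eq disj by (simp add: p_def)
        qed
      qed
      moreover have edge: "Upair (p j) (p (j + 1)) \<in> insert e U" for j
      proof -
        consider "0 \<le> j" | "j = -1" | "j < -1" by linarith
        then show ?thesis
        proof cases
          case 1
          then have "nat (j + 1) = Suc (nat j)" by simp
          then show ?thesis using 1 s(3)[of "nat j"] by (simp add: p_def)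
        next
          case 2
          then show ?thesis using r(2) s(2) xy by (simp add: p_def)
        next
          case 3
          then have "nat (- j - 1) = Suc (nat (- (j + 1) - 1))" by simp
          then have "p j = r (Suc (nat (- (j + 1) - 1)))" "p (j + 1) = r (nat (- (j + 1) - 1))" using 3 by (auto simp: p_def)
          then show ?thesis using r(3)[of "nat (- (j + 1) - 1)"] by (simp add: Upair_commute)
        qed
      qed
      moreover have "e \<in> biinf_path_edges p"
      proof -
        have "Upair (p (-1)) (p (-1 + 1)) \<in> biinf_path_edges p" unfolding biinf_path_edges_def by blast
        then show ?thesis using r(2) s(2) xy by (simp add: p_def)
      qed
      moreover have "biinf_path_edges p \<subseteq> insert e U" using edge unfolding biinf_path_edges_def by blast
      moreover have "insert e U \<subseteq> E" using UE True by blast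
      moreover have "\<forall>e'\<in>U. (e, e') \<in> R" unfolding U_def upper_def xy by blast
      ultimately show B unfolding B_def by blast
    qed
    then show ?thesis using w c free by blast
  qed
qed

text \<open>Handshake count on the component of \<open>x\<close> after deletion of the edge: if
  \<open>y\<close> were missing from it, \<open>x\<close> would be its only vertex of odd
  degree.\<close>

lemma even_subgraph_edge_connected:
  assumes fin: "finite \<delta>" and nl: "\<And>x. Upair x x \<notin> \<delta>" and e: "Upair x y \<in> \<delta>"
    and even: "\<And>v. even (card {d \<in> \<delta>. v \<in> set_uprod d})"
  shows "y \<in> gcomp (\<delta> - {Upair x y}) x"
proof (rule ccontr)
  define \<delta>' where "\<delta>' = \<delta> - {Upair x y}"
  define V where "V = gcomp \<delta>' x"
  assume "y \<notin> gcomp (\<delta> - {Upair x y}) x"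
  then have yV: "y \<notin> V" by (simp add: V_def \<delta>'_def)
  have fin': "finite \<delta>'" using fin by (simp add: \<delta>'_def)
  have "V \<subseteq> insert x (\<Union>d\<in>\<delta>'. set_uprod d)" unfolding V_def by (rule gcomp_subset_closed) force+
  then have finV: "finite V" using fin' by (auto elim!: finite_subset)
  have "(\<Sum>v\<in>V. card {d \<in> \<delta>'. v \<in> set_uprod d}) = (\<Sum>d\<in>\<delta>'. card {v \<in> V. v \<in> set_uprod d})"
    by (rule sum_multicount_gen[OF finV fin']) simp
  moreover have "even (\<Sum>d\<in>\<delta>'. card {v \<in> V. v \<in> set_uprod d})"
  proof (rule dvd_sum)
    fix d assume d: "d \<in> \<delta>'"
    obtain a b where ab: "d = Upair a b" by (cases d) auto
    have "a \<noteq> b" using d nl ab by (auto simp: \<delta>'_def)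
    have "a \<in> V \<longleftrightarrow> b \<in> V" using d ab gcomp_edge[of a \<delta>' x b] gcomp_edge[of b \<delta>' x a]
      unfolding V_def by (auto simp: Upair_commute)
    then have "{v \<in> V. v \<in> set_uprod d} = {} \<or> {v \<in> V. v \<in> set_uprod d} = {a, b}" unfolding ab by auto
    moreover have "even (card {a, b})" using \<open>a \<noteq> b\<close> by simp
    ultimately show "even (card {v \<in> V. v \<in> set_uprod d})" by (metis card.empty even_zero)
  qed
  moreover have "odd (\<Sum>v\<in>V. card {d \<in> \<delta>'. v \<in> set_uprod d})"
  proof -
    have xV: "x \<in> V" by (simp add: V_def)
    have "{d \<in> \<delta>. x \<in> set_uprod d} = insert (Upair x y) {d \<in> \<delta>'. x \<in> set_uprod d}" using e by (auto simp: \<delta>'_def)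
    then have "card {d \<in> \<delta>. x \<in> set_uprod d} = Suc (card {d \<in> \<delta>'. x \<in> set_uprod d})"
      using fin' by (simp add: \<delta>'_def)
    then have ox: "odd (card {d \<in> \<delta>'. x \<in> set_uprod d})" using even[of x] by simp
    have "even (\<Sum>v\<in>V - {x}. card {d \<in> \<delta>'. v \<in> set_uprod d})"
    proof (rule dvd_sum)
      fix v assume "v \<in> V - {x}"
      then have "v \<noteq> x" "v \<noteq> y" using yV by auto
      then have "{d \<in> \<delta>'. v \<in> set_uprod d} = {d \<in> \<delta>. v \<in> set_uprod d}" by (auto simp: \<delta>'_def)
      then show "even (card {d \<in> \<delta>'. v \<in> set_uprod d})" using even[of v] by simp
    qed
    then show ?thesis using ox sum.remove[OF finV xV, of "\<lambda>v. card {d \<in> \<delta>'. v \<in> set_uprod d}"] by simp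
  qed
  ultimately show False by simp
qed

lemma cycle_even_degree:
  assumes "distinct cs" "3 \<le> length cs"
  shows "even (card {d \<in> cycle_edges cs. v \<in> set_uprod d})"
proof (cases "v \<in> set cs")
  case False
  have "(i + 1) mod length cs < length cs" for i using assms(2) by (intro mod_less_divisor) linarith
  then have "{d \<in> cycle_edges cs. v \<in> set_uprod d} = {}" using False by (auto simp: cycle_edges_def)
  then show ?thesis by (metis card.empty even_zero)
next
  case True
  then obtain i where i: "i < length cs" "cs ! i = v" by (auto simp: in_set_conv_nth)
  \<comment> \<open>The cycle is rotated so that \<open>v\<close> comes last; its edges are then the
    closing edge and the final edge of the path.\<close>
  obtain ds where ds: "distinct ds" "length ds = length cs" "last ds = cs ! i"
    "cycle_edges cs = insert (Upair (last ds) (hd ds)) (path_edges ds)" "Upair (last ds) (hd ds) \<notin> path_edges ds"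
    using cycle_cut_open[OF assms i(1)] by metis
  define n where "n = length ds"
  have n3: "3 \<le> n" and ne: "ds \<noteq> []" using ds(2) assms(2) by (auto simp: n_def)
  have last: "last ds = ds ! (n - 1)" using ne by (simp add: last_conv_nth n_def)
  have vl: "v = ds ! (n - 1)" using i ds(3) last by simp
  define d' where "d' = Upair (ds ! (n - 2)) (ds ! Suc (n - 2))"
  have d': "d' \<in> path_edges ds" unfolding d'_def path_edges_def using n3 by (intro CollectI exI[of _ "n - 2"]) (simp add: n_def)
  have Sn: "Suc (n - 2) = n - 1" using n3 by simp
  have "{d \<in> cycle_edges cs. v \<in> set_uprod d} = {Upair (last ds) (hd ds), d'}"
  proof (intro set_eqI iffI)
    fix d assume d: "d \<in> {d \<in> cycle_edges cs. v \<in> set_uprod d}"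
    show "d \<in> {Upair (last ds) (hd ds), d'}"
    proof (cases "d = Upair (last ds) (hd ds)")
      case False
      then have "d \<in> path_edges ds" using d ds(4) by blast
      then obtain k where k: "d = Upair (ds ! k) (ds ! Suc k)" "Suc k < n" unfolding path_edges_def n_def by blast
      have "ds ! (n - 1) = ds ! k \<or> ds ! (n - 1) = ds ! Suc k" using d k(1) vl by simp
      moreover have "n - 1 < length ds" "k < length ds" "Suc k < length ds" using k n3 by (auto simp: n_def)
      ultimately have "n - 1 = k \<or> n - 1 = Suc k" using nth_eq_iff_index_eq[OF ds(1)] by metis
      then have "k = n - 2" using k(2) by linarith
      then show ?thesis using k(1) by (simp add: d'_def)
    qed simp
  next
    fix d assume "d \<in> {Upair (last ds) (hd ds), d'}"
    then show "d \<in> {d \<in> cycle_edges cs. v \<in> set_uprod d}" using d' ds(4) vl last Sn by (auto simp: d'_def)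
  qed
  moreover have "Upair (last ds) (hd ds) \<noteq> d'" using d' ds(5) by metis
  ultimately show ?thesis by simp
qed

section \<open>Sides of a cycle in a plane drawing\<close>

text \<open>Near an interior point of an arc, the two sides of a closed curve through that arc do not
  depend on how the curve closes up.\<close>

lemma arc_local_sides:
  fixes \<gamma> :: "real \<Rightarrow> complex"
  assumes arc: "arc \<gamma>" and c1: "compact c1" "connected c1" "pathstart \<gamma> \<in> c1" "pathfinish \<gamma> \<in> c1"
    "c1 \<inter> path_image \<gamma> \<subseteq> {pathstart \<gamma>, pathfinish \<gamma>}"
    and c2: "closed c2" "c2 \<inter> path_image \<gamma> \<subseteq> {pathstart \<gamma>, pathfinish \<gamma>}"
    and \<tau>: "0 < \<tau>" "\<tau> < 1"
  obtains r where "r > 0" "\<And>x y. x \<in> ball (\<gamma> \<tau>) r \<Longrightarrow> y \<in> ball (\<gamma> \<tau>) r \<Longrightarrow>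
    connected_component (- (path_image \<gamma> \<union> c1)) x y \<Longrightarrow> connected_component (- (path_image \<gamma> \<union> c2)) x y"
proof -
  define p where "p = \<gamma> \<tau>"
  have path: "path \<gamma>" and inj: "inj_on \<gamma> {0..1}" using arc by (auto simp: arc_def)
  have cont: "continuous_on {0..1} \<gamma>" using path by (simp add: path_def)
  have pi: "p \<in> path_image \<gamma>" using \<tau> by (auto simp: p_def path_image_def)
  have "p \<noteq> pathstart \<gamma>" "p \<noteq> pathfinish \<gamma>"
    using inj \<tau> inj_onD[OF inj, of \<tau> 0] inj_onD[OF inj, of \<tau> 1] by (auto simp: p_def pathstart_def pathfinish_def)
  then have "p \<notin> c1 \<union> c2" using pi c1(5) c2(2) by blast
  then have "p \<in> - (c1 \<union> c2)" by simp
  moreover have "open (- (c1 \<union> c2))"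
    by (rule open_Compl[OF closed_Un[OF compact_imp_closed[OF c1(1)] c2(1)]])
  ultimately obtain Q where Q: "Q > 0" "ball p Q \<subseteq> - (c1 \<union> c2)"
    using openE by metis
  obtain d where d: "d > 0" "\<And>t. t \<in> {0..1} \<Longrightarrow> dist t \<tau> < d \<Longrightarrow> dist (\<gamma> t) (\<gamma> \<tau>) < Q"
    using cont Q(1) \<tau> unfolding continuous_on_iff by (metis atLeastAtMost_iff less_imp_le)
  define \<epsilon> where "\<epsilon> = min d (min \<tau> (1 - \<tau>)) / 2"
  have \<epsilon>: "0 < \<epsilon>" "\<epsilon> < d" "\<epsilon> < \<tau>" "\<epsilon> < 1 - \<tau>" using d(1) \<tau> by (auto simp: \<epsilon>_def)
  define s where "s = \<tau> - \<epsilon>"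
  define t where "t = \<tau> + \<epsilon>"
  have st: "0 < s" "s < \<tau>" "\<tau> < t" "t < 1" using \<epsilon> by (auto simp: s_def t_def)
  have mid: "\<gamma> u \<in> ball p Q" if "s \<le> u" "u \<le> t" for u
  proof -
    have "dist u \<tau> < d" using that \<epsilon> by (auto simp: s_def t_def dist_real_def)
    moreover have "u \<in> {0..1}" using that st by auto
    ultimately have "dist (\<gamma> u) (\<gamma> \<tau>) < Q" using d(2) by blast
    then show ?thesis unfolding p_def mem_ball by (subst dist_commute)
  qed
  define Z where "Z = \<gamma> ` {0..s} \<union> \<gamma> ` {t..1}"
  have cs: "continuous_on {0..s} \<gamma>" "continuous_on {t..1} \<gamma>" using cont st by (auto elim: continuous_on_subset)
  have Zc: "compact Z" unfolding Z_def using cs by (intro compact_Un compact_continuous_image) auto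
  have "p \<notin> Z"
  proof
    assume "p \<in> Z"
    then obtain u where u: "u \<in> {0..s} \<union> {t..1}" "\<gamma> \<tau> = \<gamma> u"
      unfolding Z_def p_def image_Un[symmetric] by blast
    then have "u \<in> {0..1}" "\<tau> \<in> {0..1}" using st \<tau> by auto
    then have "\<tau> = u" using inj_onD[OF inj u(2)] by simp
    then show False using u(1) st by auto
  qed
  then obtain r0 where r0: "r0 > 0" "ball p r0 \<subseteq> - Z"
    using openE[of "- Z" p] Zc by (auto simp: open_Compl compact_imp_closed)
  define r where "r = min r0 Q"
  have r: "r > 0" "ball p r \<subseteq> - Z" "ball p r \<subseteq> ball p Q" using r0 Q by (auto simp: r_def)
  \<comment> \<open>Janiszewski's theorem is applied to the first curve \<open>S\<close> and to
    \<open>T\<close>, which consists of everything outside a disc about \<open>p\<close> and of the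
    arc away from \<open>p\<close>. The disc avoids \<open>c1\<close> and \<open>c2\<close>, so
    \<open>T\<close> contains \<open>c2\<close>. The intersection is \<open>c1\<close> with the two
    ends of the arc attached to it, hence connected. A smaller disc about \<open>p\<close> avoids
    \<open>T\<close>, so \<open>T\<close> separates no two of its points.\<close>
  define S where "S = path_image \<gamma> \<union> c1"
  define T where "T = - ball p Q \<union> Z"
  have S: "compact S" unfolding S_def using path c1(1) by (intro compact_Un compact_path_image)
  have T: "closed T" unfolding T_def using Zc by (intro closed_Un) (auto simp: compact_imp_closed closed_Compl)
  have "S \<inter> T = c1 \<union> Z"
  proof
    show "S \<inter> T \<subseteq> c1 \<union> Z"
    proof
      fix q assume q: "q \<in> S \<inter> T"
      show "q \<in> c1 \<union> Z"
      proof (cases "q \<in> c1 \<or> q \<in> Z")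
        case False
        then have "q \<in> path_image \<gamma>" "q \<notin> ball p Q" using q by (auto simp: S_def T_def)
        then obtain u where u: "u \<in> {0..1}" "q = \<gamma> u" by (auto simp: path_image_def)
        then have "\<not> (s \<le> u \<and> u \<le> t)" using mid \<open>q \<notin> ball p Q\<close> by blast
        then have "q \<in> Z" using u by (auto simp: Z_def)
        then show ?thesis by simp
      qed auto
    qed
    have "Z \<subseteq> path_image \<gamma>" unfolding Z_def path_image_def using st by auto
    moreover have "c1 \<subseteq> - ball p Q" using Q(2) by blast
    ultimately show "c1 \<union> Z \<subseteq> S \<inter> T" by (auto simp: S_def T_def)
  qed
  moreover have "connected (c1 \<union> Z)"
  proof -
    have "connected (\<gamma> ` {0..s})" "connected (\<gamma> ` {t..1})"
      using cs by (auto intro!: connected_continuous_image)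
    moreover have "\<gamma> 0 \<in> c1 \<inter> \<gamma> ` {0..s}" "\<gamma> 1 \<in> (c1 \<union> \<gamma> ` {0..s}) \<inter> \<gamma> ` {t..1}"
      using c1(3,4) st by (auto simp: pathstart_def pathfinish_def)
    ultimately have "connected ((c1 \<union> \<gamma> ` {0..s}) \<union> \<gamma> ` {t..1})" using c1(2) by (intro connected_Un) auto
    then show ?thesis by (simp add: Z_def Un_assoc)
  qed
  ultimately have conn: "connected (S \<inter> T)" by simp
  have "connected_component (- (path_image \<gamma> \<union> c2)) x y"
    if xy: "x \<in> ball p r" "y \<in> ball p r" and cc: "connected_component (- (path_image \<gamma> \<union> c1)) x y" for x y
  proof -
    have "ball p r \<subseteq> - T" using r by (auto simp: T_def)
    then have "connected_component (- T) x y"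
      unfolding connected_component_def using xy by (intro exI[of _ "ball p r"]) auto
    then have "connected_component (- (S \<union> T)) x y" using Janiszewski[OF S T conn] cc by (simp add: S_def)
    moreover have "- (S \<union> T) \<subseteq> - (path_image \<gamma> \<union> c2)" using Q(2) by (auto simp: S_def T_def)
    ultimately show ?thesis using connected_component_of_subset by blast
  qed
  then show ?thesis using that r(1) unfolding p_def by blast
qed

section \<open>Drawn cycles and the faces beside an edge\<close>

locale plane_drawing =
  fixes E :: "'a uprod set" and C :: "'a set" and pos :: "'a \<Rightarrow> complex" and \<gamma> :: "'a \<Rightarrow> 'a \<Rightarrow> real \<Rightarrow> complex"
  assumes arcs: "\<And>a b. a \<in> C \<Longrightarrow> b \<in> C \<Longrightarrow> Upair a b \<in> E \<Longrightarrow>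
            arc (\<gamma> a b) \<and> pathstart (\<gamma> a b) = pos a \<and> pathfinish (\<gamma> a b) = pos b \<and>
            path_image (\<gamma> a b) = path_image (\<gamma> b a) \<and>
            path_image (\<gamma> a b) \<inter> pos ` C = {pos a, pos b}"
    and crossings: "\<And>a b c d. a \<in> C \<Longrightarrow> b \<in> C \<Longrightarrow> c \<in> C \<Longrightarrow> d \<in> C \<Longrightarrow> Upair a b \<in> E \<Longrightarrow> Upair c d \<in> E \<Longrightarrow>
            Upair a b \<noteq> Upair c d \<Longrightarrow> path_image (\<gamma> a b) \<inter> path_image (\<gamma> c d) \<subseteq> pos ` ({a, b} \<inter> {c, d})"
begin

definition ink :: "'a uprod set \<Rightarrow> complex set" where
  "ink F = \<Union>{path_image (\<gamma> a b) | a b. Upair a b \<in> F}"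

definition inC :: "'a uprod set \<Rightarrow> bool" where
  "inC F \<longleftrightarrow> F \<subseteq> E \<and> (\<forall>a b. Upair a b \<in> F \<longrightarrow> a \<in> C \<and> b \<in> C)"

lemma ink_insert:
  assumes "inC (insert (Upair a b) F)"
  shows "ink (insert (Upair a b) F) = path_image (\<gamma> a b) \<union> ink F"
proof -
  have "path_image (\<gamma> a b) = path_image (\<gamma> b a)" using assms arcs[of a b] unfolding inC_def by blast
  then show ?thesis unfolding ink_def by (auto simp: Upair_inject)
qed

lemma ink_path:
  assumes "inC (path_edges ds)" "2 \<le> length ds"
  shows "compact (ink (path_edges ds)) \<and> connected (ink (path_edges ds)) \<and> pos (hd ds) \<in> ink (path_edges ds) \<and> pos (last ds) \<in> ink (path_edges ds)"
  using assms
proof (induction ds)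
  case (Cons a ds)
  show ?case
  proof (cases ds)
    case Nil
    then show ?thesis using Cons.prems by simp
  next
    case (Cons b es)
    have pe: "path_edges (a # ds) = insert (Upair a b) (path_edges ds)"
    proof (intro set_eqI iffI)
      fix d assume "d \<in> path_edges (a # ds)"
      then obtain k where k: "d = Upair ((a # ds) ! k) ((a # ds) ! Suc k)" "Suc k < length (a # ds)"
        unfolding path_edges_def by blast
      show "d \<in> insert (Upair a b) (path_edges ds)"
      proof (cases k)
        case 0 then show ?thesis using k Cons by simp
      next
        case (Suc j) then show ?thesis using k unfolding path_edges_def by auto
      qed
    next
      fix d assume "d \<in> insert (Upair a b) (path_edges ds)"
      then consider "d = Upair a b" | j where "d = Upair (ds ! j) (ds ! Suc j)" "Suc j < length ds" unfolding path_edges_def by blast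
      then show "d \<in> path_edges (a # ds)"
      proof cases
        case 1 then show ?thesis unfolding path_edges_def using Cons by (intro CollectI exI[of _ 0]) simp
      next
        case 2 then show ?thesis unfolding path_edges_def by (intro CollectI exI[of _ "Suc j"]) simp
      qed
    qed
    have inC: "inC (insert (Upair a b) (path_edges ds))" using Cons.prems(1) pe by simp
    have ab: "a \<in> C" "b \<in> C" "Upair a b \<in> E" using inC unfolding inC_def by blast+
    note ar = arcs[OF ab]
    have g: "compact (path_image (\<gamma> a b))" "connected (path_image (\<gamma> a b))" "pos a \<in> path_image (\<gamma> a b)" "pos b \<in> path_image (\<gamma> a b)"
      using ar compact_path_image[OF arc_imp_path] connected_path_image[OF arc_imp_path]
        pathstart_in_path_image[of "\<gamma> a b"] pathfinish_in_path_image[of "\<gamma> a b"] by metis+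
    have ink: "ink (path_edges (a # ds)) = path_image (\<gamma> a b) \<union> ink (path_edges ds)"
      unfolding pe by (rule ink_insert[OF inC])
    show ?thesis
    proof (cases "es = []")
      case True
      then have "path_edges ds = {}" using Cons by (simp add: path_edges_def)
      then have "ink (path_edges ds) = {}" by (simp add: ink_def)
      then show ?thesis unfolding ink using g True Cons by simp
    next
      case False
      then have "2 \<le> length ds" using Cons by (cases es) auto
      moreover have "inC (path_edges ds)" using inC unfolding inC_def by blast
      ultimately have IH: "compact (ink (path_edges ds))" "connected (ink (path_edges ds))" "pos (hd ds) \<in> ink (path_edges ds)"
        "pos (last ds) \<in> ink (path_edges ds)" using Cons.IH by auto
      have "pos b \<in> ink (path_edges ds)" using IH(3) Cons by simp
      then have "connected (path_image (\<gamma> a b) \<union> ink (path_edges ds))" using g IH by (intro connected_Un) auto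
      then show ?thesis unfolding ink using g IH Cons by (auto intro: compact_Un)
    qed
  qed
qed simp

text \<open>Splits the drawn cycle into one arc and a connected remainder that touches it at the
  ends only, as \<open>arc_local_sides\<close> requires.\<close>

lemma cycle_ink:
  assumes cs: "is_cycle E cs" "inC (cycle_edges cs)" and e: "Upair a b \<in> cycle_edges cs"
  obtains c where "compact c" "connected c" "pos a \<in> c" "pos b \<in> c" "ink (cycle_edges cs) = path_image (\<gamma> a b) \<union> c"
    "c \<inter> path_image (\<gamma> a b) \<subseteq> {pos a, pos b}"
proof -
  have c: "distinct cs" "3 \<le> length cs" using cs(1) unfolding is_cycle_def by auto
  obtain i where i: "i < length cs" "Upair a b = Upair (cs ! i) (cs ! ((i + 1) mod length cs))"
    using e unfolding cycle_edges_def by blast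
  obtain ds where ds: "length ds = length cs" "last ds = cs ! i" "hd ds = cs ! ((i + 1) mod length cs)"
    "cycle_edges cs = insert (Upair (last ds) (hd ds)) (path_edges ds)" "Upair (last ds) (hd ds) \<notin> path_edges ds"
    using cycle_cut_open[OF c i(1)] by metis
  have eq: "Upair (last ds) (hd ds) = Upair a b" unfolding ds(2,3) i(2) ..
  have ce: "cycle_edges cs = insert (Upair a b) (path_edges ds)" "Upair a b \<notin> path_edges ds" using ds(4,5) eq by metis+
  have inp: "inC (path_edges ds)" using cs(2) ce(1) unfolding inC_def by blast
  have "2 \<le> length ds" using ds(1) c by simp
  note ip = ink_path[OF inp this]
  have ends: "last ds = a \<and> hd ds = b \<or> last ds = b \<and> hd ds = a" using eq by simp
  have ab: "a \<in> C" "b \<in> C" "Upair a b \<in> E" using cs(2) e unfolding inC_def by blast+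
  have "ink (path_edges ds) \<inter> path_image (\<gamma> a b) \<subseteq> {pos a, pos b}"
  proof
    fix q assume q: "q \<in> ink (path_edges ds) \<inter> path_image (\<gamma> a b)"
    then obtain u w where uw: "Upair u w \<in> path_edges ds" "q \<in> path_image (\<gamma> u w)" unfolding ink_def by blast
    have "u \<in> C" "w \<in> C" "Upair u w \<in> E" using inp uw(1) unfolding inC_def by blast+
    moreover have "Upair a b \<noteq> Upair u w" using uw(1) ce(2) by metis
    ultimately have "path_image (\<gamma> a b) \<inter> path_image (\<gamma> u w) \<subseteq> pos ` ({a, b} \<inter> {u, w})" using crossings ab by metis
    then show "q \<in> {pos a, pos b}" using q uw(2) by blast
  qed
  moreover have "ink (cycle_edges cs) = path_image (\<gamma> a b) \<union> ink (path_edges ds)"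
    unfolding ce(1) by (rule ink_insert) (use cs(2) ce(1) in simp)
  moreover have "pos a \<in> ink (path_edges ds)" "pos b \<in> ink (path_edges ds)" using ip ends by auto
  ultimately show ?thesis using that[of "ink (path_edges ds)"] ip by blast
qed

lemma arc_midpoint:
  assumes "a \<in> C" "b \<in> C" "Upair a b \<in> E"
  shows "\<gamma> a b (1/2) \<in> path_image (\<gamma> a b)" "\<gamma> a b (1/2) \<notin> pos ` C"
proof -
  show pim: "\<gamma> a b (1/2) \<in> path_image (\<gamma> a b)" by (auto simp: path_image_def)
  have inj: "inj_on (\<gamma> a b) {0..1}" and ends: "\<gamma> a b 0 = pos a" "\<gamma> a b 1 = pos b"
    using arcs[OF assms] by (auto simp: arc_def pathstart_def pathfinish_def)
  have "\<gamma> a b (1/2) \<noteq> \<gamma> a b 0" "\<gamma> a b (1/2) \<noteq> \<gamma> a b 1"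
    using inj_onD[OF inj, of "1/2" 0] inj_onD[OF inj, of "1/2" 1] by auto
  then have "\<gamma> a b (1/2) \<notin> {pos a, pos b}" using ends by simp
  moreover have "path_image (\<gamma> a b) \<inter> pos ` C = {pos a, pos b}" using arcs[OF assms] by blast
  ultimately show "\<gamma> a b (1/2) \<notin> pos ` C" using pim by blast
qed

text \<open>A small disc about the midpoint of the arc avoids the drawing of \<open>F\<close> and
  meets both sets, because the arc lies in their frontiers; it is a bridge between them.\<close>

lemma face_sides_other:
  assumes F: "inC F" and closed: "closed (ink F)" and d: "a \<in> C" "b \<in> C" "Upair a b \<in> E" "Upair a b \<notin> F"
    and X: "connected X" "X \<inter> ink F = {}" "path_image (\<gamma> a b) \<subseteq> frontier X"
    and Y: "connected Y" "Y \<inter> ink F = {}" "path_image (\<gamma> a b) \<subseteq> frontier Y"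
    and u: "u \<in> X" "w \<in> Y"
  shows "connected_component (- ink F) u w"
proof -
  define q where "q = \<gamma> a b (1/2)"
  note mp = arc_midpoint[OF d(1-3), folded q_def]
  have "q \<notin> ink F"
  proof
    assume "q \<in> ink F"
    then obtain c e where ce: "Upair c e \<in> F" "q \<in> path_image (\<gamma> c e)" unfolding ink_def by blast
    have inCE: "c \<in> C" "e \<in> C" "Upair c e \<in> E" using ce(1) F unfolding inC_def by blast+
    have "Upair a b \<noteq> Upair c e" using ce(1) d(4) by metis
    then have "q \<in> pos ` ({a, b} \<inter> {c, e})" using crossings[OF d(1,2) inCE(1,2) d(3) inCE(3)] ce(2) mp(1) by blast
    then show False using mp(2) d by blast
  qed
  then obtain r where r: "r > 0" "ball q r \<subseteq> - ink F" using openE[of "- ink F" q] closed by (auto simp: open_Compl)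
  have meet: "Z \<inter> ball q r \<noteq> {}" if "path_image (\<gamma> a b) \<subseteq> frontier Z" for Z
  proof -
    have "q \<in> closure Z" using that mp(1) by (auto simp: frontier_def)
    then obtain z where "z \<in> Z" "dist z q < r" using r(1) unfolding closure_approachable by blast
    then show ?thesis by (auto simp: dist_commute)
  qed
  have "connected (X \<union> ball q r)" using X meet[OF X(3)] by (intro connected_Un) auto
  moreover have "(X \<union> ball q r) \<inter> Y \<noteq> {}" using meet[OF Y(3)] by blast
  ultimately have "connected ((X \<union> ball q r) \<union> Y)" using connected_Un[OF _ Y(1)] by blast
  moreover have "(X \<union> ball q r) \<union> Y \<subseteq> - ink F" using X Y r by blast
  ultimately show ?thesis unfolding connected_component_def using u by blast
qed

text \<open>If the cycle had both sets on one side, \<open>arc_local_sides\<close> would carry the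
  connection near the midpoint of the common arc over to the complement of the facial cycle of
  \<open>X\<close>. But that cycle is the frontier of \<open>X\<close>, and every connected set that
  leaves \<open>X\<close> meets it.\<close>

lemma face_sides_cycle:
  assumes cs: "is_cycle E cs" "inC (cycle_edges cs)" "Upair a b \<in> cycle_edges cs"
    and fs: "is_cycle E fs" "inC (cycle_edges fs)" "Upair a b \<in> cycle_edges fs"
    and X: "connected X" "X \<inter> ink (cycle_edges cs) = {}" "frontier X = ink (cycle_edges fs)"
    and Y: "connected Y" "Y \<inter> ink (cycle_edges cs) = {}" "path_image (\<gamma> a b) \<subseteq> frontier Y" "Y \<inter> ink (cycle_edges fs) = {}"
    and disj: "X \<inter> Y = {}" and u: "u \<in> X" "w \<in> Y"
  shows "\<not> connected_component (- ink (cycle_edges cs)) u w"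
proof
  assume cc: "connected_component (- ink (cycle_edges cs)) u w"
  have ab: "a \<in> C" "b \<in> C" "Upair a b \<in> E" using cs(2,3) unfolding inC_def by blast+
  note ar = arcs[OF ab]
  obtain c1 where c1: "compact c1" "connected c1" "pos a \<in> c1" "pos b \<in> c1" "ink (cycle_edges cs) = path_image (\<gamma> a b) \<union> c1"
    "c1 \<inter> path_image (\<gamma> a b) \<subseteq> {pos a, pos b}" using cycle_ink[OF cs] by metis
  obtain c2 where c2: "compact c2" "ink (cycle_edges fs) = path_image (\<gamma> a b) \<union> c2"
    "c2 \<inter> path_image (\<gamma> a b) \<subseteq> {pos a, pos b}" using cycle_ink[OF fs] by metis
  define p where "p = \<gamma> a b (1/2)"
  obtain r where r: "r > 0" "\<And>x y. x \<in> ball p r \<Longrightarrow> y \<in> ball p r \<Longrightarrow>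
    connected_component (- (path_image (\<gamma> a b) \<union> c1)) x y \<Longrightarrow> connected_component (- (path_image (\<gamma> a b) \<union> c2)) x y"
    using arc_local_sides[of "\<gamma> a b" c1 c2 "1/2"] ar c1 c2 unfolding p_def by (auto simp: compact_imp_closed)
  have meet: "\<exists>z. z \<in> Z \<and> z \<in> ball p r" if "path_image (\<gamma> a b) \<subseteq> frontier Z" for Z
  proof -
    have "p \<in> closure Z" using that arc_midpoint(1)[OF ab] by (auto simp: frontier_def p_def)
    then obtain z where "z \<in> Z" "dist z p < r" using r(1) unfolding closure_approachable by blast
    then show ?thesis by (auto simp: dist_commute)
  qed
  obtain u' where u': "u' \<in> X" "u' \<in> ball p r" using meet[of X] X(3) c2(2) by blast
  obtain w' where w': "w' \<in> Y" "w' \<in> ball p r" using meet[OF Y(3)] by blast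
  have "connected_component (- ink (cycle_edges cs)) u' u" unfolding connected_component_def
    using X u(1) u'(1) by (intro exI[of _ X]) blast
  moreover have "connected_component (- ink (cycle_edges cs)) w w'" unfolding connected_component_def
    using Y u(2) w'(1) by (intro exI[of _ Y]) blast
  ultimately have "connected_component (- ink (cycle_edges cs)) u' w'" using cc connected_component_trans by metis
  then have "connected_component (- ink (cycle_edges fs)) u' w'" using r(2)[OF u'(2) w'(2)] c1(5) c2(2) by metis
  then obtain t where t: "connected t" "t \<subseteq> - ink (cycle_edges fs)" "u' \<in> t" "w' \<in> t" unfolding connected_component_def by blast
  have "t \<inter> frontier X \<noteq> {}"
    using t u'(1) w'(1) disj by (intro connected_Int_frontier) blast+
  then show False using t(2) X(3) by blast
qed

end

section \<open>Duality of free and wired forests\<close>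

lemma cycle_edges_vertices:
  assumes "Upair a b \<in> cycle_edges cs" "cs \<noteq> []"
  shows "a \<in> set cs" "b \<in> set cs"
proof -
  obtain i where i: "Upair a b = Upair (cs ! i) (cs ! ((i + 1) mod length cs))" "i < length cs"
    using assms(1) unfolding cycle_edges_def by blast
  have "cs ! i \<in> set cs" "cs ! ((i + 1) mod length cs) \<in> set cs" using i(2) assms(2) by auto
  then show "a \<in> set cs" "b \<in> set cs" using i(1) by auto
qed

lemma cycle_vertex_gcomp:
  assumes "is_cycle E cs" "v \<in> set cs"
  shows "v \<in> gcomp E (cs ! 0)"
proof -
  have "path_edges cs \<subseteq> cycle_edges cs"
  proof
    fix d assume "d \<in> path_edges cs"
    then obtain k where k: "d = Upair (cs ! k) (cs ! Suc k)" "Suc k < length cs" unfolding path_edges_def by blast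
    then show "d \<in> cycle_edges cs" unfolding cycle_edges_def by (intro CollectI exI[of _ k]) simp
  qed
  then have "path_edges cs \<subseteq> E" using assms(1) unfolding is_cycle_def by blast
  moreover obtain k where "k < length cs" "v = cs ! k" using assms(2) by (metis in_set_conv_nth)
  ultimately show ?thesis using path_gcomp by metis
qed

lemma finite_cycle_edges: "finite (cycle_edges cs)"
proof -
  have "cycle_edges cs = (\<lambda>i. Upair (cs ! i) (cs ! ((i + 1) mod length cs))) ` {..<length cs}"
    unfolding cycle_edges_def by blast
  then show ?thesis by simp
qed

locale dual_planar_pair =
  fixes M :: "'a::polish_space measure" and E :: "'a uprod set"
    and Ms :: "'f::polish_space measure" and Es :: "'f uprod set"
    and fcyc :: "'f \<Rightarrow> nat \<Rightarrow> 'a" and flen :: "'f \<Rightarrow> nat"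
    and \<sigma> :: "'a uprod \<Rightarrow> 'f uprod" and R :: "('a uprod \<times> 'a uprod) set"
  assumes dual: "dual_planar_graphings M E Ms Es fcyc flen \<sigma>"
    and order: "borel_total_order M E R"
begin

definition face :: "'f \<Rightarrow> 'a list" where "face h = face_list fcyc flen h"

text \<open>Reversed because the least edge of a cycle stays least on the corresponding dual cut,
  whereas the wired forest collects the edges that are greatest on a finite cut.\<close>

definition dual_order :: "('f uprod \<times> 'f uprod) set" where
  "dual_order = {(a, b) \<in> Es \<times> Es. (the_inv_into E \<sigma> b, the_inv_into E \<sigma> a) \<in> R}"

lemma primal_graphing: "graphing M E" and dual_graphing: "graphing Ms Es" and bij: "bij_betw \<sigma> E Es"
  and \<sigma>_meas: "\<sigma> \<in> measurable (edge_space M E) (edge_space Ms Es)"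
  and \<tau>_meas: "the_inv_into E \<sigma> \<in> measurable (edge_space Ms Es) (edge_space M E)"
  and eta_\<sigma>: "A \<in> sets (edge_space M E) \<Longrightarrow> eta Ms Es (\<sigma> ` A) = eta M E A"
  and planar: "planar_component E fcyc flen (gcomp E x)"
  and face_cycle: "is_cycle E (face h)"
  using dual unfolding dual_planar_graphings_def face_def by blast+

lemma no_loops: "Upair x x \<notin> E" and finite_nbhd: "finite (nbhd E x)"
  using primal_graphing unfolding graphing_def by blast+

lemma R_order: "trans R" "irrefl R" "total_on E R" "R \<subseteq> E \<times> E"
  using borel_total_order_borel_order[OF primal_graphing order] order unfolding borel_total_order_def by auto

lemma inj_\<sigma>: "inj_on \<sigma> E" and image_\<sigma>: "\<sigma> ` E = Es" using bij by (auto simp: bij_betw_def)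

lemma \<tau>_\<sigma>: "e \<in> E \<Longrightarrow> the_inv_into E \<sigma> (\<sigma> e) = e" using inj_\<sigma> by (rule the_inv_into_f_f)

lemma dual_order_\<sigma>: "a \<in> E \<Longrightarrow> b \<in> E \<Longrightarrow> (\<sigma> a, \<sigma> b) \<in> dual_order \<longleftrightarrow> (b, a) \<in> R"
  using image_\<sigma> \<tau>_\<sigma> unfolding dual_order_def by auto

lemma upper_dual_order: "e \<in> E \<Longrightarrow> upper dual_order Es (\<sigma> e) = \<sigma> ` {d \<in> E. (d, e) \<in> R}"
  unfolding upper_def using dual_order_\<sigma> image_\<sigma> by auto

lemma \<sigma>_faces:
  assumes "e \<in> E" "\<sigma> e = Upair f g"
  shows "f \<noteq> g" "{h. e \<in> cycle_edges (face h)} = {f, g}"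
proof -
  have "\<forall>e\<in>E. \<exists>f g. f \<noteq> g \<and> {h. e \<in> cycle_edges (face h)} = {f, g} \<and> \<sigma> e = Upair f g"
    using dual unfolding dual_planar_graphings_def face_def by blast
  then obtain f' g' where fg: "f' \<noteq> g'" "{h. e \<in> cycle_edges (face h)} = {f', g'}" "\<sigma> e = Upair f' g'" using assms(1) by blast
  have "f = f' \<and> g = g' \<or> f = g' \<and> g = f'" using fg(3) assms(2) by simp
  then show "f \<noteq> g" "{h. e \<in> cycle_edges (face h)} = {f, g}" using fg(1,2) by auto
qed

lemma borel_dual_order: "borel_total_order Ms Es dual_order"
  unfolding borel_total_order_def
proof (intro conjI)
  show "dual_order \<subseteq> Es \<times> Es" unfolding dual_order_def by blast
  show "strict_linear_order_on Es dual_order"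
    unfolding strict_linear_order_on_def
  proof (intro conjI)
    show "trans dual_order" unfolding dual_order_def using R_order(1) by (auto simp: trans_def)
    show "irrefl dual_order" unfolding dual_order_def using R_order(2) by (auto simp: irrefl_def)
    show "total_on Es dual_order"
    proof (rule total_onI)
      fix a b assume ab: "a \<in> Es" "b \<in> Es" "a \<noteq> b"
      then obtain x y where xy: "x \<in> E" "y \<in> E" "a = \<sigma> x" "b = \<sigma> y" using image_\<sigma> by blast
      then have "(x, y) \<in> R \<or> (y, x) \<in> R" using ab(3) R_order(3) by (auto simp: total_on_def)
      then show "(a, b) \<in> dual_order \<or> (b, a) \<in> dual_order" using dual_order_\<sigma> xy by blast
    qed
  qed
  have "(\<lambda>p. (the_inv_into E \<sigma> (snd p), the_inv_into E \<sigma> (fst p))) \<in>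
      measurable (edge_space Ms Es \<Otimes>\<^sub>M edge_space Ms Es) (edge_space M E \<Otimes>\<^sub>M edge_space M E)"
    using \<tau>_meas by measurable
  moreover have "R \<in> sets (edge_space M E \<Otimes>\<^sub>M edge_space M E)" using order unfolding borel_total_order_def by blast
  ultimately have "(\<lambda>p. (the_inv_into E \<sigma> (snd p), the_inv_into E \<sigma> (fst p))) -` R \<inter> space (edge_space Ms Es \<Otimes>\<^sub>M edge_space Ms Es)
      \<in> sets (edge_space Ms Es \<Otimes>\<^sub>M edge_space Ms Es)" by (rule measurable_sets)
  moreover have "(\<lambda>p. (the_inv_into E \<sigma> (snd p), the_inv_into E \<sigma> (fst p))) -` R \<inter> space (edge_space Ms Es \<Otimes>\<^sub>M edge_space Ms Es) = dual_order"
    unfolding dual_order_def by (auto simp: space_pair_measure)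
  ultimately show "dual_order \<in> sets (edge_space Ms Es \<Otimes>\<^sub>M edge_space Ms Es)" by simp
qed

text \<open>The mod 2 boundary of a finite set of faces is a finite even graph, so each of its edges lies on a cycle in it.\<close>

lemma dual_cut_imp_not_free:
  assumes e: "e \<in> E" and cut: "\<sigma> e \<in> wired_cut Es dual_order"
  shows "e \<notin> free_msf E R"
proof -
  obtain f g where fg: "\<sigma> e = Upair f g" and gK: "g \<notin> gcomp (upper dual_order Es (\<sigma> e)) f" and finK: "finite (gcomp (upper dual_order Es (\<sigma> e)) f)"
    using cut unfolding wired_cut_def by blast
  define K where "K = gcomp (upper dual_order Es (\<sigma> e)) f"
  define inc where "inc d = {h \<in> K. d \<in> cycle_edges (face h)}" for d
  define \<delta> where "\<delta> = {d \<in> E. odd (card (inc d))}"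
  have fK: "finite K" using finK by (simp add: K_def)
  have "d \<in> (\<Union>h\<in>K. cycle_edges (face h))" if "d \<in> \<delta>" for d
  proof (rule ccontr)
    assume "d \<notin> (\<Union>h\<in>K. cycle_edges (face h))"
    then have "inc d = {}" by (auto simp: inc_def)
    then show False using that by (simp add: \<delta>_def)
  qed
  then have \<delta>sub: "\<delta> \<subseteq> (\<Union>h\<in>K. cycle_edges (face h))" by blast
  have finU: "finite (\<Union>h\<in>K. cycle_edges (face h))" using fK finite_cycle_edges by blast
  then have fin\<delta>: "finite \<delta>" using \<delta>sub finite_subset by blast
  have even: "even (card {d \<in> \<delta>. v \<in> set_uprod d})" for v
  proof -
    define Dv where "Dv = {d \<in> (\<Union>h\<in>K. cycle_edges (face h)). v \<in> set_uprod d}"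
    have finD: "finite Dv" unfolding Dv_def by (rule finite_subset[OF _ finU]) auto
    have UE: "(\<Union>h\<in>K. cycle_edges (face h)) \<subseteq> E" using face_cycle unfolding is_cycle_def by blast
    \<comment> \<open>Incidences at \<open>v\<close> are counted by edges and by faces; every facial
      cycle has even degree at \<open>v\<close>.\<close>
    have "(\<Sum>d\<in>Dv. card (inc d)) = (\<Sum>h\<in>K. card {d \<in> Dv. d \<in> cycle_edges (face h)})"
      unfolding inc_def by (rule sum_multicount_gen[OF finD fK]) simp
    moreover have "even (\<Sum>h\<in>K. card {d \<in> Dv. d \<in> cycle_edges (face h)})"
    proof (rule dvd_sum)
      fix h assume "h \<in> K"
      then have "{d \<in> Dv. d \<in> cycle_edges (face h)} = {d \<in> cycle_edges (face h). v \<in> set_uprod d}" by (auto simp: Dv_def)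
      then show "even (card {d \<in> Dv. d \<in> cycle_edges (face h)})"
        using cycle_even_degree[of "face h" v] face_cycle[of h] unfolding is_cycle_def by metis
    qed
    ultimately have "even (\<Sum>d\<in>Dv. card (inc d))" by simp
    then have "even (card {d \<in> Dv. odd (card (inc d))})" using even_sum_iff[OF finD, of "\<lambda>d. card (inc d)"] by simp
    moreover have "{d \<in> Dv. odd (card (inc d))} = {d \<in> \<delta>. v \<in> set_uprod d}"
      using subsetD[OF \<delta>sub] subsetD[OF UE] unfolding Dv_def \<delta>_def mem_Collect_eq by blast
    ultimately show ?thesis by simp
  qed
  have fgK: "{h. e \<in> cycle_edges (face h)} = {f, g}" by (rule \<sigma>_faces(2)[OF e fg])
  have "inc e = K \<inter> {h. e \<in> cycle_edges (face h)}" by (auto simp: inc_def)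
  also have "\<dots> = {f}" unfolding fgK using gK by (auto simp: K_def)
  finally have e\<delta>: "e \<in> \<delta>" using e by (simp add: \<delta>_def)
  \<comment> \<open>The dual of an edge below \<open>e\<close> is used in building the cluster
    \<open>K\<close>, so both of its faces lie in \<open>K\<close> or neither does, and the edge
    cancels modulo 2.\<close>
  have above: "d = e \<or> (e, d) \<in> R" if d: "d \<in> \<delta>" for d
  proof (rule ccontr)
    assume no: "\<not> (d = e \<or> (e, d) \<in> R)"
    have dE: "d \<in> E" using d by (simp add: \<delta>_def)
    then have de: "(d, e) \<in> R" using no R_order(3) e unfolding total_on_def by blast
    obtain f' g' where fg': "\<sigma> d = Upair f' g'" by (cases "\<sigma> d") auto
    have up: "Upair f' g' \<in> upper dual_order Es (\<sigma> e)" unfolding upper_dual_order[OF e] fg'[symmetric] using dE de by blast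
    have "f' \<in> K \<longleftrightarrow> g' \<in> K"
      using gcomp_edge[of f' "upper dual_order Es (\<sigma> e)" f g'] gcomp_edge[of g' "upper dual_order Es (\<sigma> e)" f f'] up
      unfolding K_def Upair_commute[of g' f'] by blast
    moreover have "inc d = K \<inter> {h. d \<in> cycle_edges (face h)}" by (auto simp: inc_def)
    then have "inc d = K \<inter> {f', g'}" using \<sigma>_faces(2)[OF dE fg'] by simp
    ultimately have "inc d = {} \<or> inc d = {f', g'}" by auto
    moreover have "even (card {f', g'})" using \<sigma>_faces(1)[OF dE fg'] by simp
    ultimately have "even (card (inc d))" by (metis card.empty even_zero)
    then show False using d by (simp add: \<delta>_def)
  qed
  obtain x y where xy: "e = Upair x y" by (cases e) auto
  have "y \<in> gcomp (\<delta> - {Upair x y}) x"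
  proof (rule even_subgraph_edge_connected[OF fin\<delta>])
    show "Upair v v \<notin> \<delta>" for v using no_loops by (simp add: \<delta>_def)
    show "Upair x y \<in> \<delta>" using e\<delta> xy by simp
  qed (rule even)
  moreover have "\<delta> - {Upair x y} \<subseteq> upper R E (Upair x y)"
  proof
    fix d assume d: "d \<in> \<delta> - {Upair x y}"
    then have "(e, d) \<in> R" using above[of d] xy by simp
    then show "d \<in> upper R E (Upair x y)" using d xy by (simp add: upper_def \<delta>_def)
  qed
  ultimately have "y \<in> gcomp (upper R E (Upair x y)) x" using subsetD[OF gcomp_mono] by metis
  moreover have "x \<noteq> y" using e no_loops xy by auto
  ultimately show ?thesis using not_free_msf_iff[of x y E R] e R_order(2) unfolding xy by simp
qed

text \<open>The drawn cycle separates the two faces at \<open>e\<close>, and at least one of them is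
  in a bounded complementary component. A dual edge coming from an edge below \<open>e\<close>
  cannot cross the cycle, whose edges are all at least \<open>e\<close>. So the dual cluster of that
  face stays on the bounded side, where only finitely many faces fit.\<close>

lemma not_free_imp_dual_cut:
  assumes e: "e \<in> E" and nf: "e \<notin> free_msf E R"
  shows "\<sigma> e \<in> wired_cut Es dual_order"
proof -
  obtain cs where cs: "is_cycle E cs" "e \<in> cycle_edges cs" "\<forall>e'\<in>cycle_edges cs. e' \<noteq> e \<longrightarrow> (e, e') \<in> R"
    using e nf unfolding free_msf_def by blast
  obtain x y where xy: "e = Upair x y" by (cases e) (rule that)
  define C where "C = gcomp E x"
  obtain pos :: "'a \<Rightarrow> complex" and \<gamma> \<Phi> where
    locfin: "\<forall>r. finite {x\<in>C. norm (pos x) \<le> r}" and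
    arcs: "\<forall>a\<in>C. \<forall>b\<in>C. Upair a b \<in> E \<longrightarrow>
            arc (\<gamma> a b) \<and> pathstart (\<gamma> a b) = pos a \<and> pathfinish (\<gamma> a b) = pos b \<and>
            path_image (\<gamma> a b) = path_image (\<gamma> b a) \<and>
            path_image (\<gamma> a b) \<inter> pos ` C = {pos a, pos b}" and
    crossings: "\<forall>a\<in>C. \<forall>b\<in>C. \<forall>c\<in>C. \<forall>d\<in>C. Upair a b \<in> E \<longrightarrow> Upair c d \<in> E \<longrightarrow>
            Upair a b \<noteq> Upair c d \<longrightarrow>
            path_image (\<gamma> a b) \<inter> path_image (\<gamma> c d) \<subseteq> pos ` ({a, b} \<inter> {c, d})" and
    \<Phi>: "bij_betw \<Phi> {f. fcyc f 0 \<in> C}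
                 (components (- (pos ` C \<union>
                    \<Union>{path_image (\<gamma> a b) | a b. a \<in> C \<and> b \<in> C \<and> Upair a b \<in> E})))" and
    fr: "\<forall>f. fcyc f 0 \<in> C \<longrightarrow> frontier (\<Phi> f) =
                   \<Union>{path_image (\<gamma> a b) | a b. Upair a b \<in> cycle_edges (face_list fcyc flen f)}"
    using planar[of x] unfolding planar_component_def C_def[symmetric]
    by (elim exE conjE) (rule that; assumption)
  interpret plane_drawing E C pos \<gamma> by standard (use arcs crossings in blast)+
  have Ccl: "b \<in> C" if "a \<in> C" "b \<in> gcomp E a" for a b using that gcomp_trans unfolding C_def by metis
  have cycC: "inC (cycle_edges ds)" if ds: "is_cycle E ds" "v \<in> set ds" "v \<in> C" for ds v
  proof -
    have "ds \<noteq> []" using ds(2) by auto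
    have "w \<in> C" if "w \<in> set ds" for w
    proof -
      have "w \<in> gcomp E v" using cycle_vertex_gcomp[OF ds(1) that] cycle_vertex_gcomp[OF ds(1,2)] gcomp_sym gcomp_trans by metis
      then show ?thesis using Ccl ds(3) by blast
    qed
    then show ?thesis unfolding inC_def using cycle_edges_vertices \<open>ds \<noteq> []\<close> ds(1) unfolding is_cycle_def by metis
  qed
  define Fc where "Fc = {f. fcyc f 0 \<in> C}"
  have face_len: "3 \<le> flen h" for h using face_cycle[of h] unfolding is_cycle_def face_def face_list_def by simp
  have face_nth: "face h ! k = fcyc h k" if "k < flen h" for h k using that by (simp add: face_def face_list_def)
  have root: "fcyc h 0 \<in> set (face h)" for h
    using face_len[of h] by (auto simp: face_def face_list_def)
  have faceC: "inC (cycle_edges (face h))" if "h \<in> Fc" for h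
    using cycC[OF face_cycle root] that by (simp add: Fc_def)
  have face_in: "h \<in> Fc" if d: "Upair a b \<in> cycle_edges (face h)" and a: "a \<in> C" for h a b
  proof -
    have ne: "face h \<noteq> []" using root[of h] by auto
    have "a \<in> set (face h)" by (rule cycle_edges_vertices(1)[OF d ne])
    then have "fcyc h 0 \<in> gcomp E a"
      using cycle_vertex_gcomp[OF face_cycle, of a h] face_nth[of 0 h] face_len[of h] gcomp_sym by (metis less_le_trans zero_less_numeral)
    then show ?thesis using Ccl a by (simp add: Fc_def)
  qed
  have xC: "x \<in> C" by (simp add: C_def)
  have csC: "inC (cycle_edges cs)"
  proof (rule cycC[OF cs(1) _ xC])
    have "cs \<noteq> []" using cs(1) unfolding is_cycle_def by auto
    then show "x \<in> set cs" using cycle_edges_vertices(1)[of x y cs] cs(2) xy by blast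
  qed
  define Dr where "Dr = pos ` C \<union> \<Union>{path_image (\<gamma> a b) | a b. a \<in> C \<and> b \<in> C \<and> Upair a b \<in> E}"
  have inkD: "ink F \<subseteq> Dr" if "inC F" for F
    unfolding ink_def Dr_def using that unfolding inC_def by blast
  have comp: "\<Phi> h \<in> components (- Dr)" if "h \<in> Fc" for h
    using \<Phi> that unfolding bij_betw_def Fc_def Dr_def by blast
  have conn: "connected (\<Phi> h)" and ne: "\<Phi> h \<noteq> {}" and off: "\<Phi> h \<subseteq> - Dr" if "h \<in> Fc" for h
    using in_components_connected[OF comp[OF that]] in_components_nonempty[OF comp[OF that]] in_components_subset[OF comp[OF that]] by auto
  have frontier: "frontier (\<Phi> h) = ink (cycle_edges (face h))" if "h \<in> Fc" for h
    using fr that unfolding ink_def face_def Fc_def by blast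
  have disj: "\<Phi> h \<inter> \<Phi> h' = {}" if "h \<in> Fc" "h' \<in> Fc" "h \<noteq> h'" for h h'
  proof -
    have "\<Phi> h \<noteq> \<Phi> h'" using \<Phi> that unfolding bij_betw_def Fc_def inj_on_def by blast
    then show ?thesis using components_nonoverlap[OF comp[OF that(1)] comp[OF that(2)]] by blast
  qed
  define J where "J = ink (cycle_edges cs)"
  have offJ: "\<Phi> h \<inter> J = {}" if "h \<in> Fc" for h using off[OF that] inkD[OF csC] by (auto simp: J_def)
  have "Upair x y \<in> cycle_edges cs" using cs(2) xy by simp
  from cycle_ink[OF cs(1) csC this] obtain c where "compact c" "J = path_image (\<gamma> x y) \<union> c" unfolding J_def by metis
  moreover have "y \<in> C" "Upair x y \<in> E" using csC \<open>Upair x y \<in> cycle_edges cs\<close> unfolding inC_def by blast+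
  then have "compact (path_image (\<gamma> x y))" using arcs xC by (intro compact_path_image arc_imp_path) blast
  ultimately have Jc: "compact J" by (simp add: compact_Un)
  \<comment> \<open>Stated for an arbitrary face at \<open>e\<close>, since it is not known in
    advance which side is bounded.\<close>
  have key: "\<sigma> e \<in> wired_cut Es dual_order"
    if kk: "\<sigma> e = Upair k k'" and kF: "k \<in> Fc" and u: "u \<in> \<Phi> k"
      and bd: "bounded (connected_component_set (- J) u)" and sep: "\<not> \<Phi> k' \<subseteq> connected_component_set (- J) u" for k k' u
  proof -
    define Z where "Z = connected_component_set (- J) u"
    define H where "H = {h \<in> Fc. \<Phi> h \<subseteq> Z}"
    have "\<Phi> k \<subseteq> Z" unfolding Z_def using conn[OF kF] offJ[OF kF] u by (intro connected_component_maximal) auto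
    then have kH: "k \<in> H" using kF by (simp add: H_def)
    have sub: "gcomp (upper dual_order Es (\<sigma> e)) k \<subseteq> H"
    proof (rule gcomp_subset_closed[OF kH])
      fix h h' assume h: "h \<in> H" and "Upair h h' \<in> upper dual_order Es (\<sigma> e)"
      then obtain d where d: "d \<in> E" "(d, e) \<in> R" "\<sigma> d = Upair h h'" unfolding upper_dual_order[OF e] by auto
      have dh: "d \<in> cycle_edges (face h)" "d \<in> cycle_edges (face h')" using \<sigma>_faces(2)[OF d(1,3)] by blast+
      have hF: "h \<in> Fc" using h by (simp add: H_def)
      obtain a b where ab: "d = Upair a b" by (cases d) auto
      have abC: "a \<in> C" "b \<in> C" using faceC[OF hF] dh(1) unfolding ab inC_def by blast+
      have hF': "h' \<in> Fc" using face_in dh(2) abC(1) unfolding ab by blast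
      have "d \<notin> cycle_edges cs"
      proof
        assume "d \<in> cycle_edges cs"
        moreover have "d \<noteq> e" using d(2) R_order(2) by (auto simp: irrefl_def)
        ultimately have "(e, d) \<in> R" using cs(3) by blast
        then have "(e, e) \<in> R" using d(2) R_order(1) by (meson transD)
        then show False using R_order(2) by (simp add: irrefl_def)
      qed
      have pim: "path_image (\<gamma> a b) \<subseteq> frontier (\<Phi> l)" if "l \<in> Fc" "d \<in> cycle_edges (face l)" for l
        unfolding frontier[OF that(1)] ink_def using that(2) ab by blast
      obtain v where v: "v \<in> \<Phi> h" using ne[OF hF] by blast
      have "w \<in> Z" if w: "w \<in> \<Phi> h'" for w
      proof -
        have "connected_component (- ink (cycle_edges cs)) v w"
        proof (rule face_sides_other[OF csC])
          show "closed (ink (cycle_edges cs))" using Jc by (simp add: J_def compact_imp_closed)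
          show "Upair a b \<in> E" "Upair a b \<notin> cycle_edges cs" using d(1) \<open>d \<notin> cycle_edges cs\<close> ab by auto
          show "\<Phi> h \<inter> ink (cycle_edges cs) = {}" "\<Phi> h' \<inter> ink (cycle_edges cs) = {}"
            using offJ[OF hF] offJ[OF hF'] by (auto simp: J_def)
        qed (use abC conn[OF hF] conn[OF hF'] pim[OF hF dh(1)] pim[OF hF' dh(2)] v w in auto)
        moreover have "connected_component (- J) u v" using h v by (auto simp: H_def Z_def)
        ultimately show ?thesis unfolding Z_def J_def using connected_component_trans by (metis mem_Collect_eq)
      qed
      then show "h' \<in> H" using hF' by (auto simp: H_def)
    qed
    \<comment> \<open>Each of these faces has a boundary vertex in the bounded closure of
      \<open>Z\<close>. The drawing has finitely many such vertices, each has finite degree, and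
      each edge lies on two faces.\<close>
    have "finite H"
    proof -
      have "bounded (closure Z)" using bd by (simp add: Z_def bounded_closure)
      then obtain r where r: "\<And>z. z \<in> closure Z \<Longrightarrow> norm z \<le> r" unfolding bounded_iff by blast
      define V where "V = {v \<in> C. norm (pos v) \<le> r}"
      have "finite V" using locfin by (simp add: V_def)
      have "H \<subseteq> (\<Union>v\<in>V. \<Union>w\<in>nbhd E v. {h. Upair v w \<in> cycle_edges (face h)})"
      proof
        fix h assume h: "h \<in> H"
        then have hF: "h \<in> Fc" by (simp add: H_def)
        define v where "v = fcyc h 0"
        define w where "w = fcyc h 1"
        have vw: "Upair v w \<in> cycle_edges (face h)"
          unfolding cycle_edges_def using face_nth[of 0 h] face_nth[of 1 h] face_len[of h]
          by (intro CollectI exI[of _ 0]) (auto simp: v_def w_def face_def face_list_def)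
        have vC: "v \<in> C" "w \<in> C" "Upair v w \<in> E" using faceC[OF hF] vw unfolding inC_def by blast+
        have "pos v \<in> path_image (\<gamma> v w)" using arcs vC pathstart_in_path_image[of "\<gamma> v w"] by metis
        then have "pos v \<in> frontier (\<Phi> h)" unfolding frontier[OF hF] ink_def using vw by blast
        then have "pos v \<in> closure Z" using h closure_mono[of "\<Phi> h" Z] by (auto simp: frontier_def H_def)
        then have "v \<in> V" using r vC by (simp add: V_def)
        moreover have "w \<in> nbhd E v" using vC by (simp add: nbhd_def)
        ultimately show "h \<in> (\<Union>v\<in>V. \<Union>w\<in>nbhd E v. {h. Upair v w \<in> cycle_edges (face h)})" using vw by blast
      qed
      moreover have "finite {h. Upair v w \<in> cycle_edges (face h)}" if "w \<in> nbhd E v" for v w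
      proof -
        have vE: "Upair v w \<in> E" using that by (simp add: nbhd_def)
        obtain f' g' where "\<sigma> (Upair v w) = Upair f' g'" by (cases "\<sigma> (Upair v w)") auto
        from \<sigma>_faces(2)[OF vE this] show ?thesis by simp
      qed
      ultimately show ?thesis using \<open>finite V\<close> finite_nbhd by (auto elim!: finite_subset)
    qed
    moreover have "k' \<notin> H" using sep by (simp add: H_def Z_def)
    ultimately show ?thesis unfolding wired_cut_def using kk sub finite_subset image_\<sigma> e by blast
  qed
  obtain f g where fg: "\<sigma> e = Upair f g" by (cases "\<sigma> e") auto
  have fgf: "f \<noteq> g" "Upair x y \<in> cycle_edges (face f)" "Upair x y \<in> cycle_edges (face g)"
    using \<sigma>_faces[OF e fg] xy by blast+
  have fF: "f \<in> Fc" "g \<in> Fc" using face_in fgf(2,3) xC by blast+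
  obtain u w where uw: "u \<in> \<Phi> f" "w \<in> \<Phi> g" using ne fF by blast
  have nc: "\<not> connected_component (- J) u w"
    unfolding J_def
  proof (rule face_sides_cycle[OF cs(1) csC \<open>Upair x y \<in> cycle_edges cs\<close> face_cycle faceC[OF fF(1)] fgf(2) conn[OF fF(1)] _ frontier[OF fF(1)] conn[OF fF(2)]])
    show "\<Phi> f \<inter> ink (cycle_edges cs) = {}" "\<Phi> g \<inter> ink (cycle_edges cs) = {}" using offJ fF by (auto simp: J_def)
    show "path_image (\<gamma> x y) \<subseteq> frontier (\<Phi> g)" unfolding frontier[OF fF(2)] ink_def using fgf(3) by blast
    show "\<Phi> g \<inter> ink (cycle_edges (face f)) = {}" using off[OF fF(2)] inkD[OF faceC[OF fF(1)]] by blast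
    show "\<Phi> f \<inter> \<Phi> g = {}" by (rule disj[OF fF fgf(1)])
  qed (use uw in auto)
  have uJ: "u \<in> - J" "w \<in> - J" using uw offJ fF by blast+
  \<comment> \<open>In the plane the complement of a compact set has only one unbounded component,
    so the two distinct sides cannot both be unbounded.\<close>
  have "bounded (connected_component_set (- J) u) \<or> bounded (connected_component_set (- J) w)"
  proof (rule ccontr)
    assume nb: "\<not> ?thesis"
    have "bounded (- (- J))" using Jc by (simp add: compact_imp_bounded)
    moreover have "connected_component_set (- J) u \<in> components (- J)" "connected_component_set (- J) w \<in> components (- J)"
      using uJ by (auto intro: componentsI)
    ultimately have "connected_component_set (- J) u = connected_component_set (- J) w"
      using nb by (intro cobounded_unique_unbounded_components[of "- J"]) auto
    then have "w \<in> connected_component_set (- J) u" using uJ(2) by (simp add: connected_component_refl)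
    then show False using nc by simp
  qed
  then show ?thesis
  proof
    assume "bounded (connected_component_set (- J) u)"
    moreover have "\<not> \<Phi> g \<subseteq> connected_component_set (- J) u" using uw(2) nc by auto
    ultimately show ?thesis using key[OF fg fF(1) uw(1)] by blast
  next
    assume "bounded (connected_component_set (- J) w)"
    moreover have "\<not> \<Phi> f \<subseteq> connected_component_set (- J) w" using uw(1) nc connected_component_sym by fastforce
    moreover have "\<sigma> e = Upair g f" using fg by (simp add: Upair_commute)
    ultimately show ?thesis using key[OF _ fF(2) uw(2)] by blast
  qed
qed

lemma \<sigma>_free: "\<sigma> ` free_msf E R = Es - wired_cut Es dual_order"
proof -
  have "free_msf E R = {e \<in> E. \<sigma> e \<notin> wired_cut Es dual_order}"
  proof (intro set_eqI iffI)
    fix e assume f: "e \<in> free_msf E R"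
    then have "e \<in> E" by (simp add: free_msf_def)
    then show "e \<in> {e \<in> E. \<sigma> e \<notin> wired_cut Es dual_order}" using f dual_cut_imp_not_free by blast
  next
    fix e assume "e \<in> {e \<in> E. \<sigma> e \<notin> wired_cut Es dual_order}"
    then show "e \<in> free_msf E R" using not_free_imp_dual_cut by blast
  qed
  moreover have "\<sigma> ` {e \<in> E. \<sigma> e \<notin> wired_cut Es dual_order} = \<sigma> ` E - wired_cut Es dual_order" by blast
  ultimately show ?thesis by (simp only: image_\<sigma>)
qed

text \<open>\<open>measure_of\<close> depends only on values on measurable sets. There
  \<open>\<sigma>\<close> matches the free forest with the complement of the dual wired forest and
  preserves the edge measure.\<close>

lemma free_dual_measure_eq:
  "free_dual_measure M E Ms Es \<sigma> R = measure_of Es (sets (edge_space Ms Es)) (\<lambda>A. ennreal (eta Ms Es (A \<inter> (Es - wired_cut Es dual_order))))"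
  unfolding free_dual_measure_def
proof (rule measure_of_eq)
  show "sets (edge_space Ms Es) \<subseteq> Pow Es" using sets.space_closed[of "edge_space Ms Es"] by simp
  fix A assume "A \<in> sigma_sets Es (sets (edge_space Ms Es))"
  then have A: "A \<in> sets (edge_space Ms Es)" using sets.sigma_sets_eq[of "edge_space Ms Es"] by simp
  interpret O: ordered_graphing Ms Es dual_order using dual_graphing borel_dual_order by unfold_locales
  have top: "Es \<in> sets (edge_space Ms Es)" using sets.top[of "edge_space Ms Es"] by simp
  define B where "B = A \<inter> (Es - wired_cut Es dual_order)"
  have B: "B \<in> sets (edge_space Ms Es)" unfolding B_def using A top O.grank_facts(2)[OF top] by auto
  have free: "free_msf E R \<subseteq> E" by (auto simp: free_msf_def)
  have eq: "(\<sigma> -` A \<inter> E) \<inter> free_msf E R = \<sigma> -` B \<inter> E"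
  proof (intro set_eqI iffI)
    fix e assume "e \<in> (\<sigma> -` A \<inter> E) \<inter> free_msf E R"
    then show "e \<in> \<sigma> -` B \<inter> E" using \<sigma>_free by (auto simp: B_def)
  next
    fix e assume e: "e \<in> \<sigma> -` B \<inter> E"
    then have "\<sigma> e \<in> \<sigma> ` free_msf E R" unfolding \<sigma>_free by (simp add: B_def)
    then have "e \<in> free_msf E R" using inj_on_image_mem_iff[OF inj_\<sigma> _ free] e by blast
    then show "e \<in> (\<sigma> -` A \<inter> E) \<inter> free_msf E R" using e by (simp add: B_def)
  qed
  have "\<sigma> -` B \<inter> E \<in> sets (edge_space M E)" using measurable_sets[OF \<sigma>_meas B] by simp
  then have "eta Ms Es (\<sigma> ` (\<sigma> -` B \<inter> E)) = eta M E (\<sigma> -` B \<inter> E)" by (rule eta_\<sigma>)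
  moreover have "\<sigma> ` (\<sigma> -` B \<inter> E) = B" using image_\<sigma> by (auto simp: B_def)
  ultimately show "ennreal (eta M E ((\<sigma> -` A \<inter> E) \<inter> free_msf E R)) = ennreal (eta Ms Es (A \<inter> (Es - wired_cut Es dual_order)))"
    unfolding eq B_def by simp
qed

end

theorem theorem1p8:
  fixes M :: "'a::polish_space measure" and E :: "'a uprod set"
    and Ms :: "'f::polish_space measure" and Es :: "'f uprod set"
    and fcyc :: "'f \<Rightarrow> nat \<Rightarrow> 'a" and flen :: "'f \<Rightarrow> nat"
    and \<sigma> :: "'a uprod \<Rightarrow> 'f uprod"
    and R :: "('a uprod \<times> 'a uprod) set"
  assumes "dual_planar_graphings M E Ms Es fcyc flen \<sigma>"
    and "borel_total_order M E R"
  shows "exposed_point M E (grank M E) (wired_measure M E R)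
       \<and> exposed_point Ms Es (corank Ms Es) (free_dual_measure M E Ms Es \<sigma> R)"
proof
  interpret dual_planar_pair M E Ms Es fcyc flen \<sigma> R using assms by unfold_locales
  interpret P: ordered_graphing M E R using primal_graphing order by unfold_locales
  interpret Q: ordered_graphing Ms Es dual_order using dual_graphing borel_dual_order by unfold_locales
  have "wired_msf E R = wired_cut E R"
    by (rule wired_msf_eq_wired_cut[OF finite_nbhd no_loops R_order(2)])
  then show "exposed_point M E (grank M E) (wired_measure M E R)"
    unfolding wired_measure_def using P.exposed_wired_cut by simp
  show "exposed_point Ms Es (corank Ms Es) (free_dual_measure M E Ms Es \<sigma> R)"
    unfolding free_dual_measure_eq by (rule Q.exposed_wired_cut_complement)
qed

end
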